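(* The following identity holds: $$\sum_{n\geq 1} \left(\frac{-1}{27}\right)^n \frac{(1)_n^2}{(\frac13)_n (\frac23)_n}\cdot \frac{17-136 n+408 n^2-640 n^3+560 n^4}{n^5 (2n-1)^4} = 180\, \zeta (5)-\frac{56 \pi ^2 \zeta (3)}{3}.$$
   Context: For a number $a$ and an integer $n\ge 0$, $(a)_n := a(a+1)\cdots(a+n-1)$ denotes the rising factorial (Pochhammer symbol), and $(1)_n^2$ means $((1)_n)^2$. $\zeta(s)=\sum_{m\ge 1} m^{-s}$ is the Riemann zeta function. *)

theory Defs
  imports "HOL-Analysis.Analysis"
begin

text \<open>The Dirichlet series of the Riemann zeta function at real arguments; it is meaningful for
  \<open>s > 1\<close> only (for \<open>s \<le> 1\<close> the family is not summable and \<open>infsum\<close> returns \<open>0\<close>).\<close>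

definition zeta :: "real \<Rightarrow> real" where
  "zeta s = (\<Sum>\<^sub>\<infinity>m\<in>{1::nat..}. real m powr (- s))"

end

theory Submission
  imports Defs
begin

text \<open>Why the identity holds.  All work takes place in formal power series in one variable
\<open>X\<close>, where parameters are real multiples of \<open>X\<close>.  There are two families of terms \<open>F(n,m)\<close>,
called Q (two parameters \<open>d\<close>, \<open>b\<close>, with argument \<open>1/2\<close>) and D (parameters \<open>a\<close>,
\<open>u\<close>, \<open>v\<close>, a well-poised family of Dougall type), each with a Wilf--Zeilberger mate \<open>G(n,m)\<close>:
\<open>F(n+1,m+1) - F(n,m+1) = G(n,m+1) - G(n,m)\<close>.  Summing such a relation over the region
\<open>m \<ge> \<sigma>(n)\<close> shows that the row sum \<open>\<Sum>m. F(0,m)\<close> equals the sum of the contributions of the edge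
\<open>m = \<sigma>(n)\<close> (lemma \<open>wz_telescope\<close>).  On the edges \<open>m = n + 1\<close> (for Q) and \<open>m = 2 n + 1\<close> (for D), the contribution is
\<open>(-1)^n n!^3 / (3n+3)!\<close> times a rational function of \<open>n\<close> times a product of linear factors
\<open>1 + c X / j\<close>.

The row sums are known in closed form.  After multiplication by a constant multiple of
\<open>X\<^sup>2\<close> and addition of \<open>1\<close>, they are infinite products of linear factors over the odd and over the even numbers.
For the proof, a parameter is shifted by \<open>2\<close>: this multiplies the sum by an explicit ratio of linear
factors, and the sum tends to \<open>1\<close> when the shift is repeated (lemma \<open>coeff_5_of_shift_invariant_sum\<close>).  The coefficient of \<open>X^5\<close> of a
product with power sums \<open>h\<^sub>r\<close> and \<open>h\<^sub>1 = 0\<close> is \<open>h\<^sub>5 / 5 - h\<^sub>2 h\<^sub>3 / 6\<close>; here \<open>h\<^sub>r\<close> is a rational multiple of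
\<open>\<zeta>(r)\<close>.  Because of the factor \<open>X\<^sup>2\<close>, the coefficient of \<open>X\<^sup>3\<close> of each family
gives a series for a rational combination of \<open>\<zeta>(5)\<close> and \<open>\<zeta>(2) \<zeta>(3)\<close>.

The terms of these series contain harmonic sums up to weight three, because the coefficients of a product of
linear factors are polynomials in its power sums.  For the six parameter choices and weights of
\<open>combination\<close>, all harmonic sums cancel, term by term, and \<open>15\<close> times the summand of the theorem remains.  The
same combination of the closed forms is \<open>2700 \<zeta>(5) - 1680 \<zeta>(2) \<zeta>(3)\<close>.\<close>

section \<open>A norm on the first coefficients of a power series\<close>

text \<open>Only the coefficients up to \<open>X^5\<close> matter.  The weight \<open>1000\<close> is chosen so that \<open>x + c X\<close> with
\<open>\<bar>c\<bar> \<le> 10\<close> has norm at most \<open>x + 1/100\<close>: integer values of the parameters then behave like small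
perturbations, and the norm of a product over \<open>m\<close> such factors exceeds its constant term only by a small power of \<open>m\<close>.\<close>
definition coeff_norm :: "real fps \<Rightarrow> real" where
  "coeff_norm f = (\<Sum>i\<le>5. \<bar>fps_nth f i\<bar> / 1000 ^ i)"

lemma coeff_norm_nonneg [simp]: "0 \<le> coeff_norm f"
  unfolding coeff_norm_def by (intro sum_nonneg) auto

lemma coeff_le_norm: "i \<le> 5 \<Longrightarrow> \<bar>fps_nth f i\<bar> \<le> 1000 ^ i * coeff_norm f"
proof -
  assume i: "i \<le> 5"
  have "\<bar>fps_nth f i\<bar> / 1000 ^ i \<le> coeff_norm f"
    unfolding coeff_norm_def using i by (intro member_le_sum) auto
  thus ?thesis by (simp add: field_simps)
qed

lemma coeff_norm_mult: "coeff_norm (f * g) \<le> coeff_norm f * coeff_norm g"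
proof -
  define a where "a i = \<bar>fps_nth f i\<bar> / 1000 ^ i" for i
  define b where "b i = \<bar>fps_nth g i\<bar> / 1000 ^ i" for i
  have "coeff_norm (f * g) \<le> (\<Sum>k\<le>5. \<Sum>i\<le>k. a i * b (k - i))"
    unfolding coeff_norm_def
  proof (rule sum_mono)
    fix k :: nat
    have "\<bar>fps_nth (f * g) k\<bar> / 1000 ^ k \<le> (\<Sum>i\<le>k. \<bar>fps_nth f i * fps_nth g (k - i)\<bar>) / 1000 ^ k"
      unfolding fps_mult_nth atLeast0AtMost by (intro divide_right_mono sum_abs) auto
    also have "\<dots> = (\<Sum>i\<le>k. a i * b (k - i))"
      unfolding sum_divide_distrib
    proof (rule sum.cong)
      fix i assume "i \<in> {..k}"
      hence "(1000::real) ^ k = 1000 ^ i * 1000 ^ (k - i)" by (simp flip: power_add)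
      thus "\<bar>fps_nth f i * fps_nth g (k - i)\<bar> / 1000 ^ k = a i * b (k - i)"
        by (simp add: a_def b_def abs_mult)
    qed auto
    finally show "\<bar>fps_nth (f * g) k\<bar> / 1000 ^ k \<le> (\<Sum>i\<le>k. a i * b (k - i))" .
  qed
  also have "\<dots> = (\<Sum>(i,j)\<in>{(i,j). i + j \<le> 5}. a i * b j)"
    by (rule sum.triangle_reindex_eq [symmetric])
  also have "\<dots> \<le> (\<Sum>(i,j)\<in>{..5}\<times>{..5}. a i * b j)"
    by (rule sum_mono2) (auto simp: a_def b_def)
  also have "\<dots> = coeff_norm f * coeff_norm g"
    unfolding coeff_norm_def sum_product sum.cartesian_product a_def b_def by simp
  finally show ?thesis .
qed

lemma coeff_norm_const [simp]: "coeff_norm (fps_const c) = \<bar>c\<bar>"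
  by (simp add: coeff_norm_def sum.atMost_Suc_shift eval_nat_numeral)

definition lin :: "real \<Rightarrow> real \<Rightarrow> real fps" where
  "lin c x = fps_const x + fps_const c * fps_X"

lemma lin_nth: "fps_nth (lin c x) k = (if k = 0 then x else if k = 1 then c else 0)"
  by (simp add: lin_def)

lemma coeff_norm_lin: "coeff_norm (lin c x) = \<bar>x\<bar> + \<bar>c\<bar> / 1000"
  by (simp add: coeff_norm_def lin_nth eval_nat_numeral)

lemma inverse_lin:
  assumes "x \<noteq> 0"
  shows "inverse (lin c x) = Abs_fps (\<lambda>k. (-c) ^ k / x ^ Suc k)"
proof -
  have "lin c x * Abs_fps (\<lambda>k. (-c) ^ k / x ^ Suc k) = 1"
  proof (rule fps_ext)
    fix n
    show "fps_nth (lin c x * Abs_fps (\<lambda>k. (-c) ^ k / x ^ Suc k)) n = fps_nth 1 n"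
      using assms by (cases n) (simp_all add: lin_def algebra_simps fps_X_mult_nth)
  qed
  thus ?thesis by (rule fps_inverse_unique)
qed

lemma coeff_norm_inverse_lin:
  assumes "\<bar>c\<bar> / 1000 < x"
  shows "coeff_norm (inverse (lin c x)) \<le> 1 / (x - \<bar>c\<bar> / 1000)"
proof -
  define q where "q = \<bar>c\<bar> / 1000 / x"
  have x: "x > 0" using assms by (smt (verit) divide_nonneg_nonneg)
  have q: "0 \<le> q" "q < 1" using assms x by (auto simp: q_def field_simps)
  have "coeff_norm (inverse (lin c x)) = (\<Sum>k\<le>5. q ^ k) / x"
    unfolding coeff_norm_def inverse_lin[OF less_imp_neq[OF x, symmetric]] sum_divide_distrib
    by (intro sum.cong) (use x in \<open>auto simp: q_def power_divide abs_mult power_abs field_simps\<close>)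
  also have "(\<Sum>k\<le>5. q ^ k) \<le> 1 / (1 - q)"
  proof -
    have "(\<Sum>k\<le>5. q ^ k) = (1 - q ^ Suc 5) / (1 - q)" using sum_gp0[of q 5] q by simp
    also have "\<dots> \<le> 1 / (1 - q)" using q by (intro divide_right_mono) auto
    finally show ?thesis .
  qed
  also have "1 / (1 - q) / x = 1 / (x - \<bar>c\<bar> / 1000)"
    using x q by (simp add: q_def field_simps)
  finally show ?thesis using x by (simp add: divide_right_mono)
qed

section \<open>Power sums of a product of linear factors\<close>

text \<open>For \<open>f = k \<cdot> \<Prod>(1 + c\<^sub>i X)\<close>, the logarithmic derivative is \<open>\<Sum>r. (-1)^r p\<^sub>r\<^sub>+\<^sub>1 X^r\<close> with the power sums
\<open>p\<^sub>r = \<Sum>c\<^sub>i^r\<close>, where factors in the denominator count negatively.  Stated as a differential equation, this needs no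
logarithm and is stable under products and inverses.\<close>
definition power_sums :: "real fps \<Rightarrow> (nat \<Rightarrow> real) \<Rightarrow> bool" where
  "power_sums f h \<longleftrightarrow> fps_deriv f = f * Abs_fps (\<lambda>k. (-1) ^ k * h (Suc k))"

lemma power_sums_const: "power_sums (fps_const c) (\<lambda>r. 0)"
  by (simp add: power_sums_def fps_eq_iff)

lemma power_sums_mult: "power_sums f h \<Longrightarrow> power_sums g h' \<Longrightarrow> power_sums (f * g) (\<lambda>r. h r + h' r)"
proof -
  assume a: "power_sums f h" "power_sums g h'"
  have "Abs_fps (\<lambda>k. (-1) ^ k * (h (Suc k) + h' (Suc k))) =
        Abs_fps (\<lambda>k. (-1) ^ k * h (Suc k)) + Abs_fps (\<lambda>k. (-1) ^ k * h' (Suc k))"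
    by (simp add: fps_eq_iff algebra_simps)
  with a show ?thesis unfolding power_sums_def by (simp add: algebra_simps)
qed

lemma power_sums_inverse: "power_sums f h \<Longrightarrow> fps_nth f 0 \<noteq> 0 \<Longrightarrow> power_sums (inverse f) (\<lambda>r. - h r)"
proof -
  assume a: "power_sums f h" "fps_nth f 0 \<noteq> 0"
  have "Abs_fps (\<lambda>k. (-1) ^ k * (- h (Suc k))) = - Abs_fps (\<lambda>k. (-1) ^ k * h (Suc k))"
    by (simp add: fps_eq_iff)
  moreover have "inverse f * f = 1" using a by (simp add: inverse_mult_eq_1)
  hence "f * (inverse f)\<^sup>2 = inverse f" by (simp add: power2_eq_square mult.assoc[symmetric] mult.commute)
  ultimately show ?thesis using a unfolding power_sums_def
    by (simp add: fps_inverse_deriv mult_ac)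
qed

lemma power_sums_lin: "x \<noteq> 0 \<Longrightarrow> power_sums (lin c x) (\<lambda>r. (c / x) ^ r)"
proof -
  assume x: "x \<noteq> 0"
  have "Abs_fps (\<lambda>k. (-1) ^ k * (c / x) ^ Suc k) = fps_const c * inverse (lin c x)"
    unfolding inverse_lin[OF x] by (rule fps_ext) (simp add: power_divide power_minus[of c] field_simps)
  moreover have "lin c x * inverse (lin c x) = 1" using x by (intro inverse_mult_eq_1') (simp add: lin_nth)
  ultimately show ?thesis unfolding power_sums_def
    by (simp add: lin_def)
qed

text \<open>Newton's identities, obtained by comparing coefficients in the differential equation.\<close>
lemma power_sums_coeffs:
  assumes "power_sums f h"
  shows "fps_nth f 1 = fps_nth f 0 * h 1"
    and "fps_nth f 2 = fps_nth f 0 * ((h 1)\<^sup>2 - h 2) / 2"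
    and "fps_nth f 3 = fps_nth f 0 * ((h 1) ^ 3 - 3 * h 1 * h 2 + 2 * h 3) / 6"
    and "h 1 = 0 \<Longrightarrow> fps_nth f 4 = fps_nth f 0 * ((h 2)\<^sup>2 / 8 - h 4 / 4)"
    and "h 1 = 0 \<Longrightarrow> fps_nth f 5 = fps_nth f 0 * (h 5 / 5 - h 2 * h 3 / 6)"
proof -
  have rec: "of_nat (Suc k) * fps_nth f (Suc k) = (\<Sum>i=0..k. fps_nth f i * ((-1) ^ (k - i) * h (Suc (k - i))))" for k
    using arg_cong[OF assms[unfolded power_sums_def], of "\<lambda>g. fps_nth g k"] by (simp add: fps_mult_nth)
  show 1: "fps_nth f 1 = fps_nth f 0 * h 1" using rec[of 0] by simp
  show 2: "fps_nth f 2 = fps_nth f 0 * ((h 1)\<^sup>2 - h 2) / 2"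
    using rec[of 1] 1 by (simp add: eval_nat_numeral algebra_simps)
  have r2: "3 * fps_nth f 3 = fps_nth f 0 * h 3 - fps_nth f 1 * h 2 + fps_nth f 2 * h 1"
    using rec[of 2] by (simp add: eval_nat_numeral algebra_simps)
  show 3: "fps_nth f 3 = fps_nth f 0 * ((h 1) ^ 3 - 3 * h 1 * h 2 + 2 * h 3) / 6"
    using r2 unfolding 1 2 by (simp add: field_simps power3_eq_cube power2_eq_square)
  assume h: "h 1 = 0"
  have "4 * fps_nth f 4 = fps_nth f 2 * (- h 2) + fps_nth f 0 * (- h 4)"
    using rec[of 3] 1 h by (simp add: eval_nat_numeral)
  thus 4: "fps_nth f 4 = fps_nth f 0 * ((h 2)\<^sup>2 / 8 - h 4 / 4)"
    unfolding 2 h by (simp add: field_simps power2_eq_square)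
  have "5 * fps_nth f 5 = fps_nth f 0 * h 5 - fps_nth f 2 * h 3 * (-1) - fps_nth f 3 * h 2"
    using rec[of 4] 1 h by (simp add: eval_nat_numeral algebra_simps)
  thus "fps_nth f 5 = fps_nth f 0 * (h 5 / 5 - h 2 * h 3 / 6)"
    unfolding 2 3 h by (simp add: field_simps power2_eq_square)
qed

lemma coeff_norm_multI: "coeff_norm f \<le> a \<Longrightarrow> coeff_norm g \<le> b \<Longrightarrow> coeff_norm (f * g) \<le> a * b"
proof -
  assume a: "coeff_norm f \<le> a" "coeff_norm g \<le> b"
  hence "0 \<le> a" using coeff_norm_nonneg[of f] by linarith
  with a show ?thesis by (intro order_trans[OF coeff_norm_mult] mult_mono) auto
qed

lemma coeff_norm_1 [simp]: "coeff_norm 1 = 1"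
  unfolding fps_const_1_eq_1[symmetric] coeff_norm_const by simp

lemma power_sums_prod:
  assumes "\<And>j. j < (k::nat) \<Longrightarrow> power_sums (f j) (h j)"
  shows "power_sums (\<Prod>j<k. f j) (\<lambda>r. \<Sum>j<k. h j r)"
  using assms
proof (induction k)
  case 0
  show ?case using power_sums_const[of 1] by simp
next
  case (Suc k)
  show ?case using power_sums_mult[OF Suc.IH Suc.prems[of k]] Suc.prems by simp
qed

section \<open>Products over arithmetic progressions and their growth\<close>

definition lin_prod :: "real \<Rightarrow> real \<Rightarrow> real \<Rightarrow> nat \<Rightarrow> real fps" where
  "lin_prod c r p k = (\<Prod>j<k. lin c (r + p * real j))"

definition scal_prod :: "real \<Rightarrow> real \<Rightarrow> nat \<Rightarrow> real" where
  "scal_prod r p k = (\<Prod>j<k. r + p * real j)"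

lemma lin_prod_0 [simp]: "lin_prod c r p 0 = 1" and lin_prod_Suc: "lin_prod c r p (Suc k) = lin_prod c r p k * lin c (r + p * real k)"
  by (simp_all add: lin_prod_def)

lemma scal_prod_0 [simp]: "scal_prod r p 0 = 1" and scal_prod_Suc: "scal_prod r p (Suc k) = scal_prod r p k * (r + p * real k)"
  by (simp_all add: scal_prod_def)

lemma lin_prod_shift: "lin_prod c r p (Suc k) = lin c r * lin_prod c (r + p) p k"
  unfolding lin_prod_def by (subst prod.lessThan_Suc_shift) (simp add: algebra_simps)

lemma scal_prod_pos: "r > 0 \<Longrightarrow> p \<ge> 0 \<Longrightarrow> scal_prod r p k > 0"
  unfolding scal_prod_def by (intro prod_pos) (auto intro: add_pos_nonneg)

lemma lin_prod_nth_0: "fps_nth (lin_prod c r p k) 0 = scal_prod r p k"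
  by (induction k) (simp_all add: lin_prod_Suc scal_prod_Suc lin_nth)

lemma inverse_lin_prod_Suc:
  assumes "r + p * real k \<noteq> 0"
  shows "inverse (lin_prod c r p k) = inverse (lin_prod c r p (Suc k)) * lin c (r + p * real k)"
proof -
  have "inverse (lin c (r + p * real k)) * lin c (r + p * real k) = 1"
    using assms by (intro inverse_mult_eq_1) (simp add: lin_nth)
  thus ?thesis by (simp add: lin_prod_Suc fps_inverse_mult mult.assoc)
qed

lemma power_sums_lin_prod:
  assumes "r > 0" "p \<ge> 0"
  shows "power_sums (lin_prod c r p k) (\<lambda>s. \<Sum>j<k. (c / (r + p * real j)) ^ s)"
  unfolding lin_prod_def
proof (rule power_sums_prod, rule power_sums_lin)
  fix j show "r + p * real j \<noteq> 0" using assms by (smt (verit) mult_nonneg_nonneg of_nat_0_le_iff)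
qed

lemma power_sums_inverse_lin_prod:
  assumes "r > 0" "p \<ge> 0"
  shows "power_sums (inverse (lin_prod c r p k)) (\<lambda>s. - (\<Sum>j<k. (c / (r + p * real j)) ^ s))"
  using power_sums_lin_prod[OF assms] scal_prod_pos[OF assms, of k] by (intro power_sums_inverse) (auto simp: lin_prod_nth_0)

text \<open>The norm of a product of \<open>k\<close> linear factors exceeds its constant term at most by this factor, which is a small
power of \<open>exp (harm k)\<close>, hence of \<open>k\<close>.\<close>
definition growth :: "nat \<Rightarrow> real" where "growth k = exp (harm k / 100)"

lemma growth_ge1: "1 \<le> growth k" by (simp add: growth_def harm_nonneg)
lemma growth_nonneg [simp]: "0 \<le> growth k" by (simp add: growth_def)
lemma growth_mono: "k \<le> m \<Longrightarrow> growth k \<le> growth m" by (simp add: growth_def harm_mono)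
lemma growth_Suc: "growth (Suc k) = growth k * exp (1 / (100 * real (Suc k)))"
  unfolding growth_def by (subst exp_add[symmetric]) (simp add: harm_Suc field_simps)

lemma coeff_norm_lin_prod:
  assumes "\<bar>c\<bar> \<le> 10" "r \<ge> 1" "p \<ge> 1"
  shows "coeff_norm (lin_prod c r p k) \<le> scal_prod r p k * growth k"
proof (induction k)
  case 0
  show ?case using growth_ge1[of 0] by simp
next
  case (Suc k)
  define x where "x = r + p * real k"
  have x: "x \<ge> real (Suc k)" using assms(2,3) mult_right_mono[OF assms(3), of "real k"] by (simp add: x_def)
  have "coeff_norm (lin c x) \<le> x + 1 / 100" using x assms(1) by (simp add: coeff_norm_lin)
  also have "\<dots> \<le> x * (1 + 1 / (100 * real (Suc k)))" using x by (simp add: field_simps)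
  also have "\<dots> \<le> x * exp (1 / (100 * real (Suc k)))"
    using x by (intro mult_left_mono exp_ge_add_one_self) auto
  finally have "coeff_norm (lin c x) \<le> x * exp (1 / (100 * real (Suc k)))" .
  from coeff_norm_multI[OF Suc.IH this] show ?case by (simp add: lin_prod_Suc scal_prod_Suc growth_Suc x_def mult_ac)
qed

lemma coeff_norm_inverse_lin_prod:
  assumes "\<bar>c\<bar> \<le> 10" "r \<ge> 1" "p \<ge> 1"
  shows "coeff_norm (inverse (lin_prod c r p k)) \<le> inverse (scal_prod r p k) * (growth k)\<^sup>2"
proof (induction k)
  case 0
  show ?case using growth_ge1[of 0] by (simp add: one_le_power)
next
  case (Suc k)
  define x where "x = r + p * real k"
  have x: "x \<ge> real (Suc k)" using assms(2,3) mult_right_mono[OF assms(3), of "real k"] by (simp add: x_def)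
  define t where "t = 1 / (100 * real (Suc k))"
  have t: "0 < t" "t \<le> 1/100" by (auto simp: t_def field_simps)
  have "\<bar>c\<bar> * real (Suc k) \<le> 10 * x" using x assms(1) by (intro mult_mono) auto
  hence c: "\<bar>c\<bar> / 1000 \<le> x * t" by (simp add: t_def field_simps)
  have x0: "x > 0" using x by (smt (verit) of_nat_0_less_iff zero_less_Suc)
  have "x * t < x" using t x0 by simp
  hence "coeff_norm (inverse (lin c x)) \<le> 1 / (x - \<bar>c\<bar> / 1000)" using c by (intro coeff_norm_inverse_lin) linarith
  also have "\<dots> \<le> 1 / (x - x * t)" using c \<open>x * t < x\<close> by (intro divide_left_mono mult_pos_pos) auto
  also have "\<dots> = inverse x * (1 / (1 - t))" using x0 t by (simp add: field_simps)
  also have "1 / (1 - t) \<le> 1 + 2 * t" using t by (simp add: field_simps)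
  also have "\<dots> \<le> exp (2 * t)" by (rule exp_ge_add_one_self)
  also have "\<dots> = (exp t)\<^sup>2" by (simp add: power2_eq_square flip: exp_add)
  finally have "coeff_norm (inverse (lin c x)) \<le> inverse x * (exp t)\<^sup>2" using x0 by simp
  from coeff_norm_multI[OF Suc.IH this] show ?case
    by (simp add: lin_prod_Suc scal_prod_Suc growth_Suc x_def t_def fps_inverse_mult power_mult_distrib mult_ac)
qed

lemma coeff_norm_lin_prod_le:
  assumes "\<bar>c\<bar> \<le> 10" "r \<ge> 1" "p \<ge> 1" "k \<le> M"
  shows "coeff_norm (lin_prod c r p k) \<le> scal_prod r p k * growth M"
  using coeff_norm_lin_prod[OF assms(1-3), of k] mult_left_mono[OF growth_mono[OF assms(4)], of "scal_prod r p k"] scal_prod_pos[of r p k] assms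
  by linarith

lemma coeff_norm_inverse_lin_prod_le:
  assumes "\<bar>c\<bar> \<le> 10" "r \<ge> 1" "p \<ge> 1" "k \<le> M"
  shows "coeff_norm (inverse (lin_prod c r p k)) \<le> inverse (scal_prod r p k) * (growth M)\<^sup>2"
proof -
  have "inverse (scal_prod r p k) * (growth k)\<^sup>2 \<le> inverse (scal_prod r p k) * (growth M)\<^sup>2"
    using scal_prod_pos[of r p k] assms by (intro mult_left_mono power_mono growth_mono) auto
  with coeff_norm_inverse_lin_prod[OF assms(1-3), of k] show ?thesis by linarith
qed

text \<open>A generous common bound for all products of such factors below; it is \<open>O(sqrt m)\<close>, which leaves series with
terms \<open>growth_bound m / m\<^sup>2\<close> convergent.\<close>
definition growth_bound :: "nat \<Rightarrow> real" where "growth_bound m = exp (harm m / 2)"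

lemma growth_bound_pos: "0 < growth_bound m" by (simp add: growth_bound_def)

lemma growth_pow_le: "j \<le> 50 \<Longrightarrow> growth m ^ j \<le> growth_bound m"
proof -
  assume "j \<le> 50"
  hence "real j * harm m \<le> 50 * harm m" by (intro mult_right_mono) (auto simp: harm_nonneg)
  thus ?thesis by (simp add: growth_def growth_bound_def mult.commute[of "harm m"] flip: exp_of_nat_mult)
qed

lemma harm_le_ln: "m \<ge> 1 \<Longrightarrow> harm m \<le> 1 + ln (real m)"
proof (induction m rule: dec_induct)
  case base
  show ?case by (simp add: harm_def)
next
  case (step m)
  have "ln (real m / real (Suc m)) \<le> real m / real (Suc m) - 1"
    using step by (intro ln_le_minus_one) auto
  hence "1 / real (Suc m) \<le> ln (real (Suc m)) - ln (real m)"
    using step by (simp add: ln_div field_simps)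
  with step show ?case by (simp add: harm_Suc inverse_eq_divide)
qed

lemma growth_bound_le: "m \<ge> 1 \<Longrightarrow> growth_bound m \<le> 2 * real m powr (1/2)"
proof -
  assume m: "m \<ge> 1"
  have "growth_bound m \<le> exp (1/2 + 1/2 * ln (real m))"
    using harm_le_ln[OF m] by (simp add: growth_bound_def)
  also have "\<dots> = exp (1/2) * real m powr (1/2)" using m by (simp add: exp_add powr_def)
  also have "exp (1/2::real) \<le> 2" using exp_half_le2 by simp
  finally show ?thesis by (simp add: mult_right_mono)
qed

lemma summable_growth_bound: "summable (\<lambda>m. growth_bound m / (real m)\<^sup>2)"
proof (rule summable_comparison_test'[where N = 1])
  show "summable (\<lambda>m. 2 * real m powr (- 3/2))"
    by (intro summable_mult) (simp add: summable_real_powr_iff)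
  fix m :: nat assume m: "m \<ge> 1"
  have "growth_bound m / (real m)\<^sup>2 \<le> 2 * real m powr (1/2) / (real m)\<^sup>2" using growth_bound_le[OF m] by (intro divide_right_mono) auto
  also have "\<dots> = 2 * real m powr (1/2 - 2)" by (subst powr_diff) (use m in \<open>simp add: powr_numeral\<close>)
  finally show "norm (growth_bound m / (real m)\<^sup>2) \<le> 2 * real m powr (- 3/2)" using growth_bound_pos[of m] by simp
qed

lemma growth_bound_over_lim: "(\<lambda>m. growth_bound m / real m) \<longlonglongrightarrow> 0"
proof (rule Lim_null_comparison)
  show "\<forall>\<^sub>F m in sequentially. norm (growth_bound m / real m) \<le> 2 * real m powr (- 1/2)"
  proof (rule eventually_sequentiallyI[of 1])
    fix m :: nat assume m: "m \<ge> 1"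
    have "growth_bound m / real m \<le> 2 * real m powr (1/2) / real m" using growth_bound_le[OF m] by (intro divide_right_mono) auto
    also have "\<dots> = 2 * real m powr (1/2 - 1)" by (subst powr_diff) (use m in simp)
    finally show "norm (growth_bound m / real m) \<le> 2 * real m powr (- 1/2)" using growth_bound_pos[of m] by simp
  qed
  show "(\<lambda>m. 2 * real m powr (- 1/2)) \<longlonglongrightarrow> 0"
    by (intro tendsto_mult_right_zero tendsto_neg_powr filterlim_real_sequentially) simp
qed

lemma scal_prod_1_1: "scal_prod 1 1 k = fact k"
  by (induction k) (simp_all add: scal_prod_Suc)
lemma scal_prod_2_2: "scal_prod 2 2 k = 2 ^ k * fact k"
  by (induction k) (simp_all add: scal_prod_Suc algebra_simps)
lemma scal_prod_1_2: "2 ^ k * fact k * scal_prod 1 2 k = fact (2 * k)"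
proof (induction k)
  case (Suc k)
  have "2 ^ Suc k * fact (Suc k) * scal_prod 1 2 (Suc k) = 2 * real (Suc k) * (1 + 2 * real k) * (2 ^ k * fact k * scal_prod 1 2 k)"
    by (simp add: scal_prod_Suc algebra_simps)
  also have "\<dots> = fact (2 * Suc k)" unfolding Suc.IH by (simp add: algebra_simps)
  finally show ?case .
qed simp

section \<open>Summation along the edge of a region\<close>

text \<open>With \<open>R n = (\<Sum>m\<ge>\<sigma> n. f n m)\<close>, the relation between \<open>f\<close> and \<open>g\<close> telescopes in \<open>m\<close>, so that \<open>R n - R (n + 1)\<close> consists of
the terms next to the edge only.  These differences telescope in \<open>n\<close>, as \<open>R n\<close> is bounded by a tail of \<open>\<Sum>C\<close>.\<close>
lemma wz_telescope:
  fixes f g :: "nat \<Rightarrow> nat \<Rightarrow> real" and \<sigma> :: "nat \<Rightarrow> nat"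
  assumes mono: "\<And>n. \<sigma> n < \<sigma> (Suc n)"
    and wz: "\<And>n m. \<sigma> n \<le> m \<Longrightarrow> f (Suc n) (Suc m) - f n (Suc m) = g n (Suc m) - g n m"
    and bound: "\<And>n m. \<sigma> n \<le> m \<Longrightarrow> \<bar>f n m\<bar> \<le> C m" and C: "summable C"
    and g: "\<And>n. g n \<longlonglongrightarrow> 0"
  shows "(\<lambda>n. f n (\<sigma> n) + g n (\<sigma> n) + (\<Sum>m\<in>{\<sigma> n<..<\<sigma> (Suc n)}. f (Suc n) m))
           sums (\<Sum>m. f 0 (m + \<sigma> 0))"
proof -
  define R where "R n = (\<Sum>m. f n (m + \<sigma> n))" for n
  have sf: "summable (\<lambda>m. f n (m + k))" if "\<sigma> n \<le> k" for n k
    by (rule summable_comparison_test'[where N = 0, OF iffD2[OF summable_iff_shift[of C k] C]])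
       (use that in \<open>auto intro!: bound\<close>)
  have step: "f n (\<sigma> n) + g n (\<sigma> n) + (\<Sum>m\<in>{\<sigma> n<..<\<sigma> (Suc n)}. f (Suc n) m) = R n - R (Suc n)" for n
  proof -
    have sf': "summable (\<lambda>m. f (Suc n) (m + Suc (\<sigma> n)))"
    proof -
      have "summable (\<lambda>m. f (Suc n) (m + \<sigma> (Suc n)))" by (rule sf) simp
      hence "summable (f (Suc n))" by (rule iffD1[OF summable_iff_shift])
      thus ?thesis by (rule iffD2[OF summable_iff_shift])
    qed
    have "(\<lambda>m. g n (Suc (m + \<sigma> n)) - g n (m + \<sigma> n)) sums (0 - g n (0 + \<sigma> n))"
      using telescope_sums[OF LIMSEQ_ignore_initial_segment[OF g[of n], of "\<sigma> n"]] by simp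
    hence "(\<lambda>m. f (Suc n) (m + Suc (\<sigma> n)) - f n (m + Suc (\<sigma> n))) sums (- g n (\<sigma> n))"
      using wz[of n] by simp
    moreover have "(\<lambda>m. f (Suc n) (m + Suc (\<sigma> n)) - f n (m + Suc (\<sigma> n))) sums
       ((\<Sum>m. f (Suc n) (m + Suc (\<sigma> n))) - (\<Sum>m. f n (m + Suc (\<sigma> n))))"
      by (intro sums_diff summable_sums sf' sf) auto
    ultimately have e1: "(\<Sum>m. f (Suc n) (m + Suc (\<sigma> n))) - (\<Sum>m. f n (m + Suc (\<sigma> n))) = - g n (\<sigma> n)"
      by (rule sums_unique2[symmetric])
    have e2: "R n = f n (\<sigma> n) + (\<Sum>m. f n (m + Suc (\<sigma> n)))"
      using suminf_split_head[OF sf[of n "\<sigma> n"]] by (simp add: R_def)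
    define d where "d = \<sigma> (Suc n) - Suc (\<sigma> n)"
    have d: "d + Suc (\<sigma> n) = \<sigma> (Suc n)" using mono[of n] by (simp add: d_def)
    have "(\<Sum>m. f (Suc n) (m + Suc (\<sigma> n))) = R (Suc n) + (\<Sum>m<d. f (Suc n) (m + Suc (\<sigma> n)))"
      using suminf_split_initial_segment[OF sf', of d] by (simp only: R_def add.assoc d)
    also have "(\<Sum>m<d. f (Suc n) (m + Suc (\<sigma> n))) = (\<Sum>m\<in>{\<sigma> n<..<\<sigma> (Suc n)}. f (Suc n) m)"
      by (rule sum.reindex_bij_witness[of _ "\<lambda>m. m - Suc (\<sigma> n)" "\<lambda>m. m + Suc (\<sigma> n)"])
         (use d in auto)
    finally show ?thesis using e1 e2 by simp
  qed
  have \<sigma>: "n \<le> \<sigma> n" for n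
    by (induction n) (use mono in \<open>auto intro: le_less_trans Suc_leI\<close>)
  \<comment> \<open>The edge moves off to infinity, so the rows are tails of a summable majorant.\<close>
  have "R \<longlonglongrightarrow> 0"
  proof (rule Lim_null_comparison)
    have "(\<lambda>n. \<Sum>m. C (m + n)) \<longlonglongrightarrow> 0" by (rule suminf_exist_split2[OF C])
    from filterlim_compose[OF this, of \<sigma> sequentially]
    show "(\<lambda>n. \<Sum>m. C (m + \<sigma> n)) \<longlonglongrightarrow> 0"
      using \<sigma> by (simp add: filterlim_at_top_mono[OF filterlim_ident] always_eventually)
    show "\<forall>\<^sub>F n in sequentially. norm (R n) \<le> (\<Sum>m. C (m + \<sigma> n))"
    proof (intro always_eventually allI)
      fix n
      have sC: "summable (\<lambda>m. C (m + \<sigma> n))" using C by (rule iffD2[OF summable_iff_shift])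
      have sa: "summable (\<lambda>m. norm (f n (m + \<sigma> n)))"
        by (rule summable_comparison_test'[OF sC, of 0]) (simp add: bound)
      have "norm (R n) \<le> (\<Sum>m. norm (f n (m + \<sigma> n)))" unfolding R_def by (rule summable_norm[OF sa])
      also have "\<dots> \<le> (\<Sum>m. C (m + \<sigma> n))" by (intro suminf_le sa sC) (simp add: bound)
      finally show "norm (R n) \<le> (\<Sum>m. C (m + \<sigma> n))" .
    qed
  qed
  from telescope_sums'[OF this] show ?thesis unfolding step R_def by simp
qed

lemma nth_tendsto_0_of_norm:
  assumes "(\<lambda>m. coeff_norm (Y m)) \<longlonglongrightarrow> 0" "j \<le> 5"
  shows "(\<lambda>m. fps_nth (Y m) j) \<longlonglongrightarrow> 0"
proof (rule Lim_null_comparison)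
  show "\<forall>\<^sub>F m in sequentially. norm (fps_nth (Y m) j) \<le> 1000 ^ j * coeff_norm (Y m)"
    using coeff_le_norm[OF assms(2)] by simp
  show "(\<lambda>m. 1000 ^ j * coeff_norm (Y m)) \<longlonglongrightarrow> 0" using tendsto_mult_right_zero[OF assms(1)] by simp
qed

section \<open>Evaluation of a sum by repeated shifts\<close>

text \<open>If \<open>K i = \<Sum>m. t i m\<close>, then \<open>K i = \<rho> i * K (i + 1)\<close> by telescoping, and \<open>K i\<close> tends to \<open>1\<close>.  Hence
\<open>K 0\<close> is the infinite product of the \<open>\<rho> i\<close>, and its coefficients follow from the power sums.  All limits are taken
coefficient by coefficient; the lower coefficients of the partial products are needed because they multiply
those of \<open>K i\<close>.\<close>
lemma coeff_5_of_shift_invariant_sum: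
  fixes t Y :: "nat \<Rightarrow> nat \<Rightarrow> real fps" and \<rho> :: "nat \<Rightarrow> real fps"
  assumes t0: "\<And>i. t i 0 = 1"
    and rel: "\<And>i m. t i m - \<rho> i * t (Suc i) m = Y i (Suc m) - Y i m"
    and Y0: "\<And>i. Y i 0 = 0" and Y: "\<And>i. (\<lambda>m. coeff_norm (Y i m)) \<longlonglongrightarrow> 0"
    and bound: "\<And>i m. m \<ge> 1 \<Longrightarrow> coeff_norm (t i m) \<le> B m / real (2 * i + 1)" and B: "summable B"
    and power_sums: "\<And>i. power_sums (\<rho> i) (h i)" and \<rho>0: "\<And>i. fps_nth (\<rho> i) 0 = 1" and h1: "\<And>i. h i 1 = 0"
    and H: "\<And>r. r \<in> {2..5} \<Longrightarrow> (\<lambda>i. h i r) sums H r"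
  shows "(\<lambda>m. fps_nth (t 0 (Suc m)) 5) sums (H 5 / 5 - H 2 * H 3 / 6)"
proof -
  have bnd: "\<bar>fps_nth (t i (Suc m)) j\<bar> \<le> 1000 ^ j * B (Suc m) / real (2 * i + 1)" if "j \<le> 5" for i m j
    using coeff_le_norm[OF that, of "t i (Suc m)"] mult_left_mono[OF bound[of "Suc m" i], of "1000 ^ j"] by simp
  have sB: "summable (\<lambda>m. 1000 ^ j * B (Suc m) / x)" for j :: nat and x :: real
    using B by (intro summable_divide summable_mult) (simp add: summable_Suc_iff)
  have sa: "summable (\<lambda>m. fps_nth (t i (Suc m)) j)" if "j \<le> 5" for i j
    by (rule summable_comparison_test'[OF sB, of 0]) (use bnd[OF that] in auto)
  define k where "k i j = (\<Sum>m. fps_nth (t i m) j)" for i j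
  have ts: "(\<lambda>m. fps_nth (t i m) j) sums k i j" if "j \<le> 5" for i j
    unfolding k_def using sa[OF that, of i] summable_Suc_iff[of "\<lambda>m. fps_nth (t i m) j"]
    by (intro summable_sums) simp
  have kstep: "k i j = (\<Sum>l\<le>j. fps_nth (\<rho> i) l * k (Suc i) (j - l))" if j: "j \<le> 5" for i j
  proof -
    have "(\<lambda>m. \<Sum>l\<le>j. fps_nth (\<rho> i) l * fps_nth (t (Suc i) m) (j - l)) sums (\<Sum>l\<le>j. fps_nth (\<rho> i) l * k (Suc i) (j - l))"
      using j by (intro sums_sum sums_mult ts) auto
    moreover have e: "fps_nth (t i m) j - (\<Sum>l\<le>j. fps_nth (\<rho> i) l * fps_nth (t (Suc i) m) (j - l))
        = fps_nth (Y i (Suc m)) j - fps_nth (Y i m) j" for m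
      using arg_cong[OF rel[of i m], of "\<lambda>f. fps_nth f j"] by (simp add: fps_mult_nth atLeast0AtMost)
    ultimately
    have "(\<lambda>m. fps_nth (Y i (Suc m)) j - fps_nth (Y i m) j) sums (k i j - (\<Sum>l\<le>j. fps_nth (\<rho> i) l * k (Suc i) (j - l)))"
      using sums_diff[OF ts[OF j, of i]] unfolding e[symmetric] by blast
    moreover have "(\<lambda>m. fps_nth (Y i (Suc m)) j - fps_nth (Y i m) j) sums (0 - fps_nth (Y i 0) j)"
      by (intro telescope_sums nth_tendsto_0_of_norm[OF Y j])
    ultimately show ?thesis using sums_unique2 by (fastforce simp: Y0)
  qed
  define P where "P I = (\<Prod>i<I. \<rho> i)" for I
  have kP: "k 0 j = (\<Sum>l\<le>j. fps_nth (P I) l * k I (j - l))" if j: "j \<le> 5" for j I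
  proof (induction I)
    case 0
    have "(\<Sum>l\<le>j. fps_nth (P 0) l * k 0 (j - l)) = (\<Sum>l\<in>{0}. fps_nth (P 0) l * k 0 (j - l))"
      by (rule sum.mono_neutral_right) (auto simp: P_def)
    thus ?case by (simp add: P_def)
  next
    case (Suc I)
    define KK where "KK i = Abs_fps (k i)" for i
    have kK: "k i l = fps_nth (\<rho> i * KK (Suc i)) l" if "l \<le> 5" for i l
      unfolding kstep[OF that, of i] by (simp add: KK_def fps_mult_nth atLeast0AtMost)
    have "k 0 j = (\<Sum>l\<le>j. fps_nth (P I) l * fps_nth (\<rho> I * KK (Suc I)) (j - l))"
      unfolding Suc.IH using j kK by (intro sum.cong refl) simp
    also have "\<dots> = fps_nth (P I * (\<rho> I * KK (Suc I))) j" by (simp add: fps_mult_nth[of "P I"] atLeast0AtMost)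
    also have "P I * (\<rho> I * KK (Suc I)) = P (Suc I) * KK (Suc I)" by (simp add: P_def mult.assoc)
    finally show ?case by (simp add: fps_mult_nth KK_def atLeast0AtMost)
  qed
  have kd: "k i j = (if j = 0 then 1 else 0) + (\<Sum>m. fps_nth (t i (Suc m)) j)" if "j \<le> 5" for i j
    using suminf_split_head[OF sums_summable[OF ts[OF that, of i]]] by (simp add: k_def t0)
  have klim: "(\<lambda>i. k i j) \<longlonglongrightarrow> (if j = 0 then 1 else 0)" if j: "j \<le> 5" for j
  proof -
    define Z where "Z = (\<Sum>m. 1000 ^ j * B (Suc m) / 1)"
    have "(\<lambda>i. \<Sum>m. fps_nth (t i (Suc m)) j) \<longlonglongrightarrow> 0"
    proof (rule Lim_null_comparison)
      show "\<forall>\<^sub>F i in sequentially. norm (\<Sum>m. fps_nth (t i (Suc m)) j) \<le> Z / real (2 * i + 1)"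
      proof (intro always_eventually allI)
        fix i
        have sn: "summable (\<lambda>m. norm (fps_nth (t i (Suc m)) j))"
          by (rule summable_comparison_test'[OF sB, of 0]) (use bnd[OF j] in auto)
        have "norm (\<Sum>m. fps_nth (t i (Suc m)) j) \<le> (\<Sum>m. norm (fps_nth (t i (Suc m)) j))"
          by (rule summable_norm[OF sn])
        also have "\<dots> \<le> (\<Sum>m. 1000 ^ j * B (Suc m) / 1 / real (2 * i + 1))"
          using bnd[OF j] by (intro suminf_le sn summable_divide sB) auto
        also have "\<dots> = Z / real (2 * i + 1)" unfolding Z_def by (rule suminf_divide[OF sB])
        finally show "norm (\<Sum>m. fps_nth (t i (Suc m)) j) \<le> Z / real (2 * i + 1)" .
      qed
      show "(\<lambda>i. Z / real (2 * i + 1)) \<longlonglongrightarrow> 0" 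
        by (intro real_tendsto_divide_at_top[OF tendsto_const] filterlim_compose[OF filterlim_real_sequentially]
              filterlim_subseq) (simp add: strict_mono_def)
    qed
    from tendsto_add[OF tendsto_const this] show ?thesis unfolding kd[OF j] by simp
  qed
  have lgP: "power_sums (P I) (\<lambda>r. \<Sum>i<I. h i r)" for I unfolding P_def by (intro power_sums_prod power_sums)
  have P0: "fps_nth (P I) 0 = 1" for I by (induction I) (simp_all add: P_def \<rho>0)
  have Hl: "(\<lambda>I. \<Sum>i<I. h i r) \<longlonglongrightarrow> H r" if "r \<in> {2..5}" for r using H[OF that] by (simp add: sums_def)
  have s1: "(\<Sum>i<I. h i 1) = 0" for I using h1 by simp
  note c = power_sums_coeffs[OF lgP, unfolded P0 s1]
  have l1: "(\<lambda>I. fps_nth (P I) 1) \<longlonglongrightarrow> 0" unfolding c(1) by simp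
  have l2: "(\<lambda>I. fps_nth (P I) 2) \<longlonglongrightarrow> 1 * (0\<^sup>2 - H 2) / 2" unfolding c(2) by (intro tendsto_intros Hl) auto
  have l3: "(\<lambda>I. fps_nth (P I) 3) \<longlonglongrightarrow> 1 * (0 ^ 3 - 3 * 0 * H 2 + 2 * H 3) / 6"
    unfolding c(3) by (intro tendsto_intros Hl) auto
  have l4: "(\<lambda>I. fps_nth (P I) 4) \<longlonglongrightarrow> 1 * ((H 2)\<^sup>2 / 8 - H 4 / 4)"
    unfolding c(4)[OF refl] by (intro tendsto_intros Hl) auto
  have l5: "(\<lambda>I. fps_nth (P I) 5) \<longlonglongrightarrow> 1 * (H 5 / 5 - H 2 * H 3 / 6)"
    unfolding c(5)[OF refl] by (intro tendsto_intros Hl) auto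
  have l0: "(\<lambda>I. fps_nth (P I) 0) \<longlonglongrightarrow> 1" by (simp add: P0)
  have "(\<lambda>I. k 0 5) \<longlonglongrightarrow> 1 * 0 + 0 * 0 + (1 * (0\<^sup>2 - H 2) / 2) * 0 + (1 * (0 ^ 3 - 3 * 0 * H 2 + 2 * H 3) / 6) * 0
      + (1 * ((H 2)\<^sup>2 / 8 - H 4 / 4)) * 0 + (1 * (H 5 / 5 - H 2 * H 3 / 6)) * 1"
  proof -
    have e: "k 0 5 = fps_nth (P I) 0 * k I 5 + fps_nth (P I) 1 * k I 4 + fps_nth (P I) 2 * k I 3 + fps_nth (P I) 3 * k I 2
       + fps_nth (P I) 4 * k I 1 + fps_nth (P I) 5 * k I 0" for I
      using kP[of 5 I] by (simp add: atMost_Suc eval_nat_numeral)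
    have kl: "(\<lambda>i. k i 5) \<longlonglongrightarrow> 0" "(\<lambda>i. k i 4) \<longlonglongrightarrow> 0" "(\<lambda>i. k i 3) \<longlonglongrightarrow> 0" "(\<lambda>i. k i 2) \<longlonglongrightarrow> 0" "(\<lambda>i. k i 1) \<longlonglongrightarrow> 0" "(\<lambda>i. k i 0) \<longlonglongrightarrow> 1"
      using klim[of 5] klim[of 4] klim[of 3] klim[of 2] klim[of 1] klim[of 0] by simp_all
    have "(\<lambda>I. fps_nth (P I) 0 * k I 5 + fps_nth (P I) 1 * k I 4 + fps_nth (P I) 2 * k I 3 + fps_nth (P I) 3 * k I 2
       + fps_nth (P I) 4 * k I 1 + fps_nth (P I) 5 * k I 0) \<longlonglongrightarrow> 1 * 0 + 0 * 0 + (1 * (0\<^sup>2 - H 2) / 2) * 0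
      + (1 * (0 ^ 3 - 3 * 0 * H 2 + 2 * H 3) / 6) * 0
      + (1 * ((H 2)\<^sup>2 / 8 - H 4 / 4)) * 0 + (1 * (H 5 / 5 - H 2 * H 3 / 6)) * 1"
      by (intro tendsto_add tendsto_mult l0 l1 l2 l3 l4 l5 kl)
    thus ?thesis unfolding e[symmetric] .
  qed
  hence "k 0 5 = H 5 / 5 - H 2 * H 3 / 6" using LIMSEQ_unique[OF tendsto_const] by fastforce
  thus ?thesis using kd[of 5 0] summable_sums[OF sa[of 5 0]] by simp
qed

text \<open>The identities between products of linear factors are polynomial identities over an integral domain.  The following
rules rewrite every linear factor into ring operations on constants and on multiples of \<open>X\<close>.\<close>
lemmas fps_const_hom = fps_const_add [symmetric] fps_const_sub [symmetric] fps_const_mult [symmetric]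
  fps_const_neg [symmetric] numeral_fps_const [symmetric] fps_const_1_eq_1 fps_const_0_eq_0

section \<open>The two families and their mates\<close>

text \<open>The common factor of \<open>F_Q\<close> and \<open>G_Q\<close>.  In terms of Pochhammer symbols with \<open>d\<close> and \<open>b\<close> multiplied by \<open>X\<close>, it
comes from \<open>(d)\<^sub>m (b)\<^sub>m (1-b)\<^sub>m (d/2)\<^sub>m\<^sub>-\<^sub>n / ((1+d/2-b/2)\<^sub>m (1/2+d/2+b/2)\<^sub>m)\<close> and
from \<open>(1-b/2)\<^sub>n (1/2+b/2)\<^sub>n (1-d/2)\<^sub>n\<close>; factors are doubled to keep
the parameters integral, and the vanishing factors \<open>d X\<close> and \<open>b X\<close> of index \<open>0\<close> are removed.\<close>
definition kernel_Q :: "real \<Rightarrow> real \<Rightarrow> nat \<Rightarrow> nat \<Rightarrow> real fps" where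
  "kernel_Q d b n m = fps_const ((-1) ^ n / (2 ^ (m - 1) * fact m * fact (m + 2 * n))) *
     (lin_prod d 1 1 (m - 1) * lin_prod b 1 1 (m - 1) * lin_prod (-b) 1 1 m * lin_prod d 2 2 (m - n - 1) *
      lin_prod (-b) 2 2 n * lin_prod b 1 2 n * lin_prod (-d) 2 2 n * inverse (lin_prod (d - b) 2 2 m) * inverse (lin_prod (d + b) 1 2 m))"

definition F_Q where "F_Q d b n m = kernel_Q d b n m * lin d (3 * real m)"

definition G_Q where "G_Q d b n m = kernel_Q d b n m * (lin d (real m) * lin b (real m) * lin (-b) (real m + 1) *
  fps_const (1 / ((real m + 2 * real n + 1) * (real m + 2 * real n + 2))))"

definition X_part :: "real \<Rightarrow> real fps" where "X_part c = fps_const c * fps_X"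

lemma lin_X_part: "lin c x = fps_const x + X_part c" by (simp add: lin_def X_part_def)
lemma X_part_hom: "X_part (a + b) = X_part a + X_part b" "X_part (a - b) = X_part a - X_part b" "X_part (- a) = - X_part a"
    "X_part (numeral k * a) = numeral k * X_part a"
  by (simp_all add: X_part_def algebra_simps fps_const_hom del: fps_const_add fps_const_sub fps_const_mult fps_const_neg)

lemma ring_Q:
  fixes n k d b :: "'a::idom"
  shows "- 1 * ((3*(n+k+2)+d) * (2+2*n + - b) * (1+2*n+b) * (2+2*n+ - d)) - (3*(n+k+2)+d) * (2+2*k+d) * (((n+k+2)+2*n+1) * ((n+k+2)+2*n+2))
    = (2+2*k+d) * ((n+k+2)+d) * ((n+k+2)+b) * ((n+k+2)+1+ - b) - 2*(n+k+2)*((n+k+2)+2*n+2)*(2*(n+k+2)+(d-b))*(2*(n+k+2)-1+(d+b))"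
  by algebra

text \<open>After division by the largest common factor \<open>V\<close> of the four terms, the relation becomes \<open>ring_Q\<close>.\<close>
lemma wz_Q:
  assumes "Suc n \<le> m"
  shows "F_Q d b (Suc n) (Suc m) - F_Q d b n (Suc m) = G_Q d b n (Suc m) - G_Q d b n m"
proof -
  obtain k where m: "m = Suc (n + k)" using assms by (metis add_Suc le_Suc_ex)
  \<comment> \<open>The common factor is \<open>w V\<close>: of the four ranges of each product, take the smallest for a numerator and the
    largest for a denominator.\<close>
  define w where "w = (-1) ^ n / (2 ^ m * fact (Suc m) * fact (Suc m + 2 * n + 2) :: real)"
  define V where "V = lin_prod d 1 1 m * lin_prod b 1 1 m * lin_prod (-b) 1 1 (Suc m) * lin_prod d 2 2 k *
      lin_prod (-b) 2 2 n * lin_prod b 1 2 n * lin_prod (-d) 2 2 n * inverse (lin_prod (d - b) 2 2 (Suc m)) * inverse (lin_prod (d + b) 1 2 (Suc m))"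
  define M where "M = real n + real k + 2"
  have M: "real (Suc m) = M" "real m = M - 1" by (simp_all add: m M_def)
  have M0: "M > 1" by (simp add: M_def)
  have 1: "F_Q d b (Suc n) (Suc m) = fps_const w * V *
      (fps_const (-1) * (lin d (3 * M) * lin (-b) (2 + 2 * real n) * lin b (1 + 2 * real n) * lin (-d) (2 + 2 * real n)))"
  proof -
    have "Suc m - Suc n - 1 = k" "Suc m - 1 = m" by (simp_all add: m)
    moreover have "(-1) ^ Suc n / (2 ^ m * fact (Suc m) * fact (Suc m + 2 * Suc n)) = w * (-1)"
      by (simp add: w_def)
    ultimately show ?thesis unfolding F_Q_def kernel_Q_def V_def
      by (simp only: lin_prod_Suc[of _ _ _ n] M fps_const_mult[symmetric] mult_ac)
  qed
  have 2: "F_Q d b n (Suc m) = fps_const w * V *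
      (lin d (3 * M) * lin d (2 + 2 * real k) * fps_const ((M + 2 * real n + 1) * (M + 2 * real n + 2)))"
  proof -
    have "Suc m - n - 1 = Suc k" "Suc m - 1 = m" by (simp_all add: m)
    moreover have "(-1) ^ n / (2 ^ m * fact (Suc m) * fact (Suc m + 2 * n)) = w * ((M + 2 * real n + 1) * (M + 2 * real n + 2))"
      unfolding w_def M(1)[symmetric] by (simp add: divide_simps; simp add: algebra_simps)
    ultimately show ?thesis unfolding F_Q_def kernel_Q_def V_def
      by (simp only: lin_prod_Suc[of _ _ _ k] M fps_const_mult[symmetric] mult_ac)
  qed
  have 3: "G_Q d b n (Suc m) = fps_const w * V *
      (lin d (2 + 2 * real k) * lin d M * lin b M * lin (-b) (M + 1))"
  proof -
    have mk: "Suc m - n - 1 = Suc k" "Suc m - 1 = m" by (simp_all add: m)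
    have c: "(-1) ^ n / (2 ^ m * fact (Suc m) * fact (Suc m + 2 * n)) * (1 / ((M + 2 * real n + 1) * (M + 2 * real n + 2))) = w"
      unfolding w_def M(1)[symmetric] by (simp add: divide_simps; simp add: algebra_simps)
    have "G_Q d b n (Suc m) = fps_const ((-1) ^ n / (2 ^ m * fact (Suc m) * fact (Suc m + 2 * n)) * (1 / ((M + 2 * real n + 1) * (M + 2 * real n + 2))))
       * V * (lin d (2 + 2 * real k) * lin d M * lin b M * lin (-b) (M + 1))"
      unfolding G_Q_def kernel_Q_def mk V_def M by (simp only: lin_prod_Suc[of _ _ _ k] fps_const_mult[symmetric] mult_ac)
    thus ?thesis unfolding c .
  qed
  have 4: "G_Q d b n m = fps_const w * V *
      (fps_const (2 * M * (M + 2 * real n + 2)) * lin (d - b) (2 * M) * lin (d + b) (2 * M - 1))"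
  proof -
    define U where "U = lin_prod d 2 2 k * lin_prod (-b) 2 2 n * lin_prod b 1 2 n * lin_prod (-d) 2 2 n"
    have mk: "m - n - 1 = k" "m - 1 = n + k" by (simp_all add: m)
    have c: "(-1) ^ n / (2 ^ (n + k) * fact m * fact (m + 2 * n)) * (1 / ((M - 1 + 2 * real n + 1) * (M - 1 + 2 * real n + 2)))
       = w * (2 * M * (M + 2 * real n + 2))"
      unfolding w_def M(1)[symmetric] by (simp add: divide_simps m; simp add: algebra_simps)
    have a: "lin_prod d 1 1 m = lin_prod d 1 1 (n + k) * lin d (M - 1)" "lin_prod b 1 1 m = lin_prod b 1 1 (n + k) * lin b (M - 1)"
      by (simp_all add: m lin_prod_Suc M_def algebra_simps)
    have a': "lin_prod (-b) 1 1 (Suc m) = lin_prod (-b) 1 1 m * lin (-b) (M - 1 + 1)"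
      by (simp add: m lin_prod_Suc M_def algebra_simps)
    have i: "inverse (lin_prod (d - b) 2 2 m) = inverse (lin_prod (d - b) 2 2 (Suc m)) * lin (d - b) (2 * M)"
      "inverse (lin_prod (d + b) 1 2 m) = inverse (lin_prod (d + b) 1 2 (Suc m)) * lin (d + b) (2 * M - 1)"
      using inverse_lin_prod_Suc[of 2 2 m "d - b"] inverse_lin_prod_Suc[of 1 2 m "d + b"] M0 by (simp_all add: M algebra_simps)
    have "G_Q d b n m = fps_const ((-1) ^ n / (2 ^ (n + k) * fact m * fact (m + 2 * n)) * (1 / ((M - 1 + 2 * real n + 1) * (M - 1 + 2 * real n + 2))))
       * (lin_prod d 1 1 m * lin_prod b 1 1 m * lin_prod (-b) 1 1 (Suc m) * U * inverse (lin_prod (d - b) 2 2 m) * inverse (lin_prod (d + b) 1 2 m))"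
      unfolding G_Q_def kernel_Q_def mk M U_def a a' by (simp only: fps_const_mult[symmetric] mult_ac)
    thus ?thesis unfolding c i V_def U_def by (simp only: fps_const_mult[symmetric] mult_ac)
  qed
  have "fps_const (-1) * (lin d (3 * M) * lin (-b) (2 + 2 * real n) * lin b (1 + 2 * real n) * lin (-d) (2 + 2 * real n))
     - lin d (3 * M) * lin d (2 + 2 * real k) * fps_const ((M + 2 * real n + 1) * (M + 2 * real n + 2))
    = lin d (2 + 2 * real k) * lin d M * lin b M * lin (-b) (M + 1)
     - fps_const (2 * M * (M + 2 * real n + 2)) * lin (d - b) (2 * M) * lin (d + b) (2 * M - 1)"
    unfolding lin_X_part M_def X_part_hom fps_const_hom by (rule ring_Q)
  thus ?thesis unfolding 1 2 3 4 by (simp only: right_diff_distrib[symmetric])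
qed

text \<open>The common factor of \<open>F_D\<close> and \<open>G_D\<close>.  For \<open>n = 0\<close> the terms \<open>F_D\<close> are those of a very well-poised
series with parameters \<open>a\<close>, \<open>u\<close>, \<open>v\<close>.\<close>
definition kernel_D :: "real \<Rightarrow> real \<Rightarrow> real \<Rightarrow> nat \<Rightarrow> nat \<Rightarrow> real fps" where
  "kernel_D a u v n m = fps_const ((-1) ^ n / fact (m + n)) *
     (lin_prod a 1 1 (m - n - 1) * lin_prod u 1 1 (m - 1) * lin_prod v 1 1 (m - 1) * lin_prod (-u) 1 1 n * lin_prod (-v) 1 1 n * lin_prod (-a) 1 2 n *
      inverse (lin_prod (a - u) 1 1 m) * inverse (lin_prod (a - v) 1 1 m) * inverse (lin_prod (a - 2 * u - 2 * v) 1 2 n))"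

definition F_D where "F_D a u v n m = kernel_D a u v n m * lin a (2 * real m)"

definition G_D where "G_D a u v n m = kernel_D a u v n m * (lin a (2 * real m + 1) * lin u (real m) * lin v (real m) *
  inverse (lin (a - 2 * u - 2 * v) (1 + 2 * real n)) * fps_const (1 / (real m + real n + 1)))"

lemma ring_D:
  fixes n k a u v :: "'a::idom"
  shows "- 1 * ((2*(n+k+2)+a) * (1+n+ - u) * (1+n+ - v) * (1+2*n+ - a))
      - (2*(n+k+2)+a) * (1+k+a) * (1+2*n+(a - 2 * u - 2 * v)) * ((n+k+2)+n+1)
    = (1+k+a) * (2*(n+k+2)+1+a) * ((n+k+2)+u) * ((n+k+2)+v)
      - (2*(n+k+2)-1+a) * ((n+k+2)+(a-u)) * ((n+k+2)+(a-v)) * ((n+k+2)+n+1)"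
  by algebra

text \<open>The reduction to \<open>ring_D\<close> is the same as for \<open>wz_Q\<close>.\<close>
lemma wz_D:
  assumes "Suc n \<le> m"
  shows "F_D a u v (Suc n) (Suc m) - F_D a u v n (Suc m) = G_D a u v n (Suc m) - G_D a u v n m"
proof -
  obtain k where m: "m = Suc (n + k)" using assms by (metis add_Suc le_Suc_ex)
  define w where "w = (-1) ^ n / (fact (Suc m + n + 1) :: real)"
  define s where "s = a - 2 * u - 2 * v"
  define V where "V = lin_prod a 1 1 k * lin_prod u 1 1 m * lin_prod v 1 1 m * lin_prod (-u) 1 1 n * lin_prod (-v) 1 1 n * lin_prod (-a) 1 2 n *
      inverse (lin_prod (a - u) 1 1 (Suc m)) * inverse (lin_prod (a - v) 1 1 (Suc m)) * inverse (lin_prod s 1 2 (Suc n))"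
  define M where "M = real n + real k + 2"
  have M: "real (Suc m) = M" "real m = M - 1" by (simp_all add: m M_def)
  have S: "inverse (lin_prod s 1 2 n) = inverse (lin_prod s 1 2 (Suc n)) * lin s (1 + 2 * real n)"
    by (rule inverse_lin_prod_Suc) (smt (verit) of_nat_0_le_iff)
  have S': "inverse (lin_prod s 1 2 (Suc n)) = inverse (lin_prod s 1 2 n) * inverse (lin s (1 + 2 * real n))"
    by (simp add: lin_prod_Suc fps_inverse_mult)
  have mk: "Suc m - Suc n - 1 = k" "Suc m - 1 = m" "Suc m - n - 1 = Suc k" "m - n - 1 = k" by (simp_all add: m)
  have 1: "F_D a u v (Suc n) (Suc m) = fps_const w * V *
      (fps_const (-1) * (lin a (2 * M) * lin (-u) (1 + 1 * real n) * lin (-v) (1 + 1 * real n) * lin (-a) (1 + 2 * real n)))"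
  proof -
    have c: "(-1) ^ Suc n / fact (Suc m + Suc n) = w * (-1)" by (simp add: w_def)
    show ?thesis unfolding F_D_def kernel_D_def V_def mk c M s_def[symmetric]
      by (simp only: lin_prod_Suc[of "- u" _ _ n] lin_prod_Suc[of "- v" _ _ n] lin_prod_Suc[of "- a" _ _ n] fps_const_mult[symmetric] mult_ac)
  qed
  have 2: "F_D a u v n (Suc m) = fps_const w * V *
      (lin a (2 * M) * lin a (1 + 1 * real k) * lin s (1 + 2 * real n) * fps_const (M + real n + 1))"
  proof -
    have c: "(-1) ^ n / fact (Suc m + n) = w * (M + real n + 1)"
      unfolding w_def M(1)[symmetric] by (simp add: divide_simps)
    show ?thesis unfolding F_D_def kernel_D_def V_def mk c M s_def[symmetric] S
      by (simp only: lin_prod_Suc[of a _ _ k] fps_const_mult[symmetric] mult_ac)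
  qed
  have 3: "G_D a u v n (Suc m) = fps_const w * V *
      (lin a (1 + 1 * real k) * lin a (2 * M + 1) * lin u M * lin v M)"
  proof -
    have c: "(-1) ^ n / fact (Suc m + n) * (1 / (M + real n + 1)) = w"
      unfolding w_def M(1)[symmetric] by (simp add: divide_simps)
    have "G_D a u v n (Suc m) = fps_const ((-1) ^ n / fact (Suc m + n) * (1 / (M + real n + 1))) * V *
      (lin a (1 + 1 * real k) * lin a (2 * M + 1) * lin u M * lin v M)"
      unfolding G_D_def kernel_D_def V_def mk M s_def[symmetric] S'
      by (simp only: lin_prod_Suc[of a _ _ k] fps_const_mult[symmetric] mult_ac)
    thus ?thesis unfolding c .
  qed
  have 4: "G_D a u v n m = fps_const w * V *
      (lin a (2 * M - 1) * lin (a - u) M * lin (a - v) M * fps_const (M + real n + 1))"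
  proof -
    have c: "(-1) ^ n / fact (m + n) * (1 / (M - 1 + real n + 1)) = w * (M + real n + 1)"
      unfolding w_def M_def by (simp add: divide_simps m; simp add: algebra_simps)
    have e: "m - 1 = n + k" by (simp add: m)
    have a: "lin_prod u 1 1 m = lin_prod u 1 1 (n + k) * lin u (M - 1)" "lin_prod v 1 1 m = lin_prod v 1 1 (n + k) * lin v (M - 1)"
      by (simp_all add: m lin_prod_Suc M_def algebra_simps)
    have M0: "M > 1" by (simp add: M_def)
    have i: "inverse (lin_prod (a - u) 1 1 m) = inverse (lin_prod (a - u) 1 1 (Suc m)) * lin (a - u) M"
      "inverse (lin_prod (a - v) 1 1 m) = inverse (lin_prod (a - v) 1 1 (Suc m)) * lin (a - v) M"
      using inverse_lin_prod_Suc[of 1 1 m "a - u"] inverse_lin_prod_Suc[of 1 1 m "a - v"] M0 by (simp_all add: M algebra_simps)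
    have l: "2 * (M - 1) + 1 = 2 * M - 1" by simp
    have "G_D a u v n m = fps_const ((-1) ^ n / fact (m + n) * (1 / (M - 1 + real n + 1))) * V *
      (lin a (2 * M - 1) * lin (a - u) M * lin (a - v) M)"
      unfolding G_D_def kernel_D_def V_def mk e M s_def[symmetric] S' i a l
      by (simp only: fps_const_mult[symmetric] mult_ac)
    thus ?thesis unfolding c by (simp only: fps_const_mult[symmetric] mult_ac)
  qed
  have "fps_const (-1) * (lin a (2 * M) * lin (-u) (1 + 1 * real n) * lin (-v) (1 + 1 * real n) * lin (-a) (1 + 2 * real n))
     - lin a (2 * M) * lin a (1 + 1 * real k) * lin s (1 + 2 * real n) * fps_const (M + real n + 1)
    = lin a (1 + 1 * real k) * lin a (2 * M + 1) * lin u M * lin v M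
     - lin a (2 * M - 1) * lin (a - u) M * lin (a - v) M * fps_const (M + real n + 1)"
    unfolding lin_X_part M_def s_def X_part_hom fps_const_hom mult_1 by (rule ring_D)
  thus ?thesis unfolding 1 2 3 4 by (simp only: right_diff_distrib[symmetric])
qed

lemma fact_mult_le: "fact i * fact j \<le> (fact (i + j) :: real)"
proof -
  have "fact i * fact j \<le> (fact (i + j) :: nat)"
    by (intro dvd_imp_le fact_fact_dvd_fact) simp
  hence "real (fact i * fact j) \<le> real (fact (i + j))" by (rule of_nat_mono)
  thus ?thesis by simp
qed

lemma fact_le_scal_prod: "fact k \<le> scal_prod 1 2 (Suc k)"
proof (induction k)
  case (Suc k)
  have "fact (Suc k) = fact k * (1 + real k)" by simp
  also have "\<dots> \<le> scal_prod 1 2 (Suc k) * (1 + 2 * real (Suc k))"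
    using Suc scal_prod_pos[of 1 2 "Suc k"] by (intro mult_mono) auto
  finally show ?case by (simp add: scal_prod_Suc[of _ _ "Suc k"])
qed (simp add: scal_prod_Suc)

lemma square_le_pow: "real m ^ 2 \<le> 2 * 2 ^ m"
proof -
  have "m ^ 2 \<le> 2 * 2 ^ m"
  proof (cases "m < 3")
    case True
    then consider "m = 0" | "m = 1" | "m = 2" by linarith
    thus ?thesis by cases auto
  next
    case False
    hence "3 \<le> m" by simp
    thus ?thesis
    proof (induction m rule: dec_induct)
      case (step k)
      have "3 * k \<le> k * k" using step by simp
      moreover have "(Suc k)\<^sup>2 = k * k + 2 * k + 1" by (simp add: power2_eq_square)
      ultimately have "(Suc k)\<^sup>2 \<le> 2 * k\<^sup>2" using step(1) unfolding power2_eq_square by linarith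
      with step show ?case by simp
    qed simp
  qed
  hence "real (m ^ 2) \<le> real (2 * 2 ^ m)" by (rule of_nat_mono)
  thus ?thesis by simp
qed

text \<open>The constant term of the kernel is \<open>(m-1)! k! n! (2n)! / (2^m m (m+2n)! (2m-1)!!)\<close> with \<open>k = m - n - 1\<close>, where
\<open>k! n! \<le> (m-1)! \<le> (2m-1)!!\<close> and \<open>(m-1)! (2n)! \<le> (m+2n)!\<close>.\<close>
lemma coeff_norm_kernel_Q:
  assumes c: "\<bar>d\<bar> \<le> 10" "\<bar>b\<bar> \<le> 10" "\<bar>d - b\<bar> \<le> 10" "\<bar>d + b\<bar> \<le> 10" and m: "Suc n \<le> m"
  shows "coeff_norm (kernel_Q d b n m) \<le> growth_bound m / (2 ^ m * real m)"
proof -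
  obtain k where mk: "m = Suc (n + k)" using m by (metis add_Suc le_Suc_ex)
  have e: "m - n - 1 = k" "m - 1 = n + k" by (simp_all add: mk)
  define x :: real where "x = (-1) ^ n / (2 ^ (n + k) * fact m * fact (m + 2 * n))"
  define E where "E = growth m"
  have E0: "E \<ge> 0" by (simp add: E_def)
  define s where "s = \<bar>x\<bar> * (scal_prod 1 1 (n + k) * scal_prod 1 1 (n + k) * scal_prod 1 1 m * scal_prod 2 2 k * scal_prod 2 2 n * scal_prod 1 2 n * scal_prod 2 2 n *
      inverse (scal_prod 2 2 m) * inverse (scal_prod 1 2 m))"
  have "coeff_norm (kernel_Q d b n m) \<le> \<bar>x\<bar> * (scal_prod 1 1 (n + k) * E * (scal_prod 1 1 (n + k) * E) * (scal_prod 1 1 m * E) * (scal_prod 2 2 k * E) *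
     (scal_prod 2 2 n * E) * (scal_prod 1 2 n * E) * (scal_prod 2 2 n * E) * (inverse (scal_prod 2 2 m) * E\<^sup>2) * (inverse (scal_prod 1 2 m) * E\<^sup>2))"
    unfolding kernel_Q_def e x_def[symmetric] E_def using c
    by (intro coeff_norm_multI coeff_norm_lin_prod_le coeff_norm_inverse_lin_prod_le eq_refl[OF coeff_norm_const]) (auto simp: mk)
  also have "\<dots> = s * E ^ 11" unfolding s_def by (simp add: power2_eq_square power_numeral_reduce)
  finally have 1: "coeff_norm (kernel_Q d b n m) \<le> s * E ^ 11" .
  have "s \<le> 1 / (2 ^ m * real m)"
  proof -
    have A: "scal_prod 1 2 m > 0" "scal_prod 1 2 n > 0" by (simp_all add: scal_prod_pos)
    have f: "(fact n * fact k) * (fact (n + k) * fact (2 * n)) * fact (n + k) \<le> fact (n + k) * fact (m + 2 * n) * scal_prod 1 2 m"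
    proof (intro mult_mono)
      show "fact n * fact k \<le> (fact (n + k) :: real)" by (rule fact_mult_le)
      have "fact (n + k) * fact (2 * n) \<le> (fact (n + k + 2 * n) :: real)" by (rule fact_mult_le)
      also have "\<dots> \<le> fact (m + 2 * n)" by (rule fact_mono) (simp add: mk)
      finally show "fact (n + k) * fact (2 * n) \<le> (fact (m + 2 * n) :: real)" .
      show "fact (n + k) \<le> scal_prod 1 2 m" unfolding mk by (rule fact_le_scal_prod)
    qed auto
    have "s = (2 ^ n * fact n * scal_prod 1 2 n) * ((fact n * fact k) * fact (n + k) * fact (n + k)) / (2 ^ m * fact m * fact (m + 2 * n) * scal_prod 1 2 m)"
      unfolding s_def x_def scal_prod_1_1 scal_prod_2_2 using A
      by (simp add: abs_mult field_simps power_add)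
    also have "\<dots> = ((fact n * fact k) * (fact (n + k) * fact (2 * n)) * fact (n + k)) / (2 ^ m * fact m * fact (m + 2 * n) * scal_prod 1 2 m)"
      unfolding scal_prod_1_2 by (simp add: mult_ac)
    also have "\<dots> \<le> (fact (n + k) * fact (m + 2 * n) * scal_prod 1 2 m) / (2 ^ m * fact m * fact (m + 2 * n) * scal_prod 1 2 m)"
      using f A by (intro divide_right_mono) auto
    also have "\<dots> = 1 / (2 ^ m * real m)"
    proof -
      have fm: "fact m = real m * fact (n + k)" by (simp add: mk)
      have m0: "real m > 0" by (simp add: mk)
      show ?thesis unfolding fm using A m0 by (simp add: divide_simps)
    qed
    finally show ?thesis .
  qed
  hence "s * E ^ 11 \<le> 1 / (2 ^ m * real m) * growth_bound m"
    using growth_pow_le[of 11 m] E0 unfolding E_def by (intro mult_mono) auto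
  with 1 show ?thesis by simp
qed

lemma coeff_norm_kernel_D:
  assumes c: "\<bar>a\<bar> \<le> 10" "\<bar>u\<bar> \<le> 10" "\<bar>v\<bar> \<le> 10" "\<bar>a - u\<bar> \<le> 10" "\<bar>a - v\<bar> \<le> 10" "\<bar>a - 2 * u - 2 * v\<bar> \<le> 10"
    and m: "Suc n \<le> m"
  shows "coeff_norm (kernel_D a u v n m) \<le> growth_bound m / real m ^ 3"
proof -
  obtain k where mk: "m = Suc (n + k)" using m by (metis add_Suc le_Suc_ex)
  have e: "m - n - 1 = k" "m - 1 = n + k" by (simp_all add: mk)
  define x :: real where "x = (-1) ^ n / fact (m + n)"
  define E where "E = growth m"
  have E0: "E \<ge> 0" by (simp add: E_def)
  define s where "s = \<bar>x\<bar> * (scal_prod 1 1 k * scal_prod 1 1 (n + k) * scal_prod 1 1 (n + k) * scal_prod 1 1 n * scal_prod 1 1 n * scal_prod 1 2 n *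
      inverse (scal_prod 1 1 m) * inverse (scal_prod 1 1 m) * inverse (scal_prod 1 2 n))"
  have "coeff_norm (kernel_D a u v n m) \<le> \<bar>x\<bar> * (scal_prod 1 1 k * E * (scal_prod 1 1 (n + k) * E) * (scal_prod 1 1 (n + k) * E) * (scal_prod 1 1 n * E) *
     (scal_prod 1 1 n * E) * (scal_prod 1 2 n * E) * (inverse (scal_prod 1 1 m) * E\<^sup>2) * (inverse (scal_prod 1 1 m) * E\<^sup>2) * (inverse (scal_prod 1 2 n) * E\<^sup>2))"
    unfolding kernel_D_def e x_def[symmetric] E_def using c
    by (intro coeff_norm_multI coeff_norm_lin_prod_le coeff_norm_inverse_lin_prod_le eq_refl[OF coeff_norm_const]) (auto simp: mk)
  also have "\<dots> = s * E ^ 12" unfolding s_def by (simp add: power2_eq_square power_numeral_reduce)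
  finally have 1: "coeff_norm (kernel_D a u v n m) \<le> s * E ^ 12" .
  have "s \<le> 1 / real m ^ 3"
  proof -
    have A: "scal_prod 1 2 n > 0" by (simp add: scal_prod_pos)
    have "real m * (fact n * fact k) * fact n \<le> real m * fact (n + k) * fact n"
      by (intro mult_mono fact_mult_le) auto
    also have "\<dots> = fact m * fact n" by (simp add: mk)
    also have "\<dots> \<le> fact (m + n)" by (rule fact_mult_le)
    finally have f: "real m * (fact n * fact k) * fact n \<le> fact (m + n)" .
    have fm: "fact m = real m * fact (n + k)" by (simp add: mk)
    have m0: "real m > 0" by (simp add: mk)
    have "s = (real m * (fact n * fact k) * fact n) / (fact (m + n) * real m ^ 3)"
      unfolding s_def x_def scal_prod_1_1 fm using A m0
      by (simp add: abs_mult field_simps power3_eq_cube)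
    also have "\<dots> \<le> fact (m + n) / (fact (m + n) * real m ^ 3)"
      using f by (intro divide_right_mono) auto
    finally show ?thesis by simp
  qed
  hence "s * E ^ 12 \<le> 1 / real m ^ 3 * growth_bound m"
    using growth_pow_le[of 12 m] E0 unfolding E_def by (intro mult_mono) auto
  with 1 show ?thesis by simp
qed

text \<open>The edge is \<open>m = n + 1\<close>; it moves by one step at a time, so that each row contributes one term of each
kind.\<close>
lemma edge_sums_Q:
  assumes c: "\<bar>d\<bar> \<le> 10" "\<bar>b\<bar> \<le> 10" "\<bar>d - b\<bar> \<le> 10" "\<bar>d + b\<bar> \<le> 10"
  shows "(\<lambda>n. fps_nth (F_Q d b n (Suc n) + G_Q d b n (Suc n)) 3) sums (\<Sum>m. fps_nth (F_Q d b 0 (Suc m)) 3)"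
proof -
  have lfb: "coeff_norm (lin d (3 * real m)) \<le> 4 * real m" "coeff_norm (lin d (real m)) \<le> 2 * real m" "coeff_norm (lin b (real m)) \<le> 2 * real m"
    "coeff_norm (lin (-b) (real m + 1)) \<le> 3 * real m" if "m \<ge> 1" for m
    using that c(1,2) by (auto simp: coeff_norm_lin)
  have pw: "growth_bound m / 2 ^ m \<le> 2 * (growth_bound m / (real m)\<^sup>2)" if "m \<ge> 1" for m
    using mult_left_mono[OF square_le_pow[of m], of "growth_bound m"] growth_bound_pos[of m] that by (simp add: field_simps)
  have F: "coeff_norm (F_Q d b n m) \<le> 8 * (growth_bound m / (real m)\<^sup>2)" if "Suc n \<le> m" for n m
  proof -
    have m: "m \<ge> 1" using that by simp
    have "coeff_norm (F_Q d b n m) \<le> growth_bound m / (2 ^ m * real m) * (4 * real m)"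
      unfolding F_Q_def by (intro coeff_norm_multI coeff_norm_kernel_Q c lfb that m)
    also have "\<dots> = 4 * (growth_bound m / 2 ^ m)" using m by simp
    finally show ?thesis using pw[OF m] by simp
  qed
  have G: "(\<lambda>m. coeff_norm (G_Q d b n m)) \<longlonglongrightarrow> 0" for n
  proof (rule Lim_null_comparison)
    show "(\<lambda>m. 24 * (growth_bound m / (real m)\<^sup>2)) \<longlonglongrightarrow> 0"
      by (intro tendsto_mult_right_zero summable_LIMSEQ_zero summable_growth_bound)
    show "\<forall>\<^sub>F m in sequentially. norm (coeff_norm (G_Q d b n m)) \<le> 24 * (growth_bound m / (real m)\<^sup>2)"
    proof (rule eventually_sequentiallyI[of "Suc n"])
      fix m assume mn: "Suc n \<le> m"
      have m: "m \<ge> 1" using mn by simp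
      have "real m * real m \<le> (real m + 2 * real n + 1) * (real m + 2 * real n + 2)" by (intro mult_mono) auto
      hence q: "1 / ((real m + 2 * real n + 1) * (real m + 2 * real n + 2)) \<le> 1 / (real m * real m)"
        using m by (intro divide_left_mono mult_pos_pos) auto
      have "coeff_norm (G_Q d b n m) \<le> growth_bound m / (2 ^ m * real m) * (2 * real m * (2 * real m) * (3 * real m) * (1 / (real m * real m)))"
        unfolding G_Q_def using q by (intro coeff_norm_multI coeff_norm_kernel_Q c lfb m mn) simp
      also have "\<dots> = 12 * (growth_bound m / 2 ^ m)" using m by simp
      finally show "norm (coeff_norm (G_Q d b n m)) \<le> 24 * (growth_bound m / (real m)\<^sup>2)" using pw[OF m] by simp
    qed
  qed
  have "(\<lambda>n. fps_nth (F_Q d b n (Suc n)) 3 + fps_nth (G_Q d b n (Suc n)) 3 + (\<Sum>m\<in>{Suc n<..<Suc (Suc n)}. fps_nth (F_Q d b (Suc n) m) 3))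
     sums (\<Sum>m. fps_nth (F_Q d b 0 (m + Suc 0)) 3)"
  proof (rule wz_telescope[where C = "\<lambda>m. 1000 ^ 3 * (8 * (growth_bound m / (real m)\<^sup>2))" and \<sigma> = Suc])
    fix n m assume mn: "Suc n \<le> m"
    show "fps_nth (F_Q d b (Suc n) (Suc m)) 3 - fps_nth (F_Q d b n (Suc m)) 3 = fps_nth (G_Q d b n (Suc m)) 3 - fps_nth (G_Q d b n m) 3"
      using arg_cong[OF wz_Q[OF mn, of d b], of "\<lambda>f. fps_nth f 3"] by simp
    show "\<bar>fps_nth (F_Q d b n m) 3\<bar> \<le> 1000 ^ 3 * (8 * (growth_bound m / (real m)\<^sup>2))"
      by (rule order_trans[OF coeff_le_norm mult_left_mono[OF F[OF mn]]]) auto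
  next
    show "summable (\<lambda>m. 1000 ^ 3 * (8 * (growth_bound m / (real m)\<^sup>2)))" by (intro summable_mult summable_growth_bound)
  qed (auto intro!: nth_tendsto_0_of_norm G)
  moreover have "{Suc n<..<Suc (Suc n)} = {}" for n by auto
  ultimately show ?thesis by simp
qed

text \<open>The edge is \<open>m = 2 n + 1\<close>.  It moves by two steps, which leaves the extra term at \<open>m = 2 n + 2\<close> in row \<open>n + 1\<close>.\<close>
lemma edge_sums_D:
  assumes c: "\<bar>a\<bar> \<le> 10" "\<bar>u\<bar> \<le> 10" "\<bar>v\<bar> \<le> 10" "\<bar>a - u\<bar> \<le> 10" "\<bar>a - v\<bar> \<le> 10" "\<bar>a - 2 * u - 2 * v\<bar> \<le> 10"
  shows "(\<lambda>n. fps_nth (F_D a u v n (2 * n + 1) + G_D a u v n (2 * n + 1) + F_D a u v (Suc n) (2 * n + 2)) 3)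
     sums (\<Sum>m. fps_nth (F_D a u v 0 (Suc m)) 3)"
proof -
  have lfb: "coeff_norm (lin a (2 * real m)) \<le> 3 * real m" "coeff_norm (lin a (2 * real m + 1)) \<le> 4 * real m"
    "coeff_norm (lin u (real m)) \<le> 2 * real m" "coeff_norm (lin v (real m)) \<le> 2 * real m" if "m \<ge> 1" for m
    using that c(1-3) by (auto simp: coeff_norm_lin)
  have F: "coeff_norm (F_D a u v n m) \<le> 3 * (growth_bound m / (real m)\<^sup>2)" if "Suc n \<le> m" for n m
  proof -
    have m: "m \<ge> 1" using that by simp
    have "coeff_norm (F_D a u v n m) \<le> growth_bound m / real m ^ 3 * (3 * real m)"
      unfolding F_D_def by (intro coeff_norm_multI coeff_norm_kernel_D c lfb that m)
    also have "\<dots> = 3 * (growth_bound m / (real m)\<^sup>2)" using m by (simp add: power3_eq_cube power2_eq_square)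
    finally show ?thesis .
  qed
  have G: "(\<lambda>m. coeff_norm (G_D a u v n m)) \<longlonglongrightarrow> 0" for n
  proof (rule Lim_null_comparison)
    define c0 where "c0 = coeff_norm (inverse (lin (a - 2 * u - 2 * v) (1 + 2 * real n)))"
    show "(\<lambda>m. 16 * c0 * (growth_bound m / real m)) \<longlonglongrightarrow> 0"
      by (intro tendsto_mult_right_zero growth_bound_over_lim)
    show "\<forall>\<^sub>F m in sequentially. norm (coeff_norm (G_D a u v n m)) \<le> 16 * c0 * (growth_bound m / real m)"
    proof (rule eventually_sequentiallyI[of "Suc n"])
      fix m assume mn: "Suc n \<le> m"
      have m: "m \<ge> 1" using mn by simp
      have q: "1 / (real m + real n + 1) \<le> 1 / real m"
        using m by (intro divide_left_mono) auto
      have "coeff_norm (G_D a u v n m) \<le> growth_bound m / real m ^ 3 * (4 * real m * (2 * real m) * (2 * real m) * c0 * (1 / real m))"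
        unfolding G_D_def c0_def using q by (intro coeff_norm_multI coeff_norm_kernel_D c lfb m mn) auto
      also have "\<dots> = 16 * c0 * (growth_bound m / real m)" using m by (simp add: power3_eq_cube field_simps)
      finally show "norm (coeff_norm (G_D a u v n m)) \<le> 16 * c0 * (growth_bound m / real m)" by simp
    qed
  qed
  have "(\<lambda>n. fps_nth (F_D a u v n (2 * n + 1)) 3 + fps_nth (G_D a u v n (2 * n + 1)) 3
      + (\<Sum>m\<in>{2 * n + 1<..<2 * Suc n + 1}. fps_nth (F_D a u v (Suc n) m) 3))
     sums (\<Sum>m. fps_nth (F_D a u v 0 (m + (2 * 0 + 1))) 3)"
  proof (rule wz_telescope[where C = "\<lambda>m. 1000 ^ 3 * (3 * (growth_bound m / (real m)\<^sup>2))" and \<sigma> = "\<lambda>n. 2 * n + 1"])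
    fix n m :: nat assume "2 * n + 1 \<le> m"
    hence mn: "Suc n \<le> m" by simp
    show "fps_nth (F_D a u v (Suc n) (Suc m)) 3 - fps_nth (F_D a u v n (Suc m)) 3 = fps_nth (G_D a u v n (Suc m)) 3 - fps_nth (G_D a u v n m) 3"
      using arg_cong[OF wz_D[OF mn, of a u v], of "\<lambda>f. fps_nth f 3"] by simp
    show "\<bar>fps_nth (F_D a u v n m) 3\<bar> \<le> 1000 ^ 3 * (3 * (growth_bound m / (real m)\<^sup>2))"
      by (rule order_trans[OF coeff_le_norm mult_left_mono[OF F[OF mn]]]) auto
  next
    show "summable (\<lambda>m. 1000 ^ 3 * (3 * (growth_bound m / (real m)\<^sup>2)))" by (intro summable_mult summable_growth_bound)
  qed (auto intro!: nth_tendsto_0_of_norm G)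
  moreover have "{2 * n + 1<..<2 * Suc n + 1} = {2 * n + 2}" for n :: nat by auto
  ultimately show ?thesis by simp
qed

section \<open>The row sum of the family Q\<close>

lemma lin_prod_append: "lin_prod c r p (j + k) = lin_prod c r p j * lin_prod c (r + p * real j) p k"
  by (induction k) (simp_all add: lin_prod_Suc algebra_simps)

lemma scal_prod_append: "scal_prod r p (j + k) = scal_prod r p j * scal_prod (r + p * real j) p k"
  by (induction k) (simp_all add: scal_prod_Suc algebra_simps)

lemma lin_prod_0_start: "lin_prod c 0 p (Suc k) = X_part c * lin_prod c p p k"
  by (simp add: lin_prod_shift lin_X_part)

lemma coeff_norm_X_part: "coeff_norm (X_part c) = \<bar>c\<bar> / 1000"
  using coeff_norm_lin[of c 0] by (simp add: lin_X_part)

lemma nth_5_X_part_mult: "fps_nth (X_part a * X_part b * f) 5 = a * b * fps_nth f 3"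
proof -
  have "X_part a * X_part b * f = fps_const (a * b) * (fps_X * (fps_X * f))" by (simp add: X_part_def mult_ac flip: fps_const_mult)
  thus ?thesis by (simp only: fps_mult_left_const_nth) (simp add: eval_nat_numeral)
qed

lemma coeff_norm_add: "coeff_norm (f + g) \<le> coeff_norm f + coeff_norm g"
  unfolding coeff_norm_def sum.distrib[symmetric]
  by (intro sum_mono) (simp add: add_divide_distrib[symmetric] divide_right_mono abs_triangle_ineq)

lemma coeff_norm_uminus [simp]: "coeff_norm (- f) = coeff_norm f"
  by (simp add: coeff_norm_def)

lemma scal_prod_ge_fact: "r \<ge> 1 \<Longrightarrow> p \<ge> 1 \<Longrightarrow> r * fact k \<le> scal_prod r p (Suc k)"
proof (induction k)
  case (Suc k)
  define y where "y = p * real (Suc k)"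
  have "real (Suc k) \<le> y" unfolding y_def
    using mult_right_mono[OF Suc.prems(2) of_nat_0_le_iff[of "Suc k"]] by (simp only: mult_1)
  hence "real (Suc k) \<le> r + p * real (Suc k)"
    unfolding y_def[symmetric] using Suc.prems(1) by linarith
  from mult_mono[OF Suc.IH[OF Suc.prems] this]
  have "r * fact k * real (Suc k) \<le> scal_prod r p (Suc k) * (r + p * real (Suc k))"
    using Suc.prems scal_prod_pos[of r p "Suc k"] by simp
  thus ?case by (simp add: scal_prod_Suc[of _ _ "Suc k"] algebra_simps)
qed (simp add: scal_prod_Suc)

lemma scal_prod_ge_fact_Suc: "r \<ge> 1 \<Longrightarrow> p \<ge> 1 \<Longrightarrow> r * fact (Suc k) \<le> scal_prod r p (Suc k)"
proof (induction k)
  case (Suc k)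
  define y where "y = p * real (Suc k)"
  have "real (Suc k) \<le> y" unfolding y_def
    using mult_right_mono[OF Suc.prems(2) of_nat_0_le_iff[of "Suc k"]] by (simp only: mult_1)
  hence "real (Suc (Suc k)) \<le> r + p * real (Suc k)"
    unfolding y_def[symmetric] using Suc.prems(1) by simp
  from mult_mono[OF Suc.IH[OF Suc.prems] this]
  have "r * fact (Suc k) * real (Suc (Suc k)) \<le> scal_prod r p (Suc k) * (r + p * real (Suc k))"
    using Suc.prems scal_prod_pos[of r p "Suc k"] by simp
  thus ?case by (simp add: scal_prod_Suc[of _ _ "Suc k"] algebra_simps)
qed (simp add: scal_prod_Suc)

lemma scal_prod_ge_2_fact: "r \<ge> 2 \<Longrightarrow> 2 ^ k * fact k \<le> scal_prod r 2 k"
proof (induction k)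
  case (Suc k)
  have "2 ^ k * fact k * (2 * real (Suc k)) \<le> scal_prod r 2 k * (r + 2 * real k)"
    using Suc scal_prod_pos[of r 2 k] by (intro mult_mono) auto
  thus ?case by (simp add: scal_prod_Suc algebra_simps)
qed simp

lemma two_terms: "(\<Sum>j<2. f j) = f 0 + f (1::nat)"
  by (simp add: numeral_2_eq_2)

text \<open>Row \<open>0\<close> of the family Q with \<open>d X\<close> replaced by \<open>2 i + d X\<close> in some of the places.  The two factors with start
\<open>0\<close> supply the factor \<open>X\<^sup>2\<close>.\<close>
definition shift_kernel_Q :: "real \<Rightarrow> real \<Rightarrow> nat \<Rightarrow> nat \<Rightarrow> real fps" where
  "shift_kernel_Q d b i m = fps_const (1 / (2 ^ m * fact m * scal_prod (2 * real i + 1) 1 m)) *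
     (lin_prod d (2 * real i + 1) 1 (m - 1) * lin_prod b 0 1 m * lin_prod (-b) 1 1 m * lin_prod d 0 2 m *
      inverse (lin_prod (d - b) (2 * real i + 2) 2 m) * inverse (lin_prod (d + b) (2 * real i + 1) 2 m))"

definition shift_term_Q where "shift_term_Q d b i m = (if m = 0 then 1 else shift_kernel_Q d b i m * lin d (2 * real i + 3 * real m))"

definition shift_mate_Q where "shift_mate_Q d b i m = (if m = 0 then 0 else
  - (shift_kernel_Q d b i m * (fps_const (2 * real m / (2 * real i + 1 + real m)) * lin d (4 * real i + 2 * real m + 1))))"

definition shift_ratio_Q where "shift_ratio_Q d b i = fps_const (1 / ((2 * real i + 1) * (2 * real i + 2))) *
   (lin_prod d (2 * real i + 1) 1 2 * lin (-b) (2 * real i + 2) * lin b (2 * real i + 1) *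
    inverse (lin (d - b) (2 * real i + 2)) * inverse (lin (d + b) (2 * real i + 1)))"

lemma ring_shift_Q_start:
  fixes i b d :: "'a::idom"
  shows "(2*i+1)*(2*i+2)*(2*i+2+(d-b))*(2*i+1+(d+b)) - (2*i+1+d)*(2*i+2+d)*(2*i+2+ - b)*(2*i+1+b)
    = - (b * (1 + - b) * d * (4*i+3+d))"
  by algebra

lemma ring_shift_Q:
  fixes i b d k :: "'a::idom"
  shows "(2*i+1+(k+1))*(2*i+1+(k+1)+1)*(2*i+2+2*(k+1)+(d-b))*(2*i+1+2*(k+1)+(d+b))*(2*i+3*(k+1)+d)
     - (2*i+2+3*(k+1)+d)*((2*i+1+k+d)*(2*i+2+k+d))*(2*i+2+ - b)*(2*i+1+b)
    = - ((2*i+1+k+d)*(k+1+b)*(1+(k+1)+ - b)*(2*(k+1)+d)*(4*i+2*(k+1)+3+d))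
      - - (2*(k+1)*(2*i+1+(k+1)+1)*(2*i+2+2*(k+1)+(d-b))*(2*i+1+2*(k+1)+(d+b))*(4*i+2*(k+1)+1+d))"
  by algebra

text \<open>The mate is a rational multiple of the summand, so that the relation is again a polynomial identity.  Index \<open>0\<close> is treated
separately, because the factor \<open>2 i + d X\<close>, which has been cancelled in the other terms, is not invertible for \<open>i = 0\<close>.\<close>
lemma shift_step_Q: "shift_term_Q d b i m - shift_ratio_Q d b i * shift_term_Q d b (Suc i) m = shift_mate_Q d b i (Suc m) - shift_mate_Q d b i m"
proof (cases m)
  case 0
  define I where "I = real i"
  have I: "I \<ge> 0" by (simp add: I_def)
  define J where "J = fps_const (1 / ((2 * I + 1) * (2 * I + 2))) *
     (inverse (lin (d - b) (2 * I + 2)) * inverse (lin (d + b) (2 * I + 1)))"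
  have e: "inverse (lin (d - b) (2 * I + 2)) * lin (d - b) (2 * I + 2) = 1"
    "inverse (lin (d + b) (2 * I + 1)) * lin (d + b) (2 * I + 1) = 1"
    "fps_const (1 / ((2 * I + 1) * (2 * I + 2))) * fps_const ((2 * I + 1) * (2 * I + 2)) = 1"
    using I by (auto intro!: inverse_mult_eq_1 simp: lin_nth)
  have 1: "1 = J * (fps_const ((2 * I + 1) * (2 * I + 2)) * lin (d - b) (2 * I + 2) * lin (d + b) (2 * I + 1))"
  proof -
    have "1 = (inverse (lin (d - b) (2 * I + 2)) * lin (d - b) (2 * I + 2)) *
      (inverse (lin (d + b) (2 * I + 1)) * lin (d + b) (2 * I + 1)) *
      (fps_const (1 / ((2 * I + 1) * (2 * I + 2))) * fps_const ((2 * I + 1) * (2 * I + 2)))" unfolding e by simp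
    thus ?thesis unfolding J_def by (simp only: mult_ac)
  qed
  have A2: "lin_prod d (2 * I + 1) 1 2 = lin d (2 * I + 1) * lin d (2 * I + 2)"
    by (simp add: eval_nat_numeral lin_prod_Suc algebra_simps)
  have 2: "shift_ratio_Q d b i = J * (lin d (2 * I + 1) * lin d (2 * I + 2) * lin (-b) (2 * I + 2) * lin b (2 * I + 1))"
    unfolding shift_ratio_Q_def J_def I_def[symmetric] A2 by (simp only: mult_ac)
  have 3: "shift_mate_Q d b i (Suc 0) = J * (- (X_part b * lin (-b) 1 * X_part d * lin d (4 * I + 3)))"
  proof -
    have c: "fps_const (1 / ((2 * I + 1) * (2 * I + 2))) = fps_const (1 / (2 * (2 * I + 1))) * fps_const (2 / (2 * I + 2))"
      unfolding fps_const_mult using I by (simp add: divide_simps; simp add: algebra_simps)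
    show ?thesis unfolding shift_mate_Q_def shift_kernel_Q_def J_def c I_def[symmetric]
      by (simp add: lin_prod_Suc scal_prod_Suc lin_X_part[of _ 0] mult_ac add_ac)
  qed
  have "fps_const ((2 * I + 1) * (2 * I + 2)) * lin (d - b) (2 * I + 2) * lin (d + b) (2 * I + 1)
     - lin d (2 * I + 1) * lin d (2 * I + 2) * lin (-b) (2 * I + 2) * lin b (2 * I + 1) = - (X_part b * lin (-b) 1 * X_part d * lin d (4 * I + 3))"
    unfolding lin_X_part X_part_hom fps_const_hom by (rule ring_shift_Q_start)
  hence "J * (fps_const ((2 * I + 1) * (2 * I + 2)) * lin (d - b) (2 * I + 2) * lin (d + b) (2 * I + 1)) - shift_ratio_Q d b i = shift_mate_Q d b i (Suc 0)"
    unfolding 2 3 by (simp only: right_diff_distrib[symmetric])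
  thus ?thesis using 0 1 by (simp add: shift_term_Q_def shift_mate_Q_def[of _ _ _ 0])
next
  case (Suc k)
  define I where "I = real i"
  define K where "K = real k"
  have I: "I \<ge> 0" "K \<ge> 0" by (simp_all add: I_def K_def)
  have m: "real m = K + 1" "real (Suc m) = K + 2" by (simp_all add: K_def Suc)
  have i': "2 * real (Suc i) + 1 = 2 * I + 3" "2 * real (Suc i) + 2 = 2 * I + 4" by (simp_all add: I_def)
  define w where "w = 1 / (2 ^ m * fact m * scal_prod (2 * I + 1) 1 (Suc (Suc m)))"
  define V where "V = lin_prod d (2 * I + 1) 1 k * lin_prod b 0 1 m * lin_prod (-b) 1 1 m * lin_prod d 0 2 m *
      inverse (lin_prod (d - b) (2 * I + 2) 2 (Suc m)) * inverse (lin_prod (d + b) (2 * I + 1) 2 (Suc m))"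
  have ap0: "scal_prod (2 * I + 1) 1 m \<noteq> 0" "scal_prod (2 * I + 1) 1 (Suc m) \<noteq> 0" "scal_prod (2 * I + 3) 1 m \<noteq> 0"
    using scal_prod_pos[of "2 * I + 1" 1 m] scal_prod_pos[of "2 * I + 1" 1 "Suc m"] scal_prod_pos[of "2 * I + 3" 1 m] I by auto
  have iv: "inverse (lin_prod (d - b) (2 * I + 2) 2 m) = inverse (lin_prod (d - b) (2 * I + 2) 2 (Suc m)) * lin (d - b) (2 * I + 2 + 2 * (K + 1))"
    "inverse (lin_prod (d + b) (2 * I + 1) 2 m) = inverse (lin_prod (d + b) (2 * I + 1) 2 (Suc m)) * lin (d + b) (2 * I + 1 + 2 * (K + 1))"
    using inverse_lin_prod_Suc[of "2 * I + 2" 2 m "d - b"] inverse_lin_prod_Suc[of "2 * I + 1" 2 m "d + b"] I unfolding m by simp_all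
  have mk: "m - 1 = k" "Suc m - 1 = Suc k" by (simp_all add: Suc)
  have 1: "shift_term_Q d b i m = fps_const w * V * (fps_const ((2 * I + 1 + (K + 1)) * (2 * I + 1 + (K + 1) + 1)) *
      lin (d - b) (2 * I + 2 + 2 * (K + 1)) * lin (d + b) (2 * I + 1 + 2 * (K + 1)) * lin d (2 * I + 3 * (K + 1)))"
  proof -
    have c: "1 / (2 ^ m * fact m * scal_prod (2 * I + 1) 1 m) = w * ((2 * I + 1 + (K + 1)) * (2 * I + 1 + (K + 1) + 1))"
      unfolding w_def scal_prod_Suc using ap0 I by (simp add: divide_simps m; simp add: algebra_simps)
    have "shift_term_Q d b i m = shift_kernel_Q d b i m * lin d (2 * I + 3 * (K + 1))" by (simp add: shift_term_Q_def Suc I_def K_def algebra_simps)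
    thus ?thesis unfolding shift_kernel_Q_def I_def[symmetric] V_def c iv mk by (simp only: fps_const_mult[symmetric] mult_ac)
  qed
  have 2: "shift_ratio_Q d b i * shift_term_Q d b (Suc i) m = fps_const w * V * (lin d (2 * I + 2 + 3 * (K + 1)) *
     (lin d (2 * I + 1 + K) * lin d (2 * I + 2 + K)) * lin (-b) (2 * I + 2) * lin b (2 * I + 1))"
  proof -
    have c: "1 / ((2 * I + 1) * (2 * I + 2)) * (1 / (2 ^ m * fact m * scal_prod (2 * I + 3) 1 m)) = w"
      using scal_prod_append[of "2 * I + 1" 1 2 m] I by (simp add: w_def eval_nat_numeral scal_prod_Suc[of _ _ 0] scal_prod_Suc[of _ _ "Suc 0"] algebra_simps)
    have d: "lin_prod d (2 * I + 1) 1 2 * lin_prod d (2 * I + 3) 1 k = lin_prod d (2 * I + 1) 1 k * lin d (2 * I + 1 + K) * lin d (2 * I + 2 + K)"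
      using lin_prod_append[of d "2 * I + 1" 1 2 k] by (simp add: lin_prod_Suc K_def algebra_simps)
    have iw: "inverse (lin_prod (d - b) (2 * I + 2) 2 (Suc m)) = inverse (lin (d - b) (2 * I + 2)) * inverse (lin_prod (d - b) (2 * I + 4) 2 m)"
      "inverse (lin_prod (d + b) (2 * I + 1) 2 (Suc m)) = inverse (lin (d + b) (2 * I + 1)) * inverse (lin_prod (d + b) (2 * I + 3) 2 m)"
      by (simp_all add: lin_prod_shift fps_inverse_mult add_ac)
    have "shift_term_Q d b (Suc i) m = shift_kernel_Q d b (Suc i) m * lin d (2 * I + 2 + 3 * (K + 1))" by (simp add: shift_term_Q_def Suc I_def K_def algebra_simps)
    hence "shift_ratio_Q d b i * shift_term_Q d b (Suc i) m =
      (fps_const (1 / ((2 * I + 1) * (2 * I + 2))) * fps_const (1 / (2 ^ m * fact m * scal_prod (2 * I + 3) 1 m))) *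
      (lin_prod d (2 * I + 1) 1 2 * lin_prod d (2 * I + 3) 1 k) * (lin_prod b 0 1 m * lin_prod (-b) 1 1 m * lin_prod d 0 2 m *
      inverse (lin_prod (d - b) (2 * I + 2) 2 (Suc m)) * inverse (lin_prod (d + b) (2 * I + 1) 2 (Suc m))) *
      (lin d (2 * I + 2 + 3 * (K + 1)) * lin (-b) (2 * I + 2) * lin b (2 * I + 1))"
      unfolding shift_ratio_Q_def shift_kernel_Q_def I_def[symmetric] i' mk iw by (simp only: mult_ac)
    thus ?thesis unfolding fps_const_mult c d V_def by (simp only: mult_ac)
  qed
  have 3: "shift_mate_Q d b i (Suc m) = fps_const w * V * (- (lin d (2 * I + 1 + K) * lin b (K + 1) * lin (-b) (1 + (K + 1)) *
      lin d (2 * (K + 1)) * lin d (4 * I + 2 * (K + 1) + 3)))"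
  proof -
    have c: "1 / (2 ^ Suc m * fact (Suc m) * scal_prod (2 * I + 1) 1 (Suc m)) * (2 * (K + 2) / (2 * I + 1 + (K + 2))) = w"
      unfolding w_def scal_prod_Suc[of _ _ "Suc m"] m fact_Suc using ap0 I by (simp add: divide_simps; simp add: algebra_simps)
    have s: "lin_prod b 0 1 (Suc m) = lin_prod b 0 1 m * lin b (K + 1)" "lin_prod (-b) 1 1 (Suc m) = lin_prod (-b) 1 1 m * lin (-b) (1 + (K + 1))"
       "lin_prod d 0 2 (Suc m) = lin_prod d 0 2 m * lin d (2 * (K + 1))" "lin_prod d (2 * I + 1) 1 (Suc k) = lin_prod d (2 * I + 1) 1 k * lin d (2 * I + 1 + K)"
      by (simp_all add: lin_prod_Suc m K_def)
    have "4 * I + 2 * (K + 2) + 1 = 4 * I + 2 * (K + 1) + 3" by simp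
    hence "shift_mate_Q d b i (Suc m) = fps_const (1 / (2 ^ Suc m * fact (Suc m) * scal_prod (2 * I + 1) 1 (Suc m)) * (2 * (K + 2) / (2 * I + 1 + (K + 2)))) * V *
       (- (lin d (2 * I + 1 + K) * lin b (K + 1) * lin (-b) (1 + (K + 1)) * lin d (2 * (K + 1)) * lin d (4 * I + 2 * (K + 1) + 3)))"
      unfolding shift_mate_Q_def shift_kernel_Q_def I_def[symmetric] mk s V_def m
      by (simp only: nat.simps if_False fps_const_mult[symmetric] mult_ac mult_minus_left mult_minus_right)
    thus ?thesis unfolding c .
  qed
  have 4: "shift_mate_Q d b i m = fps_const w * V * (- (fps_const (2 * (K + 1) * (2 * I + 1 + (K + 1) + 1)) *
      lin (d - b) (2 * I + 2 + 2 * (K + 1)) * lin (d + b) (2 * I + 1 + 2 * (K + 1)) * lin d (4 * I + 2 * (K + 1) + 1)))"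
  proof -
    have c: "1 / (2 ^ m * fact m * scal_prod (2 * I + 1) 1 m) * (2 * (K + 1) / (2 * I + 1 + (K + 1))) = w * (2 * (K + 1) * (2 * I + 1 + (K + 1) + 1))"
      unfolding w_def scal_prod_Suc m using ap0 I by (simp add: divide_simps m; simp add: algebra_simps)
    have m0: "m \<noteq> 0" by (simp add: Suc)
    have "shift_mate_Q d b i m = fps_const (1 / (2 ^ m * fact m * scal_prod (2 * I + 1) 1 m) * (2 * (K + 1) / (2 * I + 1 + (K + 1)))) * V *
      (- (lin (d - b) (2 * I + 2 + 2 * (K + 1)) * lin (d + b) (2 * I + 1 + 2 * (K + 1)) * lin d (4 * I + 2 * (K + 1) + 1)))"
      unfolding shift_mate_Q_def shift_kernel_Q_def I_def[symmetric] mk V_def m iv using m0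
      by (simp only: if_False fps_const_mult[symmetric] mult_ac mult_minus_left mult_minus_right)
    thus ?thesis unfolding c by (simp only: fps_const_mult[symmetric] mult_ac mult_minus_left mult_minus_right)
  qed
  show ?thesis unfolding 1 2 3 4 right_diff_distrib[symmetric]
    unfolding lin_X_part X_part_hom fps_const_hom by (rule arg_cong[OF ring_shift_Q])
qed

lemma coeff_norm_shift_kernel_Q:
  assumes c: "\<bar>d\<bar> \<le> 10" "\<bar>b\<bar> \<le> 10" "\<bar>d - b\<bar> \<le> 10" "\<bar>d + b\<bar> \<le> 10" and m: "1 \<le> m"
  shows "coeff_norm (shift_kernel_Q d b i m) \<le> growth_bound m / (2 ^ m * real m * (2 * real i + 1) * (2 * real i + real m))"
proof -
  obtain k where mk: "m = Suc k" using m by (cases m) auto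
  define r where "r = 2 * real i + 1"
  have r: "r \<ge> 1" "2 * real i + 2 = r + 1" "2 * real i + 1 = r" by (simp_all add: r_def)
  define x :: real where "x = 1 / (2 ^ m * fact m * scal_prod r 1 m)"
  have A: "scal_prod r 1 m > 0" "scal_prod r 1 k > 0" "scal_prod (r + 1) 2 m > 0" "scal_prod r 2 m > 0" using r by (auto intro!: scal_prod_pos)
  have x: "coeff_norm (fps_const x) \<le> x" using A by (simp add: x_def)
  have z: "lin_prod b 0 1 m = X_part b * lin_prod b 1 1 k" "lin_prod d 0 2 m = X_part d * lin_prod d 2 2 k" "m - 1 = k"
    by (simp_all add: mk lin_prod_0_start)
  define E where "E = growth m"
  have E0: "E \<ge> 0" by (simp add: E_def)
  define s where "s = x * (scal_prod r 1 k * scal_prod 1 1 k * scal_prod 1 1 m * scal_prod 2 2 k * inverse (scal_prod (r + 1) 2 m) * inverse (scal_prod r 2 m))"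
  have cc: "coeff_norm (X_part b) \<le> 1" "coeff_norm (X_part d) \<le> 1" using c by (auto simp: coeff_norm_X_part)
  have "coeff_norm (shift_kernel_Q d b i m) \<le> x * (scal_prod r 1 k * E * (1 * (scal_prod 1 1 k * E)) * (scal_prod 1 1 m * E) * (1 * (scal_prod 2 2 k * E)) *
     (inverse (scal_prod (r + 1) 2 m) * E\<^sup>2) * (inverse (scal_prod r 2 m) * E\<^sup>2))"
    unfolding shift_kernel_Q_def r(2,3) x_def[symmetric] E_def z
    by (intro coeff_norm_multI coeff_norm_lin_prod_le coeff_norm_inverse_lin_prod_le x cc) (use c r(1) mk in auto)
  also have "\<dots> = s * E ^ 8" unfolding s_def by (simp add: power2_eq_square power_numeral_reduce)
  finally have 1: "coeff_norm (shift_kernel_Q d b i m) \<le> s * E ^ 8" .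
  have rk0: "r + real k > 0" using r by simp
  have rk: "r + real k = 2 * real i + real m" by (simp add: r_def mk)
  have "s \<le> 1 / (2 ^ m * real m * r * (r + real k))"
  proof -
    have am: "scal_prod r 1 m = scal_prod r 1 k * (r + real k)" by (simp add: mk scal_prod_Suc)
    have "r * fact k \<le> scal_prod r 2 m" unfolding mk by (rule scal_prod_ge_fact) (use r in auto)
    moreover have "2 ^ m * fact m \<le> scal_prod (r + 1) 2 m" by (rule scal_prod_ge_2_fact) (use r in auto)
    ultimately have q: "inverse (scal_prod (r + 1) 2 m) * inverse (scal_prod r 2 m) \<le> inverse (2 ^ m * fact m) * inverse (r * fact k)"
      using r A by (intro mult_mono le_imp_inverse_le) auto
    have "s = (fact k * 2 ^ k * fact k) / (2 ^ m * (r + real k)) * (inverse (scal_prod (r + 1) 2 m) * inverse (scal_prod r 2 m))"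
      unfolding s_def x_def scal_prod_1_1 scal_prod_2_2 am using A rk0 by (simp add: divide_simps)
    also have "\<dots> \<le> (fact k * 2 ^ k * fact k) / (2 ^ m * (r + real k)) * (inverse (2 ^ m * fact m) * inverse (r * fact k))"
      using r by (intro mult_left_mono q) auto
    also have "\<dots> = 1 / (2 ^ m * real m * r * (r + real k)) * (1 / 2)"
    proof -
      have fm: "fact m = real m * fact k" "2 ^ m = 2 * 2 ^ k" by (simp_all add: mk)
      have m0: "real m > 0" by (simp add: mk)
      show ?thesis unfolding fm using r rk0 m0 by (simp add: divide_simps)
    qed
    also have "\<dots> \<le> 1 / (2 ^ m * real m * r * (r + real k))"
    proof -
      have "0 \<le> 1 / (2 ^ m * real m * r * (r + real k))"
        using r rk0 by (intro divide_nonneg_nonneg mult_nonneg_nonneg) auto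
      thus ?thesis by (intro mult_right_le_one_le) auto
    qed
    finally show ?thesis .
  qed
  hence "s * E ^ 8 \<le> 1 / (2 ^ m * real m * r * (r + real k)) * growth_bound m"
    using growth_pow_le[of 8 m] E0 r unfolding E_def by (intro mult_mono) auto
  with 1 show ?thesis unfolding rk r(3) by simp
qed

text \<open>The ratio \<open>shift_ratio_Q\<close> has factors over \<open>2 i + 1\<close> and \<open>2 i + 2\<close> only, which is why its power sums split into
an odd and an even part.  The factor \<open>b d X\<^sup>2 / 2\<close> between the terms here and \<open>F_Q\<close> turns coefficient \<open>5\<close> into
coefficient \<open>3\<close>.\<close>
lemma row_sum_Q:
  assumes c: "\<bar>d\<bar> \<le> 10" "\<bar>b\<bar> \<le> 10" "\<bar>d - b\<bar> \<le> 10" "\<bar>d + b\<bar> \<le> 10" and nz: "d \<noteq> 0" "b \<noteq> 0"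
    and Ev: "\<And>r. r \<in> {2..5} \<Longrightarrow> (\<lambda>i. (1 / (2 * real i + 2)) ^ r) sums Ev r"
    and Od: "\<And>r. r \<in> {2..5} \<Longrightarrow> (\<lambda>i. (1 / (2 * real i + 1)) ^ r) sums Od r"
  defines "H \<equiv> \<lambda>r. (d ^ r + (-b) ^ r - (d - b) ^ r) * Ev r + (d ^ r + b ^ r - (d + b) ^ r) * Od r"
  shows "(\<Sum>m. fps_nth (F_Q d b 0 (Suc m)) 3) = 2 * (H 5 / 5 - H 2 * H 3 / 6) / (b * d)"
proof -
  define h where "h i s = (d ^ s + (-b) ^ s - (d - b) ^ s) * (1 / (2 * real i + 2)) ^ s + (d ^ s + b ^ s - (d + b) ^ s) * (1 / (2 * real i + 1)) ^ s" for i s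
  have pw: "growth_bound m / 2 ^ m \<le> 2 * (growth_bound m / (real m)\<^sup>2)" if "m \<ge> 1" for m
    using mult_left_mono[OF square_le_pow[of m], of "growth_bound m"] growth_bound_pos[of m] that by (simp add: field_simps)
  have "(\<lambda>m. fps_nth (shift_term_Q d b 0 (Suc m)) 5) sums (H 5 / 5 - H 2 * H 3 / 6)"
  proof (rule coeff_5_of_shift_invariant_sum[where \<rho> = "shift_ratio_Q d b" and Y = "shift_mate_Q d b" and B = "\<lambda>m. 8 * (growth_bound m / (real m)\<^sup>2)" and h = h])
    fix i m :: nat assume m: "1 \<le> m"
    have l: "coeff_norm (lin d (2 * real i + 3 * real m)) \<le> 4 * (2 * real i + real m)" using m c by (simp add: coeff_norm_lin)
    have "shift_term_Q d b i m = shift_kernel_Q d b i m * lin d (2 * real i + 3 * real m)" using m by (simp add: shift_term_Q_def)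
    also have "coeff_norm \<dots> \<le> growth_bound m / (2 ^ m * real m * (2 * real i + 1) * (2 * real i + real m)) * (4 * (2 * real i + real m))"
      by (intro coeff_norm_multI coeff_norm_shift_kernel_Q c l m)
    also have "\<dots> = 4 * (growth_bound m / 2 ^ m) / real m / (2 * real i + 1)" using m by (simp add: divide_simps)
    also have "\<dots> \<le> 4 * (2 * (growth_bound m / (real m)\<^sup>2)) / 1 / (2 * real i + 1)"
      using m pw[OF m] growth_bound_pos[of m] by (intro divide_right_mono frac_le mult_left_mono) auto
    finally show "coeff_norm (shift_term_Q d b i m) \<le> 8 * (growth_bound m / (real m)\<^sup>2) / real (2 * i + 1)" by (simp add: add_ac)
  next
    fix i
    show "(\<lambda>m. coeff_norm (shift_mate_Q d b i m)) \<longlonglongrightarrow> 0"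
    proof (rule Lim_null_comparison)
      show "(\<lambda>m. 16 * (growth_bound m / (real m)\<^sup>2)) \<longlonglongrightarrow> 0"
        by (intro tendsto_mult_right_zero summable_LIMSEQ_zero summable_growth_bound)
      show "\<forall>\<^sub>F m in sequentially. norm (coeff_norm (shift_mate_Q d b i m)) \<le> 16 * (growth_bound m / (real m)\<^sup>2)"
      proof (rule eventually_sequentiallyI[of 1])
        fix m :: nat assume m: "1 \<le> m"
        have l: "coeff_norm (lin d (4 * real i + 2 * real m + 1)) \<le> 4 * (2 * real i + real m)" using m c by (simp add: coeff_norm_lin)
        have q: "coeff_norm (fps_const (2 * real m / (2 * real i + 1 + real m))) \<le> 2" by (simp add: divide_simps)
        have "coeff_norm (shift_mate_Q d b i m) = coeff_norm (shift_kernel_Q d b i m * (fps_const (2 * real m / (2 * real i + 1 + real m)) * lin d (4 * real i + 2 * real m + 1)))"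
          using m by (simp add: shift_mate_Q_def)
        also have "\<dots> \<le> growth_bound m / (2 ^ m * real m * (2 * real i + 1) * (2 * real i + real m)) * (2 * (4 * (2 * real i + real m)))"
          by (intro coeff_norm_multI coeff_norm_shift_kernel_Q c l m q)
        also have "\<dots> = 8 * (growth_bound m / 2 ^ m) / (real m * (2 * real i + 1))" using m by (simp add: divide_simps)
        also have "\<dots> \<le> 8 * (2 * (growth_bound m / (real m)\<^sup>2)) / (1 * 1)"
          using m pw[OF m] growth_bound_pos[of m] by (intro frac_le mult_left_mono mult_mono) auto
        finally show "norm (coeff_norm (shift_mate_Q d b i m)) \<le> 16 * (growth_bound m / (real m)\<^sup>2)" by simp
      qed
    qed
  next
    show "summable (\<lambda>m. 8 * (growth_bound m / (real m)\<^sup>2))" by (intro summable_mult summable_growth_bound)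
  next
    fix i
    define r where "r = 2 * real i + 1"
    have r: "r > 0" "2 * real i + 2 = r + 1" "2 * real i + 1 = r" by (simp_all add: r_def)
    have "power_sums (shift_ratio_Q d b i) (\<lambda>s. 0 + ((\<Sum>j<2. (d / (r + 1 * real j)) ^ s) + (-b / (r + 1)) ^ s + (b / r) ^ s
       + - (((d - b) / (r + 1)) ^ s) + - (((d + b) / r) ^ s)))"
      unfolding shift_ratio_Q_def r using r
      by (intro power_sums_mult power_sums_const power_sums_lin_prod power_sums_lin power_sums_inverse) (auto simp: lin_nth)
    also have "(\<lambda>s. 0 + ((\<Sum>j<2. (d / (r + 1 * real j)) ^ s) + (-b / (r + 1)) ^ s + (b / r) ^ s
       + - (((d - b) / (r + 1)) ^ s) + - (((d + b) / r) ^ s))) = h i"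
      unfolding h_def r by (rule ext, simp only: two_terms power_divide)
        (simp add: algebra_simps add_divide_distrib diff_divide_distrib)
    finally show "power_sums (shift_ratio_Q d b i) (h i)" .
    show "fps_nth (shift_ratio_Q d b i) 0 = 1" unfolding shift_ratio_Q_def r(2,3)
      using r(1) by (simp add: lin_prod_nth_0 lin_nth eval_nat_numeral scal_prod_Suc divide_simps)
    show "h i 1 = 0" by (simp add: h_def)
  next
    fix s :: nat assume s: "s \<in> {2..5}"
    show "(\<lambda>i. h i s) sums H s" unfolding h_def H_def by (intro sums_add sums_mult Ev Od s)
  qed (simp add: shift_term_Q_def, rule shift_step_Q, simp add: shift_mate_Q_def)
  moreover have "fps_nth (shift_term_Q d b 0 (Suc m)) 5 = b * d / 2 * fps_nth (F_Q d b 0 (Suc m)) 3" for m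
  proof -
    have "shift_term_Q d b 0 (Suc m) = X_part b * X_part d * (fps_const (1/2) * F_Q d b 0 (Suc m))"
    proof -
      have c: "1 / (2 ^ Suc m * fact (Suc m) * fact (Suc m)) = 1/2 * ((-1) ^ 0 / (2 ^ m * fact (Suc m) * fact (Suc m + 2 * 0)) :: real)"
        by simp
      show ?thesis unfolding shift_term_Q_def shift_kernel_Q_def F_Q_def kernel_Q_def lin_prod_0_start of_nat_0 mult_zero_right add_0 scal_prod_1_1 c diff_Suc_1 diff_0 minus_nat.diff_0 lin_prod_0
        by (simp only: nat.simps if_False fps_const_mult[symmetric] mult_ac mult_1 mult_1_right)
    qed
    thus ?thesis by (simp add: nth_5_X_part_mult)
  qed
  ultimately have "(\<lambda>m. b * d / 2 * fps_nth (F_Q d b 0 (Suc m)) 3) sums (H 5 / 5 - H 2 * H 3 / 6)" by simp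
  from sums_mult[OF this, of "2 / (b * d)"] show ?thesis using nz by (simp add: sums_iff)
qed

section \<open>The row sum of the family D\<close>

definition shift_kernel_D :: "real \<Rightarrow> real \<Rightarrow> real \<Rightarrow> nat \<Rightarrow> nat \<Rightarrow> real fps" where
  "shift_kernel_D a u v i m = fps_const (1 / fact m) *
     (lin_prod u 0 1 m * lin_prod v 0 1 m * lin_prod a (2 * real i + 1) 1 (m - 1) *
      inverse (lin_prod (a - u) (2 * real i + 1) 1 m) * inverse (lin_prod (a - v) (2 * real i + 1) 1 m))"

definition shift_term_D where "shift_term_D a u v i m = (if m = 0 then 1 else shift_kernel_D a u v i m * lin a (2 * real i + 2 * real m))"

text \<open>The coefficients of the cubic certificate polynomial for the shift of \<open>a\<close> by \<open>2\<close>.  They are determined by the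
identity \<open>ring_shift_D\<close>, which is linear in them.\<close>
definition cert_3 :: "'a::comm_ring_1 \<Rightarrow> 'a \<Rightarrow> 'a \<Rightarrow> 'a" where "cert_3 A u v = - 2 - 2 * A"
definition cert_2 :: "'a::comm_ring_1 \<Rightarrow> 'a \<Rightarrow> 'a \<Rightarrow> 'a" where
  "cert_2 A u v = - 5 + 4 * v + 4 * u - 12 * A + 4 * A * v + 4 * A * u - 7 * A ^ 2"
definition cert_1 :: "'a::comm_ring_1 \<Rightarrow> 'a \<Rightarrow> 'a \<Rightarrow> 'a" where
  "cert_1 A u v = - 3 + 4 * v + 4 * u + 2 * u * v - 4 * u * v ^ 2 - 4 * u ^ 2 * v - 13 * A + 10 * A * v + 10 * A * u
     + 2 * A * u * v - 17 * A ^ 2 + 6 * A ^ 2 * v + 6 * A ^ 2 * u - 7 * A ^ 3"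
definition cert_0 :: "'a::comm_ring_1 \<Rightarrow> 'a \<Rightarrow> 'a \<Rightarrow> 'a" where
  "cert_0 A u v = - 1 + 3 * v - 2 * v ^ 2 + 3 * u - 5 * u * v + 2 * u * v ^ 2 - 2 * u ^ 2 + 2 * u ^ 2 * v
     - 5 * A + 8 * A * v - 2 * A * v ^ 2 + 8 * A * u - 4 * A * u * v - 2 * A * u * v ^ 2 - 2 * A * u ^ 2 - 2 * A * u ^ 2 * v
     - 9 * A ^ 2 + 7 * A ^ 2 * v + 7 * A ^ 2 * u + A ^ 2 * u * v - 7 * A ^ 3 + 2 * A ^ 3 * v + 2 * A ^ 3 * u - 2 * A ^ 4"

definition cert :: "'a::comm_ring_1 \<Rightarrow> 'a \<Rightarrow> 'a \<Rightarrow> 'a \<Rightarrow> 'a" where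
  "cert A u v m = cert_3 A u v * m ^ 3 + cert_2 A u v * m ^ 2 + cert_1 A u v * m + cert_0 A u v"

definition shift_mate_D where "shift_mate_D a u v i m = (if m = 0 then 0 else
  shift_kernel_D a u v i m * (inverse (lin (a - u) (2 * real i + 1 + real m)) * inverse (lin (a - v) (2 * real i + 1 + real m)) *
    (inverse (lin a (2 * real i + 1)) * inverse (lin (a - 2 * u - 2 * v) (2 * real i + 1))) * fps_const (real m) *
    cert (lin a (2 * real i)) (X_part u) (X_part v) (fps_const (real m))))"

definition shift_ratio_D where "shift_ratio_D a u v i = lin a (2 * real i + 2) * lin (a - u - v) (2 * real i + 1) * lin (a - u - v) (2 * real i + 2) *
    lin (a - 2 * u) (2 * real i + 1) * lin (a - 2 * v) (2 * real i + 1) *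
    inverse (lin_prod (a - u) (2 * real i + 1) 1 2) * inverse (lin_prod (a - v) (2 * real i + 1) 1 2) *
    inverse (lin (a - 2 * u - 2 * v) (2 * real i + 1))"

lemma ring_shift_D_start:
  fixes A u v :: "'a::idom"
  shows "(A+1)*(A+1-2*u-2 * v)*((A+1-u)*(A+2-u))*((A+1-v)*(A+2-v))
      - (A+1)*(A+2)*(A+1-u-v)*(A+2-u-v)*(A+1-2*u)*(A+1-2 * v) = u * v * cert A u v 1"
  unfolding cert_def cert_3_def cert_2_def cert_1_def cert_0_def power_one mult_1_right by algebra

lemma ring_shift_D:
  fixes A u v m :: "'a::idom"
  shows "(A+1)*(A+1-2*u-2 * v)*(A+2*m)*((A+1+m-u)*(A+2+m-u))*((A+1+m-v)*(A+2+m-v))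
      - (A+2+2*m)*((A+m)*(A+m+1))*(A+1-u-v)*(A+2-u-v)*(A+1-2*u)*(A+1-2 * v)
    = (A+m)*(u+m)*(v+m)*cert A u v (m+1) - m*cert A u v m*(A+2+m-u)*(A+2+m-v)"
  unfolding cert_def cert_3_def cert_2_def cert_1_def cert_0_def by algebra

text \<open>Everything is expressed through \<open>A = 2 i + a X\<close>; the relation is then \<open>ring_shift_D\<close>, and for index \<open>0\<close> it is
\<open>ring_shift_D_start\<close>, the same identity divided by \<open>A\<close>.\<close>
lemma shift_step_D: "shift_term_D a u v i m - shift_ratio_D a u v i * shift_term_D a u v (Suc i) m = shift_mate_D a u v i (Suc m) - shift_mate_D a u v i m"
proof -
  define I where "I = real i"
  define r where "r = 2 * I + 1"
  have r: "r > 0" "2 * real i + 1 = r" "2 * real i + 2 = r + 1" "2 * real i = r - 1" "2 * real (Suc i) + 1 = r + 2"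
     "2 * real (Suc i) = r + 1"
    by (simp_all add: r_def I_def)
  define s where "s = a - 2 * u - 2 * v"
  define A where "A = lin a (r - 1)"
  define U where "U = X_part u"
  define V where "V = X_part v"
  have lA: "lin a x = A + fps_const (x - r + 1)" "lin (a - u) x = A + fps_const (x - r + 1) - U"
    "lin (a - v) x = A + fps_const (x - r + 1) - V" "lin (a - u - v) x = A + fps_const (x - r + 1) - U - V"
    "lin (a - 2 * u) x = A + fps_const (x - r + 1) - 2 * U" "lin (a - 2 * v) x = A + fps_const (x - r + 1) - 2 * V"
    "lin s x = A + fps_const (x - r + 1) - 2 * U - 2 * V" for x
    unfolding A_def U_def V_def s_def lin_X_part X_part_hom fps_const_hom by (simp_all add: algebra_simps)
  define Q where "Q = inverse (lin a r) * inverse (lin s r)"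
  have q: "Q * (lin a r * lin s r) = 1"
  proof -
    have "inverse (lin a r) * lin a r = 1" "inverse (lin s r) * lin s r = 1"
      using r(1) by (auto intro!: inverse_mult_eq_1 simp: lin_nth)
    moreover have "Q * (lin a r * lin s r) = (inverse (lin a r) * lin a r) * (inverse (lin s r) * lin s r)" by (simp only: Q_def mult_ac)
    ultimately show ?thesis by simp
  qed
  have qa: "inverse (lin s r) = Q * lin a r"
  proof -
    have "inverse (lin s r) = (inverse (lin a r) * lin a r) * inverse (lin s r)"
      using r(1) by (subst inverse_mult_eq_1) (auto simp: lin_nth)
    thus ?thesis unfolding Q_def by (simp only: mult_ac)
  qed
  have P2: "lin_prod c x 1 2 = lin c x * lin c (x + 1)" for c x
    by (simp add: eval_nat_numeral lin_prod_Suc)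
  show ?thesis
  proof (cases m)
    case 0
    define J where "J = inverse (lin_prod (a - u) r 1 2) * inverse (lin_prod (a - v) r 1 2) * Q"
    have e: "inverse (lin_prod (a - u) r 1 2) * lin_prod (a - u) r 1 2 = 1" "inverse (lin_prod (a - v) r 1 2) * lin_prod (a - v) r 1 2 = 1"
      using r(1) scal_prod_pos[of r 1 2] by (auto intro!: inverse_mult_eq_1 simp: lin_prod_nth_0)
    have 1: "1 = J * (lin a r * lin s r * lin_prod (a - u) r 1 2 * lin_prod (a - v) r 1 2)"
    proof -
      have "J * (lin a r * lin s r * lin_prod (a - u) r 1 2 * lin_prod (a - v) r 1 2)
        = (inverse (lin_prod (a - u) r 1 2) * lin_prod (a - u) r 1 2) * (inverse (lin_prod (a - v) r 1 2) * lin_prod (a - v) r 1 2) * (Q * (lin a r * lin s r))"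
        unfolding J_def by (simp only: mult_ac)
      thus ?thesis unfolding e q by simp
    qed
    have 2: "shift_ratio_D a u v i = J * (lin a r * lin a (r + 1) * lin (a - u - v) r * lin (a - u - v) (r + 1) * lin (a - 2 * u) r * lin (a - 2 * v) r)"
      unfolding shift_ratio_D_def r(2,3) s_def[symmetric] qa J_def by (simp only: mult_ac)
    have 3: "shift_mate_D a u v i (Suc 0) = J * (U * V * cert A U V 1)"
    proof -
      have "inverse (lin_prod (a - u) r 1 2) = inverse (lin_prod (a - u) r 1 1) * inverse (lin (a - u) (r + 1))"
        "inverse (lin_prod (a - v) r 1 2) = inverse (lin_prod (a - v) r 1 1) * inverse (lin (a - v) (r + 1))"
        unfolding P2 by (simp_all add: lin_prod_Suc fps_inverse_mult)
      thus ?thesis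
        unfolding shift_mate_D_def shift_kernel_D_def J_def U_def V_def A_def Q_def r(2) s_def[symmetric] unfolding r(4)
        by (simp add: lin_prod_Suc lin_X_part[of _ 0] mult_ac)
    qed
    have "lin a r * lin s r * lin_prod (a - u) r 1 2 * lin_prod (a - v) r 1 2
       - lin a r * lin a (r + 1) * lin (a - u - v) r * lin (a - u - v) (r + 1) * lin (a - 2 * u) r * lin (a - 2 * v) r = U * V * cert A U V 1"
      using ring_shift_D_start[of A U V] unfolding P2 lA by (simp add: numeral_fps_const)
    hence "J * (lin a r * lin s r * lin_prod (a - u) r 1 2 * lin_prod (a - v) r 1 2) - shift_ratio_D a u v i = shift_mate_D a u v i (Suc 0)"
      unfolding 2 3 by (simp only: right_diff_distrib[symmetric])
    thus ?thesis using 0 1 by (simp add: shift_term_D_def shift_mate_D_def[of _ _ _ _ 0])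
  next
    case (Suc k)
    define x where "x = real m"
    have x: "real (Suc m) = x + 1" "real k = x - 1" by (simp_all add: x_def Suc)
    have x0: "x \<ge> 0" by (simp add: x_def)
    have mk: "m - 1 = k" "Suc m - 1 = Suc k" "(m = 0) = False" "(Suc m = 0) = False" by (simp_all add: Suc)
    define W where "W = lin_prod u 0 1 m * lin_prod v 0 1 m * lin_prod a r 1 k *
       inverse (lin_prod (a - u) r 1 (Suc (Suc m))) * inverse (lin_prod (a - v) r 1 (Suc (Suc m))) * Q"
    define w where "w = (1 / fact m :: real)"
    have iv: "inverse (lin_prod c r 1 (Suc m)) = inverse (lin_prod c r 1 (Suc (Suc m))) * lin c (r + 1 + x)"
      "inverse (lin_prod c r 1 m) = inverse (lin_prod c r 1 (Suc (Suc m))) * lin c (r + 1 + x) * lin c (r + x)" for c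
      using inverse_lin_prod_Suc[of r 1 "Suc m" c] inverse_lin_prod_Suc[of r 1 m c] r(1) x0 by (simp_all add: x_def add_ac)
    have 1: "shift_term_D a u v i m = fps_const w * W * (lin a r * lin s r * lin a (r - 1 + 2 * x) *
        (lin (a - u) (r + x) * lin (a - u) (r + 1 + x)) * (lin (a - v) (r + x) * lin (a - v) (r + 1 + x)))"
    proof -
      have "shift_term_D a u v i m = shift_kernel_D a u v i m * lin a (r - 1 + 2 * x) * (Q * (lin a r * lin s r))" unfolding q shift_term_D_def mk by (simp add: r x_def)
      thus ?thesis unfolding shift_kernel_D_def r(2) mk W_def iv w_def[symmetric] by (simp only: mult_ac)
    qed
    have 2: "shift_ratio_D a u v i * shift_term_D a u v (Suc i) m = fps_const w * W * (lin a (r + 1 + 2 * x) * (lin a (r - 1 + x) * lin a (r + x)) *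
        lin (a - u - v) r * lin (a - u - v) (r + 1) * lin (a - 2 * u) r * lin (a - 2 * v) r)"
    proof -
      have d: "lin_prod a r 1 2 * lin_prod a (r + 2) 1 k = lin_prod a r 1 k * (lin a (r - 1 + x) * lin a (r + x))"
        using lin_prod_append[of a r 1 2 k] by (simp add: lin_prod_Suc x algebra_simps)
      have iw: "inverse (lin_prod c r 1 (Suc (Suc m))) = inverse (lin_prod c r 1 2) * inverse (lin_prod c (r + 2) 1 m)" for c
        using lin_prod_append[of c r 1 2 m] by (simp add: fps_inverse_mult)
      have "shift_term_D a u v (Suc i) m = shift_kernel_D a u v (Suc i) m * lin a (r + 1 + 2 * x)" unfolding shift_term_D_def mk by (simp add: r x_def add_ac)
      hence "shift_ratio_D a u v i * shift_term_D a u v (Suc i) m = fps_const w * (lin_prod u 0 1 m * lin_prod v 0 1 m * (lin_prod a r 1 2 * lin_prod a (r + 2) 1 k) *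
         inverse (lin_prod (a - u) r 1 (Suc (Suc m))) * inverse (lin_prod (a - v) r 1 (Suc (Suc m))) * Q) *
         (lin a (r + 1 + 2 * x) * lin (a - u - v) r * lin (a - u - v) (r + 1) * lin (a - 2 * u) r * lin (a - 2 * v) r)"
        unfolding shift_ratio_D_def shift_kernel_D_def r(2,3,5) mk iw s_def[symmetric] qa w_def[symmetric] P2[of a] by (simp only: mult_ac)
      thus ?thesis unfolding d W_def by (simp only: mult_ac)
    qed
    have 3: "shift_mate_D a u v i (Suc m) = fps_const w * W * (lin a (r - 1 + x) * (U + fps_const x) * (V + fps_const x) * cert A U V (fps_const (x + 1)))"
    proof -
      have c: "fps_const (1 / fact (Suc m)) * fps_const (x + 1) = fps_const w" by (simp add: w_def x_def divide_simps; simp add: algebra_simps)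
      have t: "lin_prod u 0 1 (Suc m) = lin_prod u 0 1 m * (U + fps_const x)" "lin_prod v 0 1 (Suc m) = lin_prod v 0 1 m * (V + fps_const x)"
        "lin_prod a r 1 (Suc k) = lin_prod a r 1 k * lin a (r - 1 + x)"
        by (simp_all add: lin_prod_Suc lin_X_part U_def V_def x_def Suc add_ac)
      have iw: "inverse (lin_prod c r 1 (Suc (Suc m))) = inverse (lin_prod c r 1 (Suc m)) * inverse (lin c (r + (x + 1)))" for c
        by (simp add: lin_prod_Suc[of _ _ _ "Suc m"] x_def fps_inverse_mult add_ac)
      have "shift_mate_D a u v i (Suc m) = (fps_const (1 / fact (Suc m)) * fps_const (x + 1)) * W * (lin a (r - 1 + x) * (U + fps_const x) * (V + fps_const x) * cert A U V (fps_const (x + 1)))"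
        unfolding shift_mate_D_def shift_kernel_D_def r(2) mk t if_False x s_def[symmetric] unfolding r(4) A_def[symmetric] U_def[symmetric] V_def[symmetric] W_def iw Q_def
        by (simp only: mult_ac)
      thus ?thesis unfolding c .
    qed
    have 4: "shift_mate_D a u v i m = fps_const w * W * (fps_const x * cert A U V (fps_const x) * lin (a - u) (r + 1 + x) * lin (a - v) (r + 1 + x))"
    proof -
      have iw: "inverse (lin_prod c r 1 m) * inverse (lin c (r + x)) = inverse (lin_prod c r 1 (Suc (Suc m))) * lin c (r + 1 + x)" for c
        unfolding iv(1)[symmetric] by (simp add: lin_prod_Suc x_def fps_inverse_mult)
      have "shift_mate_D a u v i m = fps_const w * (lin_prod u 0 1 m * lin_prod v 0 1 m * lin_prod a r 1 k *
         (inverse (lin_prod (a - u) r 1 m) * inverse (lin (a - u) (r + x))) * (inverse (lin_prod (a - v) r 1 m) * inverse (lin (a - v) (r + x))) * Q) *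
         (fps_const x * cert A U V (fps_const x))"
        unfolding shift_mate_D_def shift_kernel_D_def r(2) mk if_False x_def[symmetric] s_def[symmetric] unfolding r(4) A_def[symmetric] U_def[symmetric] V_def[symmetric] Q_def w_def
        by (simp only: mult_ac)
      thus ?thesis unfolding iw W_def by (simp only: mult_ac)
    qed
    define M where "M = fps_const x"
    have "lin a r * lin s r * lin a (r - 1 + 2 * x) *
        (lin (a - u) (r + x) * lin (a - u) (r + 1 + x)) * (lin (a - v) (r + x) * lin (a - v) (r + 1 + x))
      - lin a (r + 1 + 2 * x) * (lin a (r - 1 + x) * lin a (r + x)) *
        lin (a - u - v) r * lin (a - u - v) (r + 1) * lin (a - 2 * u) r * lin (a - 2 * v) r
      = lin a (r - 1 + x) * (U + fps_const x) * (V + fps_const x) * cert A U V (fps_const (x + 1))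
        - fps_const x * cert A U V (fps_const x) * lin (a - u) (r + 1 + x) * lin (a - v) (r + 1 + x)"
    proof -
      have n: "fps_const (r - r + 1) = (1 :: real fps)" "fps_const (r + x - r + 1) = 1 + M" "fps_const (r + 1 + x - r + 1) = 2 + M"
        "fps_const (r - 1 + 2 * x - r + 1) = 2 * M" "fps_const (r + 1 + 2 * x - r + 1) = 2 + 2 * M"
        "fps_const (r - 1 + x - r + 1) = M" "fps_const (r + 1 - r + 1) = (2 :: real fps)" "fps_const (x + 1) = M + 1"
        by (simp_all add: M_def numeral_fps_const)
      show ?thesis unfolding lA n M_def[symmetric] using ring_shift_D[of A U V M] by (simp only: add_ac diff_add_eq add_diff_eq)
    qed
    thus ?thesis unfolding 1 2 3 4 by (simp only: right_diff_distrib[symmetric])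
  qed
qed

lemma coeff_norm_shift_kernel_D:
  assumes c: "\<bar>a\<bar> \<le> 10" "\<bar>u\<bar> \<le> 10" "\<bar>v\<bar> \<le> 10" "\<bar>a - u\<bar> \<le> 10" "\<bar>a - v\<bar> \<le> 10" and m: "1 \<le> m"
  shows "coeff_norm (shift_kernel_D a u v i m) \<le> growth_bound m / ((real m)\<^sup>2 * (2 * real i + 1) * (2 * real i + real m))"
proof -
  obtain k where mk: "m = Suc k" using m by (cases m) auto
  define r where "r = 2 * real i + 1"
  have r: "r \<ge> 1" "2 * real i + 1 = r" by (simp_all add: r_def)
  define x :: real where "x = 1 / fact m"
  have A: "scal_prod r 1 m > 0" "scal_prod r 1 k > 0" using r by (auto intro!: scal_prod_pos)
  have x: "coeff_norm (fps_const x) \<le> x" by (simp add: x_def)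
  have z: "lin_prod u 0 1 m = X_part u * lin_prod u 1 1 k" "lin_prod v 0 1 m = X_part v * lin_prod v 1 1 k" "m - 1 = k"
    by (simp_all add: mk lin_prod_0_start)
  define E where "E = growth m"
  have E0: "E \<ge> 0" by (simp add: E_def)
  define s where "s = x * (scal_prod 1 1 k * scal_prod 1 1 k * scal_prod r 1 k * inverse (scal_prod r 1 m) * inverse (scal_prod r 1 m))"
  have cc: "coeff_norm (X_part u) \<le> 1" "coeff_norm (X_part v) \<le> 1" using c by (auto simp: coeff_norm_X_part)
  have "coeff_norm (shift_kernel_D a u v i m) \<le> x * (1 * (scal_prod 1 1 k * E) * (1 * (scal_prod 1 1 k * E)) * (scal_prod r 1 k * E) *
     (inverse (scal_prod r 1 m) * E\<^sup>2) * (inverse (scal_prod r 1 m) * E\<^sup>2))"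
    unfolding shift_kernel_D_def r(2) x_def[symmetric] E_def z
    by (intro coeff_norm_multI coeff_norm_lin_prod_le coeff_norm_inverse_lin_prod_le x cc) (use c r(1) mk in auto)
  also have "\<dots> = s * E ^ 7" unfolding s_def by (simp add: power2_eq_square power_numeral_reduce)
  finally have 1: "coeff_norm (shift_kernel_D a u v i m) \<le> s * E ^ 7" .
  have rk: "r + real k = 2 * real i + real m" by (simp add: r_def mk)
  have rk0: "r + real k > 0" using r by simp
  have "s \<le> 1 / ((real m)\<^sup>2 * r * (r + real k))"
  proof -
    have am: "scal_prod r 1 m = scal_prod r 1 k * (r + real k)" by (simp add: mk scal_prod_Suc)
    have fm: "fact m = real m * fact k" by (simp add: mk)
    have m0: "real m > 0" by (simp add: mk)
    have "r * fact m \<le> scal_prod r 1 m" unfolding mk by (rule scal_prod_ge_fact_Suc) (use r in auto)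
    hence q: "inverse (scal_prod r 1 m) \<le> inverse (r * fact m)"
      using r A by (intro le_imp_inverse_le) auto
    have "s = (fact k * fact k) / (fact m * (r + real k)) * inverse (scal_prod r 1 m)"
      unfolding s_def x_def scal_prod_1_1 am using A rk0 by (simp add: divide_simps)
    also have "\<dots> \<le> (fact k * fact k) / (fact m * (r + real k)) * inverse (r * fact m)"
      using rk0 by (intro mult_left_mono q) auto
    also have "\<dots> = 1 / ((real m)\<^sup>2 * r * (r + real k))"
      unfolding fm using r rk0 m0 by (simp add: divide_simps power2_eq_square)
    finally show ?thesis .
  qed
  hence "s * E ^ 7 \<le> 1 / ((real m)\<^sup>2 * r * (r + real k)) * growth_bound m"
    using growth_pow_le[of 7 m] E0 r unfolding E_def by (intro mult_mono) auto
  with 1 show ?thesis unfolding rk r(2) by simp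
qed

lemma coeff_norm_cert: 
  assumes "m \<ge> 1"
  shows "coeff_norm (cert A U V (fps_const (real m))) \<le> (coeff_norm (cert_3 A U V) + coeff_norm (cert_2 A U V) + coeff_norm (cert_1 A U V) + coeff_norm (cert_0 A U V)) * real m ^ 3"
proof -
  have p: "real m ^ 2 \<le> real m ^ 3" "real m \<le> real m ^ 3" "1 \<le> real m ^ 3"
    using assms power_increasing[of 2 3 "real m"] power_increasing[of 1 3 "real m"] by (auto simp: one_le_power)
  have "coeff_norm (cert A U V (fps_const (real m))) \<le> coeff_norm (cert_3 A U V) * real m ^ 3 + coeff_norm (cert_2 A U V) * real m ^ 3 + coeff_norm (cert_1 A U V) * real m ^ 3 + coeff_norm (cert_0 A U V) * 1"
    unfolding cert_def using p
    by (intro order_trans[OF coeff_norm_add] add_mono coeff_norm_multI) (simp_all add: fps_const_power)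
  also have "\<dots> \<le> coeff_norm (cert_3 A U V) * real m ^ 3 + coeff_norm (cert_2 A U V) * real m ^ 3 + coeff_norm (cert_1 A U V) * real m ^ 3 + coeff_norm (cert_0 A U V) * real m ^ 3"
    using p by (intro add_mono order_refl mult_left_mono) auto
  finally show ?thesis by (simp add: algebra_simps)
qed

lemma row_sum_D:
  assumes c: "\<bar>a\<bar> \<le> 10" "\<bar>u\<bar> \<le> 10" "\<bar>v\<bar> \<le> 10" "\<bar>a - u\<bar> \<le> 10" "\<bar>a - v\<bar> \<le> 10" and nz: "u \<noteq> 0" "v \<noteq> 0"
    and Ev: "\<And>r. r \<in> {2..5} \<Longrightarrow> (\<lambda>i. (1 / (2 * real i + 2)) ^ r) sums Ev r"
    and Od: "\<And>r. r \<in> {2..5} \<Longrightarrow> (\<lambda>i. (1 / (2 * real i + 1)) ^ r) sums Od r"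
  defines "H \<equiv> \<lambda>r. (a ^ r + (a - u - v) ^ r - (a - u) ^ r - (a - v) ^ r) * Ev r
     + ((a - u - v) ^ r + (a - 2 * u) ^ r + (a - 2 * v) ^ r - (a - u) ^ r - (a - v) ^ r - (a - 2 * u - 2 * v) ^ r) * Od r"
  shows "(\<Sum>m. fps_nth (F_D a u v 0 (Suc m)) 3) = (H 5 / 5 - H 2 * H 3 / 6) / (u * v)"
proof -
  define h where "h i s = (a ^ s + (a - u - v) ^ s - (a - u) ^ s - (a - v) ^ s) * (1 / (2 * real i + 2)) ^ s
     + ((a - u - v) ^ s + (a - 2 * u) ^ s + (a - 2 * v) ^ s - (a - u) ^ s - (a - v) ^ s - (a - 2 * u - 2 * v) ^ s) * (1 / (2 * real i + 1)) ^ s" for i s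
  have "(\<lambda>m. fps_nth (shift_term_D a u v 0 (Suc m)) 5) sums (H 5 / 5 - H 2 * H 3 / 6)"
  proof (rule coeff_5_of_shift_invariant_sum[where \<rho> = "shift_ratio_D a u v" and Y = "shift_mate_D a u v" and B = "\<lambda>m. 3 * (growth_bound m / (real m)\<^sup>2)" and h = h])
    fix i m :: nat assume m: "1 \<le> m"
    have l: "coeff_norm (lin a (2 * real i + 2 * real m)) \<le> 3 * (2 * real i + real m)" using m c by (simp add: coeff_norm_lin)
    have "shift_term_D a u v i m = shift_kernel_D a u v i m * lin a (2 * real i + 2 * real m)" using m by (simp add: shift_term_D_def)
    also have "coeff_norm \<dots> \<le> growth_bound m / ((real m)\<^sup>2 * (2 * real i + 1) * (2 * real i + real m)) * (3 * (2 * real i + real m))"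
      by (intro coeff_norm_multI coeff_norm_shift_kernel_D c l m)
    also have "\<dots> = 3 * (growth_bound m / (real m)\<^sup>2) / (2 * real i + 1)" using m by (simp add: divide_simps)
    finally show "coeff_norm (shift_term_D a u v i m) \<le> 3 * (growth_bound m / (real m)\<^sup>2) / real (2 * i + 1)" by (simp add: add_ac)
  next
    fix i
    define c0 where "c0 = coeff_norm (inverse (lin a (2 * real i + 1)) * inverse (lin (a - 2 * u - 2 * v) (2 * real i + 1)))"
    define A where "A = lin a (2 * real i)"
    define c1 where "c1 = coeff_norm (cert_3 A (X_part u) (X_part v)) + coeff_norm (cert_2 A (X_part u) (X_part v)) + coeff_norm (cert_1 A (X_part u) (X_part v)) + coeff_norm (cert_0 A (X_part u) (X_part v))"
    have c01: "c0 \<ge> 0" "c1 \<ge> 0" unfolding c0_def c1_def by (auto intro!: add_nonneg_nonneg)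
    show "(\<lambda>m. coeff_norm (shift_mate_D a u v i m)) \<longlonglongrightarrow> 0"
    proof (rule Lim_null_comparison)
      show "(\<lambda>m. c0 * c1 * (growth_bound m / real m)) \<longlonglongrightarrow> 0"
        by (intro tendsto_mult_right_zero growth_bound_over_lim)
      show "\<forall>\<^sub>F m in sequentially. norm (coeff_norm (shift_mate_D a u v i m)) \<le> c0 * c1 * (growth_bound m / real m)"
      proof (rule eventually_sequentiallyI[of 1])
        fix m :: nat assume m: "1 \<le> m"
        have l: "coeff_norm (inverse (lin y (2 * real i + 1 + real m))) \<le> 1 / real m" if "\<bar>y\<bar> \<le> 10" for y
        proof -
          have "coeff_norm (inverse (lin y (2 * real i + 1 + real m))) \<le> 1 / (2 * real i + 1 + real m - \<bar>y\<bar> / 1000)"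
            using that by (intro coeff_norm_inverse_lin) simp
          also have "\<dots> \<le> 1 / real m" using that m by (intro frac_le) auto
          finally show ?thesis .
        qed
        have mm: "coeff_norm (fps_const (real m)) \<le> real m" by simp
        have R: "growth_bound m / ((real m)\<^sup>2 * (2 * real i + 1) * (2 * real i + real m)) \<le> growth_bound m / ((real m)\<^sup>2 * 1 * real m)"
          using m growth_bound_pos[of m] by (intro divide_left_mono mult_mono) (auto intro!: mult_pos_pos add_nonneg_pos)
        have "coeff_norm (shift_mate_D a u v i m) = coeff_norm (shift_kernel_D a u v i m * (inverse (lin (a - u) (2 * real i + 1 + real m)) * inverse (lin (a - v) (2 * real i + 1 + real m)) *
            (inverse (lin a (2 * real i + 1)) * inverse (lin (a - 2 * u - 2 * v) (2 * real i + 1))) * fps_const (real m) *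
             cert A (X_part u) (X_part v) (fps_const (real m))))"
          using m by (simp add: shift_mate_D_def A_def)
        also have "\<dots> \<le> growth_bound m / ((real m)\<^sup>2 * 1 * real m) * (1 / real m * (1 / real m) * c0 * real m * (c1 * real m ^ 3))"
          unfolding c0_def c1_def by (intro coeff_norm_multI order_trans[OF coeff_norm_shift_kernel_D R] c l mm coeff_norm_cert m order_refl)
        also have "\<dots> = c0 * c1 * (growth_bound m / real m)" using m by (simp add: power3_eq_cube power2_eq_square)
        finally show "norm (coeff_norm (shift_mate_D a u v i m)) \<le> c0 * c1 * (growth_bound m / real m)" by simp
      qed
    qed
  next
    show "summable (\<lambda>m. 3 * (growth_bound m / (real m)\<^sup>2))" by (intro summable_mult summable_growth_bound)
  next
    fix i
    define r where "r = 2 * real i + 1"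
    have r: "r > 0" "2 * real i + 2 = r + 1" "2 * real i + 1 = r" by (simp_all add: r_def)
    have "power_sums (shift_ratio_D a u v i) (\<lambda>s. (a / (r + 1)) ^ s + ((a - u - v) / r) ^ s + ((a - u - v) / (r + 1)) ^ s + ((a - 2 * u) / r) ^ s + ((a - 2 * v) / r) ^ s
       + - (\<Sum>j<2. ((a - u) / (r + 1 * real j)) ^ s) + - (\<Sum>j<2. ((a - v) / (r + 1 * real j)) ^ s) + - (((a - 2 * u - 2 * v) / r) ^ s))"
      unfolding shift_ratio_D_def r(2,3) using r(1)
      by (intro power_sums_mult power_sums_inverse_lin_prod power_sums_lin power_sums_inverse) (auto simp: lin_nth)
    also have "(\<lambda>s. (a / (r + 1)) ^ s + ((a - u - v) / r) ^ s + ((a - u - v) / (r + 1)) ^ s + ((a - 2 * u) / r) ^ s + ((a - 2 * v) / r) ^ s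
       + - (\<Sum>j<2. ((a - u) / (r + 1 * real j)) ^ s) + - (\<Sum>j<2. ((a - v) / (r + 1 * real j)) ^ s) + - (((a - 2 * u - 2 * v) / r) ^ s)) = h i"
      unfolding h_def r(2,3) by (rule ext, simp only: two_terms power_divide)
        (simp add: algebra_simps add_divide_distrib diff_divide_distrib)
    finally show "power_sums (shift_ratio_D a u v i) (h i)" .
    show "fps_nth (shift_ratio_D a u v i) 0 = 1" unfolding shift_ratio_D_def r(2,3)
      using r(1) by (simp add: lin_prod_nth_0 lin_nth eval_nat_numeral scal_prod_Suc divide_simps)
    show "h i 1 = 0" by (simp add: h_def add_divide_distrib diff_divide_distrib)
  next
    fix s :: nat assume s: "s \<in> {2..5}"
    show "(\<lambda>i. h i s) sums H s" unfolding h_def H_def by (intro sums_add sums_mult Ev Od s)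
  qed (simp add: shift_term_D_def, rule shift_step_D, simp add: shift_mate_D_def)
  moreover have "fps_nth (shift_term_D a u v 0 (Suc m)) 5 = u * v * fps_nth (F_D a u v 0 (Suc m)) 3" for m
  proof -
    have "shift_term_D a u v 0 (Suc m) = X_part u * X_part v * F_D a u v 0 (Suc m)"
      unfolding shift_term_D_def shift_kernel_D_def F_D_def kernel_D_def lin_prod_0_start of_nat_0 mult_zero_right add_0 diff_Suc_1 diff_0 minus_nat.diff_0 lin_prod_0
        power_0 add_0_right fps_inverse_one
      by (simp only: nat.simps if_False mult_ac mult_1 mult_1_right)
    thus ?thesis by (simp add: nth_5_X_part_mult)
  qed
  ultimately have "(\<lambda>m. u * v * fps_nth (F_D a u v 0 (Suc m)) 3) sums (H 5 / 5 - H 2 * H 3 / 6)" by simp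
  from sums_mult[OF this, of "1 / (u * v)"] show ?thesis using nz by (simp add: sums_iff)
qed

section \<open>Zeta values, and series of odd and even reciprocals\<close>

definition zeta_nat :: "nat \<Rightarrow> real" where "zeta_nat r = (\<Sum>n. (1 / real (Suc n)) ^ r)"

lemma zeta_nat_sums: "r \<ge> 2 \<Longrightarrow> (\<lambda>n. (1 / real (Suc n)) ^ r) sums zeta_nat r"
proof -
  assume "r \<ge> 2"
  hence "summable (\<lambda>n. inverse (real n ^ r))" by (rule inverse_power_summable)
  hence "summable (\<lambda>n. inverse (real (Suc n) ^ r))" by (subst summable_Suc_iff)
  hence "summable (\<lambda>n. (1 / real (Suc n)) ^ r)" by (simp add: power_divide inverse_eq_divide)
  thus ?thesis unfolding zeta_nat_def by (rule summable_sums)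
qed

lemma even_sums: "r \<ge> 2 \<Longrightarrow> (\<lambda>i. (1 / (2 * real i + 2)) ^ r) sums ((1/2) ^ r * zeta_nat r)"
proof -
  assume r: "r \<ge> 2"
  have "(1 / (2 * real i + 2)) ^ r = (1/2) ^ r * (1 / real (Suc i)) ^ r" for i
    unfolding power_mult_distrib[symmetric] by (simp add: field_simps)
  thus ?thesis using sums_mult[OF zeta_nat_sums[OF r]] by simp
qed

lemma odd_sums: "r \<ge> 2 \<Longrightarrow> (\<lambda>i. (1 / (2 * real i + 1)) ^ r) sums ((1 - (1/2) ^ r) * zeta_nat r)"
proof -
  assume r: "r \<ge> 2"
  have "(\<lambda>n. \<Sum>i\<in>{n * 2..<n * 2 + 2}. (1 / real (Suc i)) ^ r) sums zeta_nat r"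
    by (rule sums_group[OF zeta_nat_sums[OF r]]) simp
  moreover have "(\<Sum>i\<in>{n * 2..<n * 2 + 2}. (1 / real (Suc i)) ^ r) = (1 / (2 * real n + 1)) ^ r + (1 / (2 * real n + 2)) ^ r" for n
  proof -
    have "{n * 2..<n * 2 + 2} = {2 * n, 2 * n + 1}" by auto
    thus ?thesis by (simp add: add_ac)
  qed
  ultimately have "(\<lambda>n. (1 / (2 * real n + 1)) ^ r + (1 / (2 * real n + 2)) ^ r) sums zeta_nat r" by simp
  from sums_diff[OF this even_sums[OF r]] show ?thesis by (simp add: algebra_simps)
qed

lemma has_sum_from_1:
  fixes f :: "nat \<Rightarrow> real"
  assumes "(\<lambda>n. f (Suc n)) sums s" "summable (\<lambda>n. \<bar>f (Suc n)\<bar>)"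
  shows "(f has_sum s) {1..}"
proof -
  have "((\<lambda>n. f (Suc n)) has_sum s) UNIV"
    using assms by (intro norm_summable_imp_has_sum) auto
  hence "(f has_sum s) (Suc ` UNIV)" by (subst has_sum_reindex) (auto simp: o_def)
  moreover have "Suc ` UNIV = {1..}" by (auto simp: image_iff Suc_le_eq gr0_conv_Suc)
  ultimately show ?thesis by simp
qed

lemma zeta_eq_zeta_nat:
  assumes "r \<ge> 2"
  shows "zeta (real r) = zeta_nat r"
proof -
  have e: "real (Suc n) powr (- real r) = (1 / real (Suc n)) ^ r" for n
    by (simp add: powr_minus powr_realpow power_divide inverse_eq_divide)
  have "((\<lambda>m. real m powr (- real r)) has_sum zeta_nat r) {1..}"
    using zeta_nat_sums[OF assms] unfolding e[symmetric] by (intro has_sum_from_1) (auto simp: sums_iff)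
  thus ?thesis unfolding zeta_def by (rule infsumI)
qed

lemma zeta_nat_2: "zeta_nat 2 = pi\<^sup>2 / 6"
proof -
  have "(\<lambda>n. (1 / real (Suc n))\<^sup>2) sums (pi\<^sup>2 / 6)"
    using inverse_squares_sums by (simp add: power_divide add_ac)
  from sums_unique2[OF zeta_nat_sums this] show ?thesis by simp
qed

lemma fact_pochhammer: "27 ^ n * fact n * (pochhammer (1/3) n * pochhammer (2/3) n) = (fact (3 * n) :: real)"
proof (induction n)
  case (Suc n)
  have "27 ^ Suc n * fact (Suc n) * (pochhammer (1/3) (Suc n) * pochhammer (2/3) (Suc n))
     = 27 * (real n + 1) * (1/3 + real n) * (2/3 + real n) * (27 ^ n * fact n * (pochhammer (1/3) n * pochhammer (2/3) n :: real))"
    by (simp add: pochhammer_Suc algebra_simps)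
  also have "\<dots> = 27 * (real n + 1) * (1/3 + real n) * (2/3 + real n) * fact (3 * n)" unfolding Suc.IH ..
  also have "\<dots> = fact (3 * Suc n)"
  proof -
    have "3 * Suc n = Suc (Suc (Suc (3 * n)))" by simp
    thus ?thesis by (simp only: fact_Suc) (simp add: algebra_simps)
  qed
  finally show ?case .
qed simp

section \<open>The edge terms in terms of harmonic sums\<close>

definition harm_sum :: "nat \<Rightarrow> nat \<Rightarrow> real" where "harm_sum n s = (\<Sum>j<n. (1 / (1 + real j)) ^ s)"
definition odd_harm_sum :: "nat \<Rightarrow> nat \<Rightarrow> real" where "odd_harm_sum n s = (\<Sum>j<n. (1 / (1 + 2 * real j)) ^ s)"

lemma sum_1_1: "(\<Sum>j<n. (c / (1 + 1 * real j)) ^ s) = c ^ s * harm_sum n s"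
  by (simp add: harm_sum_def sum_distrib_left power_divide)
lemma sum_1_2: "(\<Sum>j<n. (c / (1 + 2 * real j)) ^ s) = c ^ s * odd_harm_sum n s"
  by (simp add: odd_harm_sum_def sum_distrib_left power_divide)
lemma sum_2_2: "(\<Sum>j<n. (c / (2 + 2 * real j)) ^ s) = (c / 2) ^ s * harm_sum n s"
proof -
  have "c / (2 + 2 * real j) = (c / 2) / (1 + 1 * real j)" for j by (simp add: field_simps)
  thus ?thesis by (simp only: sum_1_1)
qed
lemma sum_1_1_double: "(\<Sum>j<2 * n. (c / (1 + 1 * real j)) ^ s) = c ^ s * ((1/2) ^ s * harm_sum n s + odd_harm_sum n s)"
proof (induction n)
  case (Suc n)
  have "(1 / (2 * (1 + real n))) ^ s = (1/2) ^ s * (1 / (1 + real n)) ^ s"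
    unfolding power_mult_distrib[symmetric] by simp
  with Suc show ?case by (simp add: harm_sum_def odd_harm_sum_def algebra_simps power_divide)
qed (simp add: harm_sum_def odd_harm_sum_def)

text \<open>The coefficient of \<open>X^3\<close> in \<open>f B\<close>, relative to the constant term of \<open>f\<close>, when \<open>h\<close> are the power sums of \<open>f\<close>.\<close>
definition cubic :: "(nat \<Rightarrow> real) \<Rightarrow> real \<Rightarrow> real \<Rightarrow> real \<Rightarrow> real \<Rightarrow> real" where
  "cubic h B0 B1 B2 B3 = ((h 1) ^ 3 - 3 * h 1 * h 2 + 2 * h 3) / 6 * B0 + ((h 1)\<^sup>2 - h 2) / 2 * B1 + h 1 * B2 + B3"

lemma nth_3_mult_power_sums:
  assumes "power_sums f h"
  shows "fps_nth (f * B) 3 = fps_nth f 0 * cubic h (fps_nth B 0) (fps_nth B 1) (fps_nth B 2) (fps_nth B 3)"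
proof -
  have "fps_nth (f * B) 3 = fps_nth f 0 * fps_nth B 3 + fps_nth f 1 * fps_nth B 2 + fps_nth f 2 * fps_nth B 1 + fps_nth f 3 * fps_nth B 0"
    by (simp add: fps_mult_nth eval_nat_numeral)
  thus ?thesis unfolding power_sums_coeffs(1-3)[OF assms] cubic_def by (simp add: algebra_simps add_divide_distrib diff_divide_distrib)
qed

lemma lin_mult_nth: "fps_nth (lin c x * f) 0 = x * fps_nth f 0" "fps_nth (lin c x * f) (Suc k) = x * fps_nth f (Suc k) + c * fps_nth f k"
  by (simp_all add: lin_def algebra_simps mult.assoc)

text \<open>The power sums of the product of linear factors in the edge term.  The coefficient of the first harmonic sum
vanishes for exponent \<open>1\<close>, so that the harmonic numbers themselves never occur.\<close>
definition edge_sum_Q :: "real \<Rightarrow> real \<Rightarrow> nat \<Rightarrow> nat \<Rightarrow> real" where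
  "edge_sum_Q d b n s = (d ^ s + b ^ s + (-b) ^ s + (1/2) ^ s * ((-b) ^ s + (-d) ^ s - (d - b) ^ s)) * harm_sum n s + (b ^ s - (d + b) ^ s) * odd_harm_sum n s
     + ((-b / real (Suc n)) ^ s - ((d - b) / (2 * real (Suc n))) ^ s - ((d + b) / (2 * real (Suc n) - 1)) ^ s)"

text \<open>The hypergeometric factor that both families have in common on their edges, and the reason why they can be
combined.\<close>
definition edge_coeff :: "nat \<Rightarrow> real" where "edge_coeff n = (-1) ^ n * fact n ^ 3 / fact (3 * Suc n)"

lemma fact_3_Suc: "(fact (3 * Suc n) :: real) = 3 * real (Suc n) * (3 * real (Suc n) - 1) * fact (3 * n + 1)"
proof -
  have "3 * Suc n = Suc (Suc (3 * n + 1))" by simp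
  thus ?thesis by (simp only: fact_Suc) (simp add: algebra_simps)
qed

lemma edge_term_Q:
  fixes n :: nat
  defines "x \<equiv> real (Suc n)"
  shows "fps_nth (F_Q d b n (Suc n) + G_Q d b n (Suc n)) 3 = edge_coeff n * (1 / (2 * x * (2 * x - 1)) *
    cubic (edge_sum_Q d b n) (3 * x * (3 * x - 1) * (3 * x) + x * x * (x + 1)) (3 * x * (3 * x - 1) * d + (x * (x + 1) * (d + b) - x * x * b))
      (d * b * (x + 1) - b * (d + b) * x) (- (d * b * b)))"
proof -
  define B where "B = fps_const (3 * x * (3 * x - 1)) * lin d (3 * x) + lin d x * (lin b x * lin (-b) (x + 1))"
  have x: "x \<ge> 1" by (simp add: x_def)
  have nx: "real n = x - 1" by (simp add: x_def)
  have e: "Suc n - 1 = n" "n - n = 0" "Suc n - n - 1 = 0" by simp_all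
  have P: "F_Q d b n (Suc n) + G_Q d b n (Suc n) = (fps_const (1 / (3 * x * (3 * x - 1))) * kernel_Q d b n (Suc n)) * B"
  proof -
    have c: "(x + 2 * real n + 1) * (x + 2 * real n + 2) = 3 * x * (3 * x - 1)"
      unfolding nx by (simp add: algebra_simps)
    have "fps_const (1 / (3 * x * (3 * x - 1))) * fps_const (3 * x * (3 * x - 1)) = 1" using x by simp
    hence "F_Q d b n (Suc n) = kernel_Q d b n (Suc n) * lin d (3 * x) * (fps_const (1 / (3 * x * (3 * x - 1))) * fps_const (3 * x * (3 * x - 1)))"
      by (simp only: F_Q_def x_def mult_1_right)
    thus ?thesis unfolding G_Q_def B_def x_def[symmetric] c by (simp only: ring_distribs mult_ac)
  qed
  have lgP: "power_sums (fps_const (1 / (3 * x * (3 * x - 1))) * kernel_Q d b n (Suc n)) (edge_sum_Q d b n)"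
  proof -
    have "power_sums (fps_const (1 / (3 * x * (3 * x - 1))) * kernel_Q d b n (Suc n)) (\<lambda>s. 0 + (0 + ((\<Sum>j<n. (d / (1 + 1 * real j)) ^ s)
       + (\<Sum>j<n. (b / (1 + 1 * real j)) ^ s) + (\<Sum>j<Suc n. (-b / (1 + 1 * real j)) ^ s) + (\<Sum>j<0. (d / (2 + 2 * real j)) ^ s)
       + (\<Sum>j<n. (-b / (2 + 2 * real j)) ^ s) + (\<Sum>j<n. (b / (1 + 2 * real j)) ^ s) + (\<Sum>j<n. (-d / (2 + 2 * real j)) ^ s)
       + - (\<Sum>j<Suc n. ((d - b) / (2 + 2 * real j)) ^ s) + - (\<Sum>j<Suc n. ((d + b) / (1 + 2 * real j)) ^ s))))"
      unfolding kernel_Q_def e by (intro power_sums_mult power_sums_const power_sums_lin_prod power_sums_inverse_lin_prod) simp_all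
    also have "(\<lambda>s. 0 + (0 + ((\<Sum>j<n. (d / (1 + 1 * real j)) ^ s)
       + (\<Sum>j<n. (b / (1 + 1 * real j)) ^ s) + (\<Sum>j<Suc n. (-b / (1 + 1 * real j)) ^ s) + (\<Sum>j<0. (d / (2 + 2 * real j)) ^ s)
       + (\<Sum>j<n. (-b / (2 + 2 * real j)) ^ s) + (\<Sum>j<n. (b / (1 + 2 * real j)) ^ s) + (\<Sum>j<n. (-d / (2 + 2 * real j)) ^ s)
       + - (\<Sum>j<Suc n. ((d - b) / (2 + 2 * real j)) ^ s) + - (\<Sum>j<Suc n. ((d + b) / (1 + 2 * real j)) ^ s)))) = edge_sum_Q d b n"
    proof (rule ext)
      fix s
      have h: "(c / 2) ^ s = (1/2) ^ s * c ^ s" for c :: real by (simp add: power_divide)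
      have y: "1 + 1 * real n = real (Suc n)" "2 + 2 * real n = 2 * real (Suc n)" "1 + 2 * real n = 2 * real (Suc n) - 1" by simp_all
      show "0 + (0 + ((\<Sum>j<n. (d / (1 + 1 * real j)) ^ s)
       + (\<Sum>j<n. (b / (1 + 1 * real j)) ^ s) + (\<Sum>j<Suc n. (-b / (1 + 1 * real j)) ^ s) + (\<Sum>j<0. (d / (2 + 2 * real j)) ^ s)
       + (\<Sum>j<n. (-b / (2 + 2 * real j)) ^ s) + (\<Sum>j<n. (b / (1 + 2 * real j)) ^ s) + (\<Sum>j<n. (-d / (2 + 2 * real j)) ^ s)
       + - (\<Sum>j<Suc n. ((d - b) / (2 + 2 * real j)) ^ s) + - (\<Sum>j<Suc n. ((d + b) / (1 + 2 * real j)) ^ s))) = edge_sum_Q d b n s"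
        unfolding sum.lessThan_Suc lessThan_0 sum.empty unfolding sum_1_1 sum_1_2 sum_2_2 h[of "- b"] h[of "- d"] h[of "d - b"] edge_sum_Q_def y by (simp only: ring_distribs; simp)
    qed
    finally show ?thesis .
  qed
  have P0: "fps_nth (fps_const (1 / (3 * x * (3 * x - 1))) * kernel_Q d b n (Suc n)) 0 = edge_coeff n * (1 / (2 * x * (2 * x - 1)))"
  proof -
    have a: "scal_prod 1 2 n > 0" by (simp add: scal_prod_pos)
    have s: "scal_prod 1 2 (Suc n) = scal_prod 1 2 n * (2 * x - 1)" "(fact (Suc n) :: real) = x * fact n" "Suc n + 2 * n = 3 * n + 1"
      by (simp_all add: scal_prod_Suc x_def)
    have "fps_nth (kernel_Q d b n (Suc n)) 0 = (-1) ^ n / (2 ^ n * fact (Suc n) * fact (Suc n + 2 * n)) * (fact n * fact n * fact (Suc n) * 1 * (2 ^ n * fact n) *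
        scal_prod 1 2 n * (2 ^ n * fact n) * inverse (2 ^ Suc n * fact (Suc n)) * inverse (scal_prod 1 2 (Suc n)))"
      unfolding kernel_Q_def by (simp add: lin_prod_nth_0 scal_prod_1_1 scal_prod_2_2 del: power_Suc fact_Suc)
    also have "\<dots> = (-1) ^ n * fact n ^ 3 / (fact (3 * n + 1) * 2 * x * (2 * x - 1))"
      unfolding s power_Suc using a x by (simp add: divide_simps power3_eq_cube)
    finally show ?thesis unfolding edge_coeff_def fact_3_Suc x_def[symmetric] by simp
  qed
  have "fps_nth B 0 = 3 * x * (3 * x - 1) * (3 * x) + x * x * (x + 1)"
    "fps_nth B 1 = 3 * x * (3 * x - 1) * d + (x * (x + 1) * (d + b) - x * x * b)"
    "fps_nth B 2 = d * b * (x + 1) - b * (d + b) * x" "fps_nth B 3 = - (d * b * b)"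
    unfolding B_def by (simp_all add: lin_mult_nth lin_nth eval_nat_numeral algebra_simps)
  thus ?thesis unfolding P nth_3_mult_power_sums[OF lgP] P0 by (simp only: mult.assoc)
qed

definition edge_sum_D :: "real \<Rightarrow> real \<Rightarrow> real \<Rightarrow> nat \<Rightarrow> nat \<Rightarrow> real" where
  "edge_sum_D a u v n s = (a ^ s + (-u) ^ s + (-v) ^ s + (1/2) ^ s * (u ^ s + v ^ s - (a - u) ^ s - (a - v) ^ s)) * harm_sum n s
     + ((-a) ^ s - (a - 2 * u - 2 * v) ^ s + u ^ s + v ^ s - (a - u) ^ s - (a - v) ^ s) * odd_harm_sum n s
     - ((1 / (2 * real (Suc n) - 1)) ^ s + (1 / (2 * real (Suc n))) ^ s) * ((a - u) ^ s + (a - v) ^ s)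
     - ((a - 2 * u - 2 * v) / (2 * real (Suc n) - 1)) ^ s"

text \<open>What remains of the three terms next to the edge after their common product has been removed.\<close>
definition edge_factor_D :: "real \<Rightarrow> real \<Rightarrow> real \<Rightarrow> real \<Rightarrow> real fps" where
  "edge_factor_D a u v x = fps_const (3 * x * (3 * x - 1)) * (lin a (4 * x - 2) * (lin (a - u) (2 * x) * (lin (a - v) (2 * x) * lin (a - 2 * u - 2 * v) (2 * x - 1))))
    + fps_const (3 * x) * (lin a (4 * x - 1) * (lin u (2 * x - 1) * (lin v (2 * x - 1) * (lin (a - u) (2 * x) * lin (a - v) (2 * x)))))
    - lin a (4 * x) * (lin u (2 * x - 1) * (lin v (2 * x - 1) * (lin (-u) x * (lin (-v) x * lin (-a) (2 * x - 1)))))"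

lemma edge_term_D:
  fixes n :: nat
  defines "x \<equiv> real (Suc n)"
  shows "fps_nth (F_D a u v n (2 * n + 1) + G_D a u v n (2 * n + 1) + F_D a u v (Suc n) (2 * n + 2)) 3
    = edge_coeff n * (1 / (4 * x\<^sup>2 * (2 * x - 1) ^ 3) * cubic (edge_sum_D a u v n) (fps_nth (edge_factor_D a u v x) 0) (fps_nth (edge_factor_D a u v x) 1)
        (fps_nth (edge_factor_D a u v x) 2) (fps_nth (edge_factor_D a u v x) 3))"
proof -
  define c where "c = (-1) ^ n / (fact (3 * Suc n) :: real)"
  define s where "s = a - 2 * u - 2 * v"
  define U where "U = lin_prod a 1 1 n * lin_prod u 1 1 (2 * n) * lin_prod v 1 1 (2 * n) * lin_prod (-u) 1 1 n * lin_prod (-v) 1 1 n * lin_prod (-a) 1 2 n *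
      inverse (lin_prod (a - u) 1 1 (2 * Suc n)) * inverse (lin_prod (a - v) 1 1 (2 * Suc n)) * inverse (lin_prod s 1 2 (Suc n))"
  have x: "x \<ge> 1" by (simp add: x_def)
  have nx: "real n = x - 1" by (simp add: x_def)
  have e: "2 * n + 1 - n - 1 = n" "2 * n + 1 - 1 = 2 * n" "2 * n + 2 - Suc n - 1 = n" "2 * n + 2 - 1 = Suc (2 * n)"
    "2 * n + 2 = 2 * Suc n" "2 * n + 1 + n = 3 * n + 1" "2 * n + 2 + Suc n = 3 * Suc n" by simp_all
  have y: "2 * real (2 * n + 1) = 4 * x - 2" "2 * real (2 * n + 1) + 1 = 4 * x - 1" "real (2 * n + 1) = 2 * x - 1"
    "1 + 2 * real n = 2 * x - 1" "1 + 1 * real n = x" "1 + 1 * real (2 * n) = 2 * x - 1" "2 * real (2 * n + 2) = 4 * x"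
    by (simp_all add: x_def)
  have y': "2 * (2 * x - 1) + 1 = 4 * x - 1" by simp
  have i: "inverse (lin_prod c 1 1 (2 * n + 1)) = inverse (lin_prod c 1 1 (2 * Suc n)) * lin c (2 * x)" for c
    using inverse_lin_prod_Suc[of 1 1 "2 * n + 1" c] by (simp add: x_def add_ac)
  have i': "inverse (lin_prod s 1 2 n) = inverse (lin_prod s 1 2 (Suc n)) * lin s (2 * x - 1)"
    using inverse_lin_prod_Suc[of 1 2 n s] x unfolding y by simp
  have i'': "inverse (lin_prod s 1 2 n) * inverse (lin s (2 * x - 1)) = inverse (lin_prod s 1 2 (Suc n))"
    unfolding y(4)[symmetric] by (simp add: lin_prod_Suc fps_inverse_mult)
  have 1: "F_D a u v n (2 * n + 1) = fps_const c * U * (fps_const (3 * x * (3 * x - 1)) * (lin a (4 * x - 2) * (lin (a - u) (2 * x) * (lin (a - v) (2 * x) * lin s (2 * x - 1)))))"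
  proof -
    have k: "(-1) ^ n / fact (3 * n + 1) = c * (3 * x * (3 * x - 1))"
      unfolding c_def fact_3_Suc x_def[symmetric] using x by simp
    show ?thesis unfolding F_D_def kernel_D_def e y(1) s_def[symmetric] i i' k U_def by (simp only: fps_const_mult[symmetric] mult_ac)
  qed
  have 2: "G_D a u v n (2 * n + 1) = fps_const c * U * (fps_const (3 * x) * (lin a (4 * x - 1) * (lin u (2 * x - 1) * (lin v (2 * x - 1) * (lin (a - u) (2 * x) * lin (a - v) (2 * x))))))"
  proof -
    have k: "(-1) ^ n / fact (3 * n + 1) * (1 / (2 * x - 1 + real n + 1)) = c * (3 * x)"
      unfolding c_def fact_3_Suc x_def[symmetric] nx using x by (simp add: divide_simps)
    have "G_D a u v n (2 * n + 1) = fps_const ((-1) ^ n / fact (3 * n + 1) * (1 / (2 * x - 1 + real n + 1))) *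
       (lin_prod a 1 1 n * lin_prod u 1 1 (2 * n) * lin_prod v 1 1 (2 * n) * lin_prod (-u) 1 1 n * lin_prod (-v) 1 1 n * lin_prod (-a) 1 2 n *
      inverse (lin_prod (a - u) 1 1 (2 * Suc n)) * inverse (lin_prod (a - v) 1 1 (2 * Suc n)) * (inverse (lin_prod s 1 2 n) * inverse (lin s (2 * x - 1)))) *
      (lin a (4 * x - 1) * (lin u (2 * x - 1) * (lin v (2 * x - 1) * (lin (a - u) (2 * x) * lin (a - v) (2 * x)))))"
      unfolding G_D_def kernel_D_def e y(3,4) y' s_def[symmetric] i by (simp only: fps_const_mult[symmetric] mult_ac)
    thus ?thesis unfolding k i'' U_def by (simp only: fps_const_mult[symmetric] mult_ac)
  qed
  have 3: "F_D a u v (Suc n) (2 * n + 2) = - (fps_const c * U * (lin a (4 * x) * (lin u (2 * x - 1) * (lin v (2 * x - 1) * (lin (-u) x * (lin (-v) x * lin (-a) (2 * x - 1)))))))"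
  proof -
    have k: "fps_const ((-1) ^ Suc n / fact (3 * Suc n)) = - fps_const c" by (simp add: c_def)
    have t: "lin_prod u 1 1 (Suc (2 * n)) = lin_prod u 1 1 (2 * n) * lin u (2 * x - 1)" "lin_prod v 1 1 (Suc (2 * n)) = lin_prod v 1 1 (2 * n) * lin v (2 * x - 1)"
      "lin_prod (-u) 1 1 (Suc n) = lin_prod (-u) 1 1 n * lin (-u) x" "lin_prod (-v) 1 1 (Suc n) = lin_prod (-v) 1 1 n * lin (-v) x"
      "lin_prod (-a) 1 2 (Suc n) = lin_prod (-a) 1 2 n * lin (-a) (2 * x - 1)"
      unfolding lin_prod_Suc y by (rule refl)+
    show ?thesis unfolding F_D_def kernel_D_def e(3) e(4) e(7) y(7) s_def[symmetric] t k unfolding e(5) U_def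
      by (simp only: mult_ac mult_minus_left mult_minus_right)
  qed
  have P: "F_D a u v n (2 * n + 1) + G_D a u v n (2 * n + 1) + F_D a u v (Suc n) (2 * n + 2) = fps_const c * U * edge_factor_D a u v x"
    unfolding 1 2 3 edge_factor_D_def s_def[symmetric] by (simp only: distrib_left right_diff_distrib add_uminus_conv_diff)
  have lgP: "power_sums (fps_const c * U) (edge_sum_D a u v n)"
  proof -
    have "power_sums (fps_const c * U) (\<lambda>s'. 0 + ((\<Sum>j<n. (a / (1 + 1 * real j)) ^ s') + (\<Sum>j<2 * n. (u / (1 + 1 * real j)) ^ s')
      + (\<Sum>j<2 * n. (v / (1 + 1 * real j)) ^ s') + (\<Sum>j<n. (-u / (1 + 1 * real j)) ^ s') + (\<Sum>j<n. (-v / (1 + 1 * real j)) ^ s')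
      + (\<Sum>j<n. (-a / (1 + 2 * real j)) ^ s') + - (\<Sum>j<2 * Suc n. ((a - u) / (1 + 1 * real j)) ^ s')
      + - (\<Sum>j<2 * Suc n. ((a - v) / (1 + 1 * real j)) ^ s') + - (\<Sum>j<Suc n. (s / (1 + 2 * real j)) ^ s')))"
      unfolding U_def by (intro power_sums_mult power_sums_const power_sums_lin_prod power_sums_inverse_lin_prod) simp_all
    also have "(\<lambda>s'. 0 + ((\<Sum>j<n. (a / (1 + 1 * real j)) ^ s') + (\<Sum>j<2 * n. (u / (1 + 1 * real j)) ^ s')
      + (\<Sum>j<2 * n. (v / (1 + 1 * real j)) ^ s') + (\<Sum>j<n. (-u / (1 + 1 * real j)) ^ s') + (\<Sum>j<n. (-v / (1 + 1 * real j)) ^ s')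
      + (\<Sum>j<n. (-a / (1 + 2 * real j)) ^ s') + - (\<Sum>j<2 * Suc n. ((a - u) / (1 + 1 * real j)) ^ s')
      + - (\<Sum>j<2 * Suc n. ((a - v) / (1 + 1 * real j)) ^ s') + - (\<Sum>j<Suc n. (s / (1 + 2 * real j)) ^ s'))) = edge_sum_D a u v n"
    proof (rule ext)
      fix r
      have H: "harm_sum (Suc n) r = harm_sum n r + (1 / x) ^ r" "odd_harm_sum (Suc n) r = odd_harm_sum n r + (1 / (2 * x - 1)) ^ r"
        by (simp_all add: harm_sum_def odd_harm_sum_def x_def)
      have q: "(1 / (2 * x)) ^ r = (1/2) ^ r * (1 / x) ^ r" "(s / (2 * x - 1)) ^ r = s ^ r * (1 / (2 * x - 1)) ^ r"
        by (simp_all add: power_divide power_mult_distrib)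
      show "0 + ((\<Sum>j<n. (a / (1 + 1 * real j)) ^ r) + (\<Sum>j<2 * n. (u / (1 + 1 * real j)) ^ r)
      + (\<Sum>j<2 * n. (v / (1 + 1 * real j)) ^ r) + (\<Sum>j<n. (-u / (1 + 1 * real j)) ^ r) + (\<Sum>j<n. (-v / (1 + 1 * real j)) ^ r)
      + (\<Sum>j<n. (-a / (1 + 2 * real j)) ^ r) + - (\<Sum>j<2 * Suc n. ((a - u) / (1 + 1 * real j)) ^ r)
      + - (\<Sum>j<2 * Suc n. ((a - v) / (1 + 1 * real j)) ^ r) + - (\<Sum>j<Suc n. (s / (1 + 2 * real j)) ^ r)) = edge_sum_D a u v n r"
        unfolding sum_1_1_double unfolding sum_1_1 sum_1_2 H edge_sum_D_def x_def[symmetric] s_def[symmetric] q by (simp only: ring_distribs) simp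
    qed
    finally show ?thesis .
  qed
  have P0: "fps_nth (fps_const c * U) 0 = edge_coeff n * (1 / (4 * x\<^sup>2 * (2 * x - 1) ^ 3))"
  proof -
    have a: "scal_prod 1 2 n > 0" by (simp add: scal_prod_pos)
    have t: "scal_prod 1 2 (Suc n) = scal_prod 1 2 n * (2 * x - 1)" "(fact (2 * Suc n) :: real) = 2 * x * (2 * x - 1) * fact (2 * n)"
      by (simp_all add: scal_prod_Suc x_def algebra_simps)
    have "fps_nth (fps_const c * U) 0 = c * (fact n * fact (2 * n) * fact (2 * n) * fact n * fact n * scal_prod 1 2 n *
        inverse (fact (2 * Suc n)) * inverse (fact (2 * Suc n)) * inverse (scal_prod 1 2 (Suc n)))"
      unfolding U_def by (simp add: lin_prod_nth_0 scal_prod_1_1 del: fact_Suc mult_Suc_right)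
    also have "\<dots> = c * fact n ^ 3 * (1 / (4 * x\<^sup>2 * (2 * x - 1) ^ 3))"
      unfolding t using a x by (simp add: divide_simps power3_eq_cube power2_eq_square)
    finally show ?thesis unfolding edge_coeff_def c_def by simp
  qed
  show ?thesis unfolding P nth_3_mult_power_sums[OF lgP] P0 by (simp only: mult.assoc)
qed

lemma edge_sum_Q_alt: "edge_sum_Q d b n s = (d ^ s + b ^ s + (-b) ^ s + (1/2) ^ s * ((-b) ^ s + (-d) ^ s - (d - b) ^ s)) * harm_sum n s + (b ^ s - (d + b) ^ s) * odd_harm_sum n s
     + ((-b) ^ s - ((d - b) / 2) ^ s) * (1 / real (Suc n)) ^ s - (d + b) ^ s * (1 / (2 * real (Suc n) - 1)) ^ s"
proof -
  have p: "(c / y) ^ s = c ^ s * (1 / y) ^ s" for c y :: real by (simp add: power_divide)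
  have q: "(d - b) / (2 * real (Suc n)) = ((d - b) / 2) / real (Suc n)" by simp
  show ?thesis unfolding edge_sum_Q_def q p[of "- b"] p[of "(d - b) / 2"] p[of "d + b"] by algebra
qed

lemma edge_sum_D_alt: "edge_sum_D a u v n s = (a ^ s + (-u) ^ s + (-v) ^ s + (1/2) ^ s * (u ^ s + v ^ s - (a - u) ^ s - (a - v) ^ s)) * harm_sum n s
     + ((-a) ^ s - (a - 2 * u - 2 * v) ^ s + u ^ s + v ^ s - (a - u) ^ s - (a - v) ^ s) * odd_harm_sum n s
     - ((1 / (2 * real (Suc n) - 1)) ^ s + (1/2) ^ s * (1 / real (Suc n)) ^ s) * ((a - u) ^ s + (a - v) ^ s)
     - (a - 2 * u - 2 * v) ^ s * (1 / (2 * real (Suc n) - 1)) ^ s"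
proof -
  have p: "(c / y) ^ s = c ^ s * (1 / y) ^ s" for c y :: real by (simp add: power_divide)
  have q: "(1 / (2 * real (Suc n))) ^ s = (1/2) ^ s * (1 / real (Suc n)) ^ s"
    unfolding power_mult_distrib[symmetric] by simp
  show ?thesis unfolding edge_sum_D_def q p[of "a - 2 * u - 2 * v"] ..
qed

text \<open>Sorted by monomials in the harmonic sums, the coefficient of \<open>X^3\<close> needs seven rational functions of \<open>n\<close>, since the
second and third power sums enter linearly.\<close>
lemma cubic_expand:
  fixes s :: real
  assumes h: "h 1 = a1 + o1 * O1" "h 2 = a2 + k2 * H2 + o2 * O2" "h 3 = a3 + k3 * H3 + o3 * O3"
    and c: "s * ((a1 ^ 3 - 3 * a1 * a2 + 2 * a3) / 6 * B0 + (a1\<^sup>2 - a2) / 2 * B1 + a1 * B2 + B3) = C1"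
     "s * ((a1\<^sup>2 - a2) * o1 / 2 * B0 + a1 * o1 * B1 + o1 * B2) = C2"
     "s * (a1 * o1\<^sup>2 / 2 * B0 + o1\<^sup>2 / 2 * B1) = C3"
     "s * (o1 ^ 3 / 6 * B0) = C4"
     "s * (- a1 / 2 * B0 - B1 / 2) = C5"
     "s * (- o1 / 2 * B0) = C6"
     "s * (B0 / 3) = C7"
  shows "s * cubic h B0 B1 B2 B3 = C1 + C2 * O1 + C3 * O1\<^sup>2 + C4 * O1 ^ 3 + C5 * (k2 * H2 + o2 * O2)
    + C6 * (O1 * (k2 * H2 + o2 * O2)) + C7 * (k3 * H3 + o3 * O3)"
  unfolding c[symmetric] cubic_def h power2_eq_square power3_eq_cube
  by (simp add: algebra_simps add_divide_distrib diff_divide_distrib)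

section \<open>Cancellation of the harmonic sums\<close>

text \<open>Every rational function below has poles at \<open>0\<close> and \<open>1/2\<close> only.  As rewrite rules, these equations compute the
partial fraction decomposition in \<open>p = 1 / x\<close> and \<open>q = 1 / (2 x - 1)\<close>, which is unique; this makes
the cancellation in \<open>combination\<close> a linear one.\<close>
lemma pq_rules:
  fixes x z :: real
  assumes "x > 0" "2 * x - 1 > 0"
  defines "p \<equiv> 1 / x" and "q \<equiv> 1 / (2 * x - 1)"
  shows "p * x = 1" "p * q = 2 * q - p" "q * x = 1/2 + q/2"
    "p * (x * z) = z" "p * (q * z) = 2 * (q * z) - p * z" "q * (x * z) = z/2 + q * z/2"
proof -
  show r: "p * x = 1" "p * q = 2 * q - p" "q * x = 1/2 + q/2"
  proof -
    have y: "2 * x - 1 \<noteq> 0" "x \<noteq> 0" using assms(1,2) by auto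
    have px: "p * x = 1" and qx: "q * (2 * x - 1) = 1" using y by (simp_all add: p_def q_def)
    show "p * x = 1" by (rule px)
    show "q * x = 1/2 + q/2" using qx by (simp add: algebra_simps)
    have "p * q = p * q * (2 * x - (2 * x - 1))" by simp
    also have "\<dots> = 2 * q * (p * x) - p * (q * (2 * x - 1))" by (simp add: algebra_simps)
    finally show "p * q = 2 * q - p" unfolding px qx by simp
  qed
  show "p * (x * z) = z" "p * (q * z) = 2 * (q * z) - p * z" "q * (x * z) = z/2 + q * z/2"
    unfolding mult.assoc[symmetric] r by (simp_all add: algebra_simps)
qed

lemma term_Q1:
  fixes n :: nat
  defines "x \<equiv> real (Suc n)"
  defines "p \<equiv> 1 / x" and "q \<equiv> 1 / (2 * x - 1)"
  shows "fps_nth (F_Q (- 4) 1 n (Suc n) + G_Q (- 4) 1 n (Suc n)) 3 = edge_coeff n * ((- (41 * p) + 189 / 8 * p ^ 2 + 82 * q + 207 / 2 * q ^ 2 + 126 * q ^ 3 + 81 / 2 * q ^ 4) + (41 * p + 138 * q + 168 * q ^ 2 + 54 * q ^ 3) * odd_harm_sum n 1 + (88 + 112 * q + 36 * q ^ 2) * (odd_harm_sum n 1)\<^sup>2 + (224 / 3 * x + 16 + 16 * q) * (odd_harm_sum n 1) ^ 3 + (- (11 / 2) - 7 * q - 9 / 4 * q ^ 2) * (16 * harm_sum n 2 + (- 8) * odd_harm_sum n 2) + (- (14 * x) - 3 - 3 * q) * (odd_harm_sum n 1 * (16 * harm_sum n 2 + (- 8) * odd_harm_sum n 2)) + (7 /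 3 * x + 1 / 2 + 1 / 2 * q) * ((- 81 / 2) * harm_sum n 3 + 28 * odd_harm_sum n 3))"
proof -
  have x: "x > 0" "2 * x - 1 > 0" "2 * x \<noteq> 1" by (simp_all add: x_def)
  note pq = pq_rules[OF x(1,2), folded p_def q_def]
  have h: "edge_sum_Q (- 4) 1 n 1 = (3 / 2 * p + 3 * q) + 4 * odd_harm_sum n 1"
    "edge_sum_Q (- 4) 1 n 2 = (- (21 / 4 * p ^ 2) - 9 * q ^ 2) + 16 * harm_sum n 2 + (- 8) * odd_harm_sum n 2"
    "edge_sum_Q (- 4) 1 n 3 = (117 / 8 * p ^ 3 + 27 * q ^ 3) + (- 81 / 2) * harm_sum n 3 + 28 * odd_harm_sum n 3"
    unfolding edge_sum_Q_alt x_def[symmetric] p_def[symmetric] q_def[symmetric]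
    by (simp_all add: power_divide)
  have "p * q / 2 * cubic (edge_sum_Q (- 4) 1 n) (3 * x * (3 * x - 1) * (3 * x) + x * x * (x + 1)) (3 * x * (3 * x - 1) * (- 4) + (x * (x + 1) * ((- 4) + 1) - x * x * 1)) ((- 4) * 1 * (x + 1) - 1 * ((- 4) + 1) * x) (- ((- 4) * 1 * 1))
    = (- (41 * p) + 189 / 8 * p ^ 2 + 82 * q + 207 / 2 * q ^ 2 + 126 * q ^ 3 + 81 / 2 * q ^ 4) + (41 * p + 138 * q + 168 * q ^ 2 + 54 * q ^ 3) * odd_harm_sum n 1 + (88 + 112 * q + 36 * q ^ 2) * (odd_harm_sum n 1)\<^sup>2 + (224 / 3 * x + 16 + 16 * q) * (odd_harm_sum n 1) ^ 3 + (- (11 / 2) - 7 * q - 9 / 4 * q ^ 2) * (16 * harm_sum n 2 + (- 8) * odd_harm_sum n 2) + (- (14 * x) - 3 - 3 * q) * (odd_harm_sum n 1 * (16 * harm_sum n 2 + (- 8) * odd_harm_sum n 2)) + (7 / 3 * x + 1 / 2 + 1 / 2 * q) * ((- 81 / 2) * harm_sum n 3 + 28 * odd_harm_sum n 3)"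
    by (rule cubic_expand[OF h]) (simp_all add: algebra_simps eval_nat_numeral pq add_divide_distrib diff_divide_distrib)
  moreover have "1 / (2 * x * (2 * x - 1)) = p * q / 2" unfolding p_def q_def using x by (simp add: power_divide)
  ultimately show ?thesis unfolding edge_term_Q x_def[symmetric] by (simp only:)
qed

lemma term_Q2:
  fixes n :: nat
  defines "x \<equiv> real (Suc n)"
  defines "p \<equiv> 1 / x" and "q \<equiv> 1 / (2 * x - 1)"
  shows "fps_nth (F_Q (- 2) 1 n (Suc n) + G_Q (- 2) 1 n (Suc n)) 3 = edge_coeff n * ((- (11 / 2 * p) + 25 / 8 * p ^ 2 + 11 * q + 3 / 2 * q ^ 2 + 4 * q ^ 3 + 3 / 2 * q ^ 4) + (11 / 2 * p + 3 * q + 8 * q ^ 2 + 3 * q ^ 3) * odd_harm_sum n 1 + (4 + 8 * q + 3 * q ^ 2) * (odd_harm_sum n 1)\<^sup>2 + (28 / 3 * x + 2 + 2 * q) * (odd_harm_sum n 1) ^ 3 + (- (1) - 2 * q - 3 / 4 * q ^ 2) * (5 * harm_sum n 2 + 0 * odd_harm_sum n 2) + (- (7 * x) - 3 / 2 - 3 / 2 * q) * (odd_harm_sum n 1 * (5 * harm_sum n 2 + 0 * odd_harm_sum n 2)) + (7 / 3 * x + 1 / 2 + 1 / 2 * q) * ((- 15 / 4) * harm_sum n 3 + 2 * odd_harm_sum n 3))"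
proof -
  have x: "x > 0" "2 * x - 1 > 0" "2 * x \<noteq> 1" by (simp_all add: x_def)
  note pq = pq_rules[OF x(1,2), folded p_def q_def]
  have h: "edge_sum_Q (- 2) 1 n 1 = (1 / 2 * p + q) + 2 * odd_harm_sum n 1"
    "edge_sum_Q (- 2) 1 n 2 = (- (5 / 4 * p ^ 2) - q ^ 2) + 5 * harm_sum n 2 + 0 * odd_harm_sum n 2"
    "edge_sum_Q (- 2) 1 n 3 = (19 / 8 * p ^ 3 + q ^ 3) + (- 15 / 4) * harm_sum n 3 + 2 * odd_harm_sum n 3"
    unfolding edge_sum_Q_alt x_def[symmetric] p_def[symmetric] q_def[symmetric]
    by (simp_all add: power_divide)
  have "p * q / 2 * cubic (edge_sum_Q (- 2) 1 n) (3 * x * (3 * x - 1) * (3 * x) + x * x * (x + 1)) (3 * x * (3 * x - 1) * (- 2) + (x * (x + 1) * ((- 2) + 1) - x * x * 1)) ((- 2) * 1 * (x + 1) - 1 * ((- 2) + 1) * x) (- ((- 2) * 1 * 1))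
    = (- (11 / 2 * p) + 25 / 8 * p ^ 2 + 11 * q + 3 / 2 * q ^ 2 + 4 * q ^ 3 + 3 / 2 * q ^ 4) + (11 / 2 * p + 3 * q + 8 * q ^ 2 + 3 * q ^ 3) * odd_harm_sum n 1 + (4 + 8 * q + 3 * q ^ 2) * (odd_harm_sum n 1)\<^sup>2 + (28 / 3 * x + 2 + 2 * q) * (odd_harm_sum n 1) ^ 3 + (- (1) - 2 * q - 3 / 4 * q ^ 2) * (5 * harm_sum n 2 + 0 * odd_harm_sum n 2) + (- (7 * x) - 3 / 2 - 3 / 2 * q) * (odd_harm_sum n 1 * (5 * harm_sum n 2 + 0 * odd_harm_sum n 2)) + (7 / 3 * x + 1 / 2 + 1 / 2 * q) * ((- 15 / 4) * harm_sum n 3 + 2 * odd_harm_sum n 3)"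
    by (rule cubic_expand[OF h]) (simp_all add: algebra_simps eval_nat_numeral pq add_divide_distrib diff_divide_distrib)
  moreover have "1 / (2 * x * (2 * x - 1)) = p * q / 2" unfolding p_def q_def using x by (simp add: power_divide)
  ultimately show ?thesis unfolding edge_term_Q x_def[symmetric] by (simp only:)
qed

lemma term_Q3:
  fixes n :: nat
  defines "x \<equiv> real (Suc n)"
  defines "p \<equiv> 1 / x" and "q \<equiv> 1 / (2 * x - 1)"
  shows "fps_nth (F_Q 1 1 n (Suc n) + G_Q 1 1 n (Suc n)) 3 = edge_coeff n * ((- (p) + 1 / 2 * p ^ 2 + 2 * q - 39 * q ^ 2 - 44 * q ^ 3 - 12 * q ^ 4) + (p - 39 / 2 * q - 22 * q ^ 2 - 6 * q ^ 3) * odd_harm_sum n 1 + (- (23 / 4) - 11 / 2 * q - 3 / 2 * q ^ 2) * (odd_harm_sum n 1)\<^sup>2 + (- (7 / 6 * x) - 1 / 4 - 1 / 4 * q) * (odd_harm_sum n 1) ^ 3 + (23 / 4 + 11 / 2 * q + 3 / 2 * q ^ 2) * ((7 / 2) * harm_sum n 2 + (- 3) * odd_harm_sum n 2) + (7 / 2 * x + 3 / 4 + 3 / 4 * q) * (odd_harm_sum n 1 * ((7 / 2) * harm_sum n 2 + (- 3) * odd_harm_sum n 2)) + (7 / 3 * x + 1 / 2 + 1 / 2 * q) * ((3 / 4) * harm_sum n 3 + (- 7) * odd_harm_sum n 3))"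
proof -
  have x: "x > 0" "2 * x - 1 > 0" "2 * x \<noteq> 1" by (simp_all add: x_def)
  note pq = pq_rules[OF x(1,2), folded p_def q_def]
  have h: "edge_sum_Q 1 1 n 1 = (- (p) - 2 * q) + (- 1) * odd_harm_sum n 1"
    "edge_sum_Q 1 1 n 2 = (p ^ 2 - 4 * q ^ 2) + (7 / 2) * harm_sum n 2 + (- 3) * odd_harm_sum n 2"
    "edge_sum_Q 1 1 n 3 = (- (p ^ 3) - 8 * q ^ 3) + (3 / 4) * harm_sum n 3 + (- 7) * odd_harm_sum n 3"
    unfolding edge_sum_Q_alt x_def[symmetric] p_def[symmetric] q_def[symmetric]
    by (simp_all add: power_divide)
  have "p * q / 2 * cubic (edge_sum_Q 1 1 n) (3 * x * (3 * x - 1) * (3 * x) + x * x * (x + 1)) (3 * x * (3 * x - 1) * 1 + (x * (x + 1) * (1 + 1) - x * x * 1)) (1 * 1 * (x + 1) - 1 * (1 + 1) * x) (- (1 * 1 * 1))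
    = (- (p) + 1 / 2 * p ^ 2 + 2 * q - 39 * q ^ 2 - 44 * q ^ 3 - 12 * q ^ 4) + (p - 39 / 2 * q - 22 * q ^ 2 - 6 * q ^ 3) * odd_harm_sum n 1 + (- (23 / 4) - 11 / 2 * q - 3 / 2 * q ^ 2) * (odd_harm_sum n 1)\<^sup>2 + (- (7 / 6 * x) - 1 / 4 - 1 / 4 * q) * (odd_harm_sum n 1) ^ 3 + (23 / 4 + 11 / 2 * q + 3 / 2 * q ^ 2) * ((7 / 2) * harm_sum n 2 + (- 3) * odd_harm_sum n 2) + (7 / 2 * x + 3 / 4 + 3 / 4 * q) * (odd_harm_sum n 1 * ((7 / 2) * harm_sum n 2 + (- 3) * odd_harm_sum n 2)) + (7 / 3 * x + 1 / 2 + 1 / 2 * q) * ((3 / 4) * harm_sum n 3 + (- 7) * odd_harm_sum n 3)"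
    by (rule cubic_expand[OF h]) (simp_all add: algebra_simps eval_nat_numeral pq add_divide_distrib diff_divide_distrib)
  moreover have "1 / (2 * x * (2 * x - 1)) = p * q / 2" unfolding p_def q_def using x by (simp add: power_divide)
  ultimately show ?thesis unfolding edge_term_Q x_def[symmetric] by (simp only:)
qed

lemma term_D1:
  fixes n :: nat
  defines "x \<equiv> real (Suc n)"
  defines "p \<equiv> 1 / x" and "q \<equiv> 1 / (2 * x - 1)"
  shows "fps_nth (F_D 5 (- 2) 5 n (2 * n + 1) + G_D 5 (- 2) 5 n (2 * n + 1) + F_D 5 (- 2) 5 (Suc n) (2 * n + 2)) 3 = edge_coeff n * ((- (37 * p) + 459 / 16 * p ^ 2 + 74 * q - 3849 / 4 * q ^ 2 - 1617 * q ^ 3 - 1989 / 4 * q ^ 4) + (37 * p - 858 * q - 1752 * q ^ 2 - 558 * q ^ 3) * odd_harm_sum n 1 + (- (400) - 928 * q - 360 * q ^ 2) * (odd_harm_sum n 1)\<^sup>2 + (- (3584 / 3 * x) - 256 - 256 * q) * (odd_harm_sum n 1) ^ 3 + (25 / 4 + 29 / 2 * q + 45 / 8 * q ^ 2) * (49 * harm_sum n 2 + 4 * odd_harm_sum n 2) + (56 * x + 12 + 12 * q) * (odd_harm_sum n 1 * (49 * harm_sum n 2 + 4 * odd_harm_sum n 2)) + (14 / 3 * x + 1 + q) * ((- 81 / 4) * harm_sum n 3 + (- 350) * odd_harm_sum n 3))"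
proof -
  have x: "x > 0" "2 * x - 1 > 0" "2 * x \<noteq> 1" by (simp_all add: x_def)
  note pq = pq_rules[OF x(1,2), folded p_def q_def]
  have h: "edge_sum_D 5 (- 2) 5 n 1 = (- (7 / 2 * p) - 6 * q) + (- 8) * odd_harm_sum n 1"
    "edge_sum_D 5 (- 2) 5 n 2 = (- (49 / 4 * p ^ 2) - 50 * q ^ 2) + 49 * harm_sum n 2 + 4 * odd_harm_sum n 2"
    "edge_sum_D 5 (- 2) 5 n 3 = (- (343 / 8 * p ^ 3) - 342 * q ^ 3) + (- 81 / 4) * harm_sum n 3 + (- 350) * odd_harm_sum n 3"
    unfolding edge_sum_D_alt x_def[symmetric] p_def[symmetric] q_def[symmetric]
    by (simp_all add: power_divide)
  have B: "fps_nth (edge_factor_D 5 (- 2) 5 x) 0 = 448 * x ^ 6 - 576 * x ^ 5 + 240 * x ^ 4 - 32 * x ^ 3"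
    "fps_nth (edge_factor_D 5 (- 2) 5 x) 1 = 2512 * x ^ 5 - 2936 * x ^ 4 + 1106 * x ^ 3 - 133 * x ^ 2"
    "fps_nth (edge_factor_D 5 (- 2) 5 x) 2 = 2888 * x ^ 4 - 2930 * x ^ 3 + 778 * x ^ 2 - 55 * x"
    "fps_nth (edge_factor_D 5 (- 2) 5 x) 3 = - (2240 * x ^ 3) + 15 * x ^ 2 + 190 * x - 50"
    unfolding edge_factor_D_def by (simp_all add: lin_mult_nth lin_nth eval_nat_numeral algebra_simps)
  have "p\<^sup>2 * q ^ 3 / 4 * cubic (edge_sum_D 5 (- 2) 5 n) (448 * x ^ 6 - 576 * x ^ 5 + 240 * x ^ 4 - 32 * x ^ 3) (2512 * x ^ 5 - 2936 * x ^ 4 + 1106 * x ^ 3 - 133 * x ^ 2) (2888 * x ^ 4 - 2930 * x ^ 3 + 778 * x ^ 2 - 55 * x) (- (2240 * x ^ 3) + 15 * x ^ 2 + 190 * x - 50)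
    = (- (37 * p) + 459 / 16 * p ^ 2 + 74 * q - 3849 / 4 * q ^ 2 - 1617 * q ^ 3 - 1989 / 4 * q ^ 4) + (37 * p - 858 * q - 1752 * q ^ 2 - 558 * q ^ 3) * odd_harm_sum n 1 + (- (400) - 928 * q - 360 * q ^ 2) * (odd_harm_sum n 1)\<^sup>2 + (- (3584 / 3 * x) - 256 - 256 * q) * (odd_harm_sum n 1) ^ 3 + (25 / 4 + 29 / 2 * q + 45 / 8 * q ^ 2) * (49 * harm_sum n 2 + 4 * odd_harm_sum n 2) + (56 * x + 12 + 12 * q) * (odd_harm_sum n 1 * (49 * harm_sum n 2 + 4 * odd_harm_sum n 2)) + (14 / 3 * x + 1 + q) * ((- 81 / 4) * harm_sum n 3 + (- 350) * odd_harm_sum n 3)"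
    by (rule cubic_expand[OF h]) (simp_all add: algebra_simps eval_nat_numeral pq add_divide_distrib diff_divide_distrib)
  moreover have "1 / (4 * x\<^sup>2 * (2 * x - 1) ^ 3) = p\<^sup>2 * q ^ 3 / 4" unfolding p_def q_def using x by (simp add: power_divide)
  ultimately show ?thesis unfolding edge_term_D x_def[symmetric] B by (simp only:)
qed

lemma term_D2:
  fixes n :: nat
  defines "x \<equiv> real (Suc n)"
  defines "p \<equiv> 1 / x" and "q \<equiv> 1 / (2 * x - 1)"
  shows "fps_nth (F_D 0 1 1 n (2 * n + 1) + G_D 0 1 1 n (2 * n + 1) + F_D 0 1 1 (Suc n) (2 * n + 2)) 3 = edge_coeff n * ((- (2 * p) + 4 * q + 488 * q ^ 2 + 712 * q ^ 3 + 264 * q ^ 4) + (2 * p + 972 * q + 1424 * q ^ 2 + 516 * q ^ 3) * odd_harm_sum n 1 + (960 + 1408 * q + 480 * q ^ 2) * (odd_harm_sum n 1)\<^sup>2 + (3584 / 3 * x + 256 + 256 * q) * (odd_harm_sum n 1) ^ 3 + (- (15) - 22 * q - 15 / 2 * q ^ 2) * (2 * harm_sum n 2 + (- 16) * odd_harm_sum n 2) + (- (56 * x) - 12 - 12 * q) * (odd_harm_sum n 1 * (2 * harm_sum n 2 + (- 16) * odd_harm_sum n 2)) + (14 / 3 * x + 1 + q) * ((- 3 / 2) * harm_sum n 3 + 68 * odd_harm_sum n 3))"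
proof -
  have x: "x > 0" "2 * x - 1 > 0" "2 * x \<noteq> 1" by (simp_all add: x_def)
  note pq = pq_rules[OF x(1,2), folded p_def q_def]
  have h: "edge_sum_D 0 1 1 n 1 = (p + 6 * q) + 8 * odd_harm_sum n 1"
    "edge_sum_D 0 1 1 n 2 = (- (1 / 2 * p ^ 2) - 18 * q ^ 2) + 2 * harm_sum n 2 + (- 16) * odd_harm_sum n 2"
    "edge_sum_D 0 1 1 n 3 = (1 / 4 * p ^ 3 + 66 * q ^ 3) + (- 3 / 2) * harm_sum n 3 + 68 * odd_harm_sum n 3"
    unfolding edge_sum_D_alt x_def[symmetric] p_def[symmetric] q_def[symmetric]
    by (simp_all add: power_divide)
  have B: "fps_nth (edge_factor_D 0 1 1 x) 0 = 448 * x ^ 6 - 576 * x ^ 5 + 240 * x ^ 4 - 32 * x ^ 3"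
    "fps_nth (edge_factor_D 0 1 1 x) 1 = - (832 * x ^ 5) + 896 * x ^ 4 - 296 * x ^ 3 + 28 * x ^ 2"
    "fps_nth (edge_factor_D 0 1 1 x) 2 = 576 * x ^ 4 - 516 * x ^ 3 + 130 * x ^ 2 - 5 * x"
    "fps_nth (edge_factor_D 0 1 1 x) 3 = - (160 * x ^ 3) + 120 * x ^ 2 - 26 * x"
    unfolding edge_factor_D_def by (simp_all add: lin_mult_nth lin_nth eval_nat_numeral algebra_simps)
  have "p\<^sup>2 * q ^ 3 / 4 * cubic (edge_sum_D 0 1 1 n) (448 * x ^ 6 - 576 * x ^ 5 + 240 * x ^ 4 - 32 * x ^ 3) (- (832 * x ^ 5) + 896 * x ^ 4 - 296 * x ^ 3 + 28 * x ^ 2) (576 * x ^ 4 - 516 * x ^ 3 + 130 * x ^ 2 - 5 * x) (- (160 * x ^ 3) + 120 * x ^ 2 - 26 * x)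
    = (- (2 * p) + 4 * q + 488 * q ^ 2 + 712 * q ^ 3 + 264 * q ^ 4) + (2 * p + 972 * q + 1424 * q ^ 2 + 516 * q ^ 3) * odd_harm_sum n 1 + (960 + 1408 * q + 480 * q ^ 2) * (odd_harm_sum n 1)\<^sup>2 + (3584 / 3 * x + 256 + 256 * q) * (odd_harm_sum n 1) ^ 3 + (- (15) - 22 * q - 15 / 2 * q ^ 2) * (2 * harm_sum n 2 + (- 16) * odd_harm_sum n 2) + (- (56 * x) - 12 - 12 * q) * (odd_harm_sum n 1 * (2 * harm_sum n 2 + (- 16) * odd_harm_sum n 2)) + (14 / 3 * x + 1 + q) * ((- 3 / 2) * harm_sum n 3 + 68 * odd_harm_sum n 3)"
    by (rule cubic_expand[OF h]) (simp_all add: algebra_simps eval_nat_numeral pq add_divide_distrib diff_divide_distrib)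
  moreover have "1 / (4 * x\<^sup>2 * (2 * x - 1) ^ 3) = p\<^sup>2 * q ^ 3 / 4" unfolding p_def q_def using x by (simp add: power_divide)
  ultimately show ?thesis unfolding edge_term_D x_def[symmetric] B by (simp only:)
qed

lemma term_D3:
  fixes n :: nat
  defines "x \<equiv> real (Suc n)"
  defines "p \<equiv> 1 / x" and "q \<equiv> 1 / (2 * x - 1)"
  shows "fps_nth (F_D 0 2 (- 1) n (2 * n + 1) + G_D 0 2 (- 1) n (2 * n + 1) + F_D 0 2 (- 1) (Suc n) (2 * n + 2)) 3 = edge_coeff n * ((- (7 * p) + 9 / 8 * p ^ 2 + 14 * q + 185 / 2 * q ^ 2 + 134 * q ^ 3 + 93 / 2 * q ^ 4) + (7 * p + 162 * q + 232 * q ^ 2 + 78 * q ^ 3) * odd_harm_sum n 1 + (120 + 176 * q + 60 * q ^ 2) * (odd_harm_sum n 1)\<^sup>2 + (448 / 3 * x + 32 + 32 * q) * (odd_harm_sum n 1) ^ 3 + (- (15 / 2) - 11 * q - 15 / 4 * q ^ 2) * (5 * harm_sum n 2 + (- 4) * odd_harm_sum n 2) + (- (28 * x) - 6 - 6 * q) * (odd_harm_sum n 1 * (5 * harm_sum n 2 + (- 4) * odd_harm_sum n 2)) + (14 / 3 * x + 1 + q) * ((- 21 / 4) * harm_sum n 3 + 22 * odd_harm_sum n 3))"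
proof -
  have x: "x > 0" "2 * x - 1 > 0" "2 * x \<noteq> 1" by (simp_all add: x_def)
  note pq = pq_rules[OF x(1,2), folded p_def q_def]
  have h: "edge_sum_D 0 2 (- 1) n 1 = (1 / 2 * p + 3 * q) + 4 * odd_harm_sum n 1"
    "edge_sum_D 0 2 (- 1) n 2 = (- (5 / 4 * p ^ 2) - 9 * q ^ 2) + 5 * harm_sum n 2 + (- 4) * odd_harm_sum n 2"
    "edge_sum_D 0 2 (- 1) n 3 = (7 / 8 * p ^ 3 + 15 * q ^ 3) + (- 21 / 4) * harm_sum n 3 + 22 * odd_harm_sum n 3"
    unfolding edge_sum_D_alt x_def[symmetric] p_def[symmetric] q_def[symmetric]
    by (simp_all add: power_divide)
  have B: "fps_nth (edge_factor_D 0 2 (- 1) x) 0 = 448 * x ^ 6 - 576 * x ^ 5 + 240 * x ^ 4 - 32 * x ^ 3"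
    "fps_nth (edge_factor_D 0 2 (- 1) x) 1 = - (416 * x ^ 5) + 448 * x ^ 4 - 148 * x ^ 3 + 14 * x ^ 2"
    "fps_nth (edge_factor_D 0 2 (- 1) x) 2 = - (144 * x ^ 4) + 132 * x ^ 3 - 62 * x ^ 2 + 10 * x"
    "fps_nth (edge_factor_D 0 2 (- 1) x) 3 = 160 * x ^ 3 - 120 * x ^ 2 + 26 * x"
    unfolding edge_factor_D_def by (simp_all add: lin_mult_nth lin_nth eval_nat_numeral algebra_simps)
  have "p\<^sup>2 * q ^ 3 / 4 * cubic (edge_sum_D 0 2 (- 1) n) (448 * x ^ 6 - 576 * x ^ 5 + 240 * x ^ 4 - 32 * x ^ 3) (- (416 * x ^ 5) + 448 * x ^ 4 - 148 * x ^ 3 + 14 * x ^ 2) (- (144 * x ^ 4) + 132 * x ^ 3 - 62 * x ^ 2 + 10 * x) (160 * x ^ 3 - 120 * x ^ 2 + 26 * x)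
    = (- (7 * p) + 9 / 8 * p ^ 2 + 14 * q + 185 / 2 * q ^ 2 + 134 * q ^ 3 + 93 / 2 * q ^ 4) + (7 * p + 162 * q + 232 * q ^ 2 + 78 * q ^ 3) * odd_harm_sum n 1 + (120 + 176 * q + 60 * q ^ 2) * (odd_harm_sum n 1)\<^sup>2 + (448 / 3 * x + 32 + 32 * q) * (odd_harm_sum n 1) ^ 3 + (- (15 / 2) - 11 * q - 15 / 4 * q ^ 2) * (5 * harm_sum n 2 + (- 4) * odd_harm_sum n 2) + (- (28 * x) - 6 - 6 * q) * (odd_harm_sum n 1 * (5 * harm_sum n 2 + (- 4) * odd_harm_sum n 2)) + (14 / 3 * x + 1 + q) * ((- 21 / 4) * harm_sum n 3 + 22 * odd_harm_sum n 3)"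
    by (rule cubic_expand[OF h]) (simp_all add: algebra_simps eval_nat_numeral pq add_divide_distrib diff_divide_distrib)
  moreover have "1 / (4 * x\<^sup>2 * (2 * x - 1) ^ 3) = p\<^sup>2 * q ^ 3 / 4" unfolding p_def q_def using x by (simp add: power_divide)
  ultimately show ?thesis unfolding edge_term_D x_def[symmetric] B by (simp only:)
qed

section \<open>The theorem\<close>

definition summand :: "nat \<Rightarrow> real" where
  "summand n = (-1/27)^n * ((pochhammer 1 n)\<^sup>2 / (pochhammer (1/3) n * pochhammer (2/3) n)) *
      ((17 - 136 * real n + 408 * real n ^ 2 - 640 * real n ^ 3 + 560 * real n ^ 4)
        / (real n ^ 5 * (2 * real n - 1) ^ 4))"

lemma summand_fact: "summand n = (-1) ^ n * fact n ^ 3 / fact (3 * n) *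
      ((17 - 136 * real n + 408 * real n ^ 2 - 640 * real n ^ 3 + 560 * real n ^ 4)
        / (real n ^ 5 * (2 * real n - 1) ^ 4))"
proof -
  have P: "pochhammer (1/3) n * pochhammer (2/3) n > (0::real)" by (intro mult_pos_pos pochhammer_pos) auto
  have "(-1/27)^n * ((pochhammer 1 n)\<^sup>2 / (pochhammer (1/3) n * pochhammer (2/3) n)) = (-1) ^ n * fact n ^ 3 / (fact (3 * n) :: real)"
    unfolding fact_pochhammer[symmetric] pochhammer_fact[symmetric] power_divide[of "-1" 27 n] using P
    by (simp add: power_divide power3_eq_cube power2_eq_square field_simps)
  thus ?thesis unfolding summand_def by simp
qed

text \<open>The six specialisations and their weights solve the linear system which says that the rational coefficient of each nonconstant
monomial in the harmonic sums vanishes.\<close>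
lemma combination:
  "15 * summand (Suc n) =
    - 56 * fps_nth (F_Q (-4) 1 n (Suc n) + G_Q (-4) 1 n (Suc n)) 3
    + 280 * fps_nth (F_Q (-2) 1 n (Suc n) + G_Q (-2) 1 n (Suc n)) 3
    - 64 * fps_nth (F_Q 1 1 n (Suc n) + G_Q 1 1 n (Suc n)) 3
    + 4 * fps_nth (F_D 5 (-2) 5 n (2 * n + 1) + G_D 5 (-2) 5 n (2 * n + 1) + F_D 5 (-2) 5 (Suc n) (2 * n + 2)) 3
    - 7 * fps_nth (F_D 0 1 1 n (2 * n + 1) + G_D 0 1 1 n (2 * n + 1) + F_D 0 1 1 (Suc n) (2 * n + 2)) 3
    + 98 * fps_nth (F_D 0 2 (-1) n (2 * n + 1) + G_D 0 2 (-1) n (2 * n + 1) + F_D 0 2 (-1) (Suc n) (2 * n + 2)) 3"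
proof -
  define x where "x = real (Suc n)"
  define p where "p = 1 / x"
  define q where "q = 1 / (2 * x - 1)"
  have x: "x > 0" "2 * x - 1 > 0" by (simp_all add: x_def)
  have f: "(fact (Suc n) :: real) = x * fact n" by (simp add: x_def)
  have "15 * summand (Suc n) = edge_coeff n * (- 15 * x ^ 3 * ((17 - 136 * x + 408 * x ^ 2 - 640 * x ^ 3 + 560 * x ^ 4) / (x ^ 5 * (2 * x - 1) ^ 4)))"
    unfolding summand_fact edge_coeff_def x_def[symmetric] f by (simp add: power_mult_distrib)
  also have "- 15 * x ^ 3 * ((17 - 136 * x + 408 * x ^ 2 - 640 * x ^ 3 + 560 * x ^ 4) / (x ^ 5 * (2 * x - 1) ^ 4))
     = - 255 * p\<^sup>2 - 1080 * q\<^sup>2 - 1440 * q ^ 3 - 360 * q ^ 4"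
    unfolding p_def q_def using x by (simp add: divide_simps; simp add: algebra_simps eval_nat_numeral)
  finally have t: "15 * summand (Suc n) = edge_coeff n * (- 255 * p\<^sup>2 - 1080 * q\<^sup>2 - 1440 * q ^ 3 - 360 * q ^ 4)" .
  show ?thesis
    unfolding t term_Q1 term_Q2 term_Q3 term_D1 term_D2 term_D3 x_def[symmetric]
    unfolding p_def[symmetric] q_def[symmetric]
    by (simp add: algebra_simps add_divide_distrib diff_divide_distrib)
qed

text \<open>Geometric decay with ratio \<open>1/6\<close> is enough for absolute convergence; the true ratio is \<open>1/27\<close>.\<close>
lemma six_power_fact_le: "6 ^ n * fact n ^ 3 \<le> (fact (3 * n) :: real)"
proof (induction n)
  case (Suc n)
  have "6 * (1 + real n) ^ 3 \<le> (3 + 3 * real n) * (2 + 3 * real n) * (1 + 3 * real n)"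
    by (simp add: power3_eq_cube algebra_simps)
  from mult_mono[OF Suc.IH this] have "(6 ^ n * fact n ^ 3) * (6 * (1 + real n) ^ 3) \<le> fact (3 * n) * ((3 + 3 * real n) * (2 + 3 * real n) * (1 + 3 * real n))"
    by simp
  also have "\<dots> = fact (3 * Suc n)"
  proof -
    have "3 * Suc n = Suc (Suc (Suc (3 * n)))" by simp
    thus ?thesis by (simp only: fact_Suc) (simp add: algebra_simps)
  qed
  finally show ?case by (simp add: power_mult_distrib mult_ac)
qed simp

lemma summand_summable: "summable (\<lambda>n. \<bar>summand (Suc n)\<bar>)"
proof (rule summable_comparison_test'[where N = 0])
  show "summable (\<lambda>n. 1761 * (1/6) ^ Suc n :: real)"
    by (intro summable_mult) (simp add: summable_Suc_iff summable_geometric)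
  fix n :: nat
  define x where "x = real (Suc n)"
  have x: "x \<ge> 1" by (simp add: x_def)
  have a: "fact (Suc n) ^ 3 / fact (3 * Suc n) \<le> (1/6 :: real) ^ Suc n"
    using six_power_fact_le[of "Suc n"] by (simp add: power_divide divide_simps mult_ac del: fact_Suc mult_Suc_right power_Suc)
  have b: "\<bar>(17 - 136 * x + 408 * x ^ 2 - 640 * x ^ 3 + 560 * x ^ 4) / (x ^ 5 * (2 * x - 1) ^ 4)\<bar> \<le> 1761"
  proof -
    have p: "1 \<le> x ^ 4" "x \<le> x ^ 4" "x ^ 2 \<le> x ^ 4" "x ^ 3 \<le> x ^ 4"
      using x power_increasing[of 1 4 x] power_increasing[of 2 4 x] power_increasing[of 3 4 x] by (auto simp: one_le_power)
    have pp: "0 \<le> x ^ 2" "0 \<le> x ^ 3" using x by auto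
    have "\<bar>17 - 136 * x + 408 * x ^ 2 - 640 * x ^ 3 + 560 * x ^ 4\<bar> \<le> 1761 * x ^ 4"
      using p pp x by (intro abs_leI) linarith+
    also have "\<dots> \<le> 1761 * (x ^ 5 * (2 * x - 1) ^ 4)"
    proof -
      have "x ^ 4 * 1 \<le> x ^ 5 * (2 * x - 1) ^ 4"
        using x by (intro mult_mono power_increasing one_le_power) auto
      thus ?thesis by simp
    qed
    finally show ?thesis using x by (simp add: abs_mult field_simps)
  qed
  have "\<bar>summand (Suc n)\<bar> = fact (Suc n) ^ 3 / fact (3 * Suc n) * \<bar>(17 - 136 * x + 408 * x ^ 2 - 640 * x ^ 3 + 560 * x ^ 4) / (x ^ 5 * (2 * x - 1) ^ 4)\<bar>"
    unfolding summand_fact x_def by (simp add: abs_mult power_abs del: fact_Suc mult_Suc_right of_nat_Suc)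
  also have "\<dots> \<le> (1/6) ^ Suc n * 1761" by (intro mult_mono a b) auto
  finally show "norm \<bar>summand (Suc n)\<bar> \<le> 1761 * (1/6) ^ Suc n" by simp
qed

definition prod_sum_Q :: "real \<Rightarrow> real \<Rightarrow> nat \<Rightarrow> real" where
  "prod_sum_Q d b r = (d ^ r + (-b) ^ r - (d - b) ^ r) * ((1/2) ^ r * zeta_nat r) + (d ^ r + b ^ r - (d + b) ^ r) * ((1 - (1/2) ^ r) * zeta_nat r)"

definition prod_sum_D :: "real \<Rightarrow> real \<Rightarrow> real \<Rightarrow> nat \<Rightarrow> real" where
  "prod_sum_D a u v r = (a ^ r + (a - u - v) ^ r - (a - u) ^ r - (a - v) ^ r) * ((1/2) ^ r * zeta_nat r)
     + ((a - u - v) ^ r + (a - 2 * u) ^ r + (a - 2 * v) ^ r - (a - u) ^ r - (a - v) ^ r - (a - 2 * u - 2 * v) ^ r) * ((1 - (1/2) ^ r) * zeta_nat r)"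

lemma family_Q:
  assumes c: "\<bar>d\<bar> \<le> 10" "\<bar>b\<bar> \<le> 10" "\<bar>d - b\<bar> \<le> 10" "\<bar>d + b\<bar> \<le> 10" and nz: "d \<noteq> 0" "b \<noteq> 0"
  shows "(\<lambda>n. fps_nth (F_Q d b n (Suc n) + G_Q d b n (Suc n)) 3) sums (2 * (prod_sum_Q d b 5 / 5 - prod_sum_Q d b 2 * prod_sum_Q d b 3 / 6) / (b * d))"
proof -
  have "(\<Sum>m. fps_nth (F_Q d b 0 (Suc m)) 3) = 2 * (prod_sum_Q d b 5 / 5 - prod_sum_Q d b 2 * prod_sum_Q d b 3 / 6) / (b * d)"
    unfolding prod_sum_Q_def by (rule row_sum_Q[OF c nz even_sums odd_sums]) auto
  with edge_sums_Q[OF c] show ?thesis by simp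
qed

lemma family_D:
  assumes c: "\<bar>a\<bar> \<le> 10" "\<bar>u\<bar> \<le> 10" "\<bar>v\<bar> \<le> 10" "\<bar>a - u\<bar> \<le> 10" "\<bar>a - v\<bar> \<le> 10" and c': "\<bar>a - 2 * u - 2 * v\<bar> \<le> 10"
    and nz: "u \<noteq> 0" "v \<noteq> 0"
  shows "(\<lambda>n. fps_nth (F_D a u v n (2 * n + 1) + G_D a u v n (2 * n + 1) + F_D a u v (Suc n) (2 * n + 2)) 3)
     sums ((prod_sum_D a u v 5 / 5 - prod_sum_D a u v 2 * prod_sum_D a u v 3 / 6) / (u * v))"
proof -
  have "(\<Sum>m. fps_nth (F_D a u v 0 (Suc m)) 3) = (prod_sum_D a u v 5 / 5 - prod_sum_D a u v 2 * prod_sum_D a u v 3 / 6) / (u * v)"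
    unfolding prod_sum_D_def by (rule row_sum_D[OF c nz even_sums odd_sums]) auto
  with edge_sums_D[OF c c'] show ?thesis by simp
qed

lemma summand_sums: "(\<lambda>n. summand (Suc n)) sums (180 * zeta_nat 5 - 112 * (zeta_nat 2 * zeta_nat 3))"
proof -
  have "(\<lambda>n. 15 * summand (Suc n)) sums
   (- 56 * (2 * (prod_sum_Q (-4) 1 5 / 5 - prod_sum_Q (-4) 1 2 * prod_sum_Q (-4) 1 3 / 6) / (1 * - 4))
    + 280 * (2 * (prod_sum_Q (-2) 1 5 / 5 - prod_sum_Q (-2) 1 2 * prod_sum_Q (-2) 1 3 / 6) / (1 * - 2))
    - 64 * (2 * (prod_sum_Q 1 1 5 / 5 - prod_sum_Q 1 1 2 * prod_sum_Q 1 1 3 / 6) / (1 * 1))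
    + 4 * ((prod_sum_D 5 (-2) 5 5 / 5 - prod_sum_D 5 (-2) 5 2 * prod_sum_D 5 (-2) 5 3 / 6) / (- 2 * 5))
    - 7 * ((prod_sum_D 0 1 1 5 / 5 - prod_sum_D 0 1 1 2 * prod_sum_D 0 1 1 3 / 6) / (1 * 1))
    + 98 * ((prod_sum_D 0 2 (-1) 5 / 5 - prod_sum_D 0 2 (-1) 2 * prod_sum_D 0 2 (-1) 3 / 6) / (2 * - 1)))"
    unfolding combination by (intro sums_add sums_diff sums_mult family_Q family_D) simp_all
  also have "(- 56 * (2 * (prod_sum_Q (-4) 1 5 / 5 - prod_sum_Q (-4) 1 2 * prod_sum_Q (-4) 1 3 / 6) / (1 * - 4))
    + 280 * (2 * (prod_sum_Q (-2) 1 5 / 5 - prod_sum_Q (-2) 1 2 * prod_sum_Q (-2) 1 3 / 6) / (1 * - 2))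
    - 64 * (2 * (prod_sum_Q 1 1 5 / 5 - prod_sum_Q 1 1 2 * prod_sum_Q 1 1 3 / 6) / (1 * 1))
    + 4 * ((prod_sum_D 5 (-2) 5 5 / 5 - prod_sum_D 5 (-2) 5 2 * prod_sum_D 5 (-2) 5 3 / 6) / (- 2 * 5))
    - 7 * ((prod_sum_D 0 1 1 5 / 5 - prod_sum_D 0 1 1 2 * prod_sum_D 0 1 1 3 / 6) / (1 * 1))
    + 98 * ((prod_sum_D 0 2 (-1) 5 / 5 - prod_sum_D 0 2 (-1) 2 * prod_sum_D 0 2 (-1) 3 / 6) / (2 * - 1)))
    = 15 * (180 * zeta_nat 5 - 112 * (zeta_nat 2 * zeta_nat 3))"
    unfolding prod_sum_Q_def prod_sum_D_def by (simp add: power_divide field_simps)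
  finally have "(\<lambda>n. 15 * summand (Suc n)) sums (15 * (180 * zeta_nat 5 - 112 * (zeta_nat 2 * zeta_nat 3)))" .
  from sums_mult[OF this, of "1/15"] show ?thesis by (simp add: diff_divide_distrib)
qed

theorem mainTheorem1:
  "((\<lambda>n::nat. (-1/27)^n * ((pochhammer 1 n)\<^sup>2 / (pochhammer (1/3) n * pochhammer (2/3) n)) *
      ((17 - 136 * real n + 408 * real n ^ 2 - 640 * real n ^ 3 + 560 * real n ^ 4)
        / (real n ^ 5 * (2 * real n - 1) ^ 4)))
    has_sum (180 * zeta 5 - 56 * pi\<^sup>2 * zeta 3 / 3)) {1..}"
proof -
  have "(summand has_sum (180 * zeta_nat 5 - 112 * (zeta_nat 2 * zeta_nat 3))) {1..}"
    by (rule has_sum_from_1[OF summand_sums summand_summable])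
  also have "180 * zeta_nat 5 - 112 * (zeta_nat 2 * zeta_nat 3) = 180 * zeta 5 - 56 * pi\<^sup>2 * zeta 3 / 3"
    using zeta_eq_zeta_nat[of 5] zeta_eq_zeta_nat[of 3] by (simp add: zeta_nat_2)
  finally show ?thesis unfolding summand_def[abs_def] .
qed

end
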